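(* Let $k$ be a positive integer. Let $\mathcal{T}^{A_1\cdots A_k\to B}$ be a completely positive trace non-increasing superoperator, with Choi state \[ \tau^{A'_1\cdots A'_kB}:=(\mathcal{T}^{A_1\cdots A_k\to B}\otimes\mathbb{I}^{A'_1\cdots A'_k})(\Phi^{A'_1A_1}\otimes\cdots\otimes\Phi^{A'_kA_k}). \] Let $\rho^{A_1\cdots A_kR}$ be a subnormalised density matrix. For unitary matrices $U^{A_1},\ldots,U^{A_k}$ on their respective Hilbert spaces, put $U:=U^{A_1}\otimes\cdots\otimes U^{A_k}\otimes1^R$ and define the unitarily perturbed state \[ \sigma^{BR}(U^{A_1},\ldots,U^{A_k}):=(\mathcal{T}\otimes\mathbb{I}^R)\big(U\,\rho^{A_1\cdots A_kR}\,U^\dagger\big). \] For any subset $S\subseteq[k]$, let $A_S:=\bigotimes_{s\in S}A_s$, $A'_S:=\bigotimes_{s\in S}A'_s$, and $D_S:=2^{|S|-1}\prod_{s\in S}(1-|A_s|^{-2})^{-1/2}$. Let $0<\epsilon<1$. Then \[ \mathbb{E}_{U^{A_1},\ldots,U^{A_k}}\big[\|\sigma^{BR}(U^{A_1},\ldots,U^{A_k})-\tau^B\otimes\rho^R\|_1\big]\le2(3^k-1)\epsilon+\sum_{\emptyset\ne S\subseteq[k]}2^{|S|}D_S\cdot2^{-\frac12H_2^\epsilon(A_S|R)_\rho-\frac12H_2^\epsilon(A'_S|B)_\tau}, \] where the expectation is over independent choices of the unitaries $U^{A_1},\ldots,U^{A_k}$ from their respective Haar measures.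
   Context: All Hilbert spaces are finite dimensional; $|A|$ denotes the dimension of a Hilbert space $A$ (with $|A_s|\ge2$ so that $D_S$ is defined), and $|S|$ the cardinality of a set $S$; logarithms are base 2. $\mathbb{I}$ is the identity superoperator, $1^R$ the identity matrix. A subnormalised density matrix is a positive semidefinite matrix of trace at most one. $A'$ is a Hilbert space of the same dimension as $A$, and the EPR state is $\Phi^{A'A}:=|A|^{-1}\sum_{a_1,a_2=1}^{|A|}|a_1,a_1\rangle\langle a_2,a_2|^{A'A}$. Marginals are partial traces. $\|\cdot\|_p$ is the Schatten-$\ell_p$ norm; negative powers of positive semidefinite matrices are taken on the support. For a subnormalised density matrix $\alpha$ and a positive semidefinite $\beta$ on the same space, $D_2(\alpha\|\beta):=2\log\|\beta^{-1/4}\alpha\beta^{-1/4}\|_2$ if $\mathrm{supp}(\alpha)\subseteq\mathrm{supp}(\beta)$, and $+\infty$ otherwise. For $0<\epsilon<1$, $D_2^\epsilon(\alpha\|\beta):=\min_{\alpha'}D_2(\alpha'\|\beta)$ over all subnormalised density matrices $\alpha'$ with $\|\alpha'-\alpha\|_1\le\epsilon\,(\mathrm{Tr}\,\alpha)$. The smooth conditional Rényi-2 entropy is $H_2^\epsilon(A|R)_\rho:=-D_2^\epsilon(\rho^{AR}\|1^A\otimes\rho^R)$. *)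

theory Defs
  imports "HOL-Probability.Probability"
begin

text \<open>
  A finite-dimensional Hilbert space is given by a finite set \<open>I\<close> labelling an orthonormal basis
  of it, and an operator on it by its matrix in that basis, extended by \<open>0\<close> outside \<open>I \<times> I\<close>; thus
  operators on \<open>I\<close> agree iff they are equal as functions. The tensor product of the spaces \<open>I\<close> and
  \<open>J\<close> is \<open>I \<times> J\<close>, and that of a family \<open>A s\<close> (\<open>s \<in> S\<close>) is \<open>PiE S A\<close>.
\<close>

type_synonym 'i oper = "'i \<Rightarrow> 'i \<Rightarrow> complex"
type_synonym ('i, 'j) superoper = "'i oper \<Rightarrow> 'j oper"

definition vecs :: "'i set \<Rightarrow> ('i \<Rightarrow> complex) set" where
  "vecs I = {v. \<forall>i. i \<notin> I \<longrightarrow> v i = 0}"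

definition opers :: "'i set \<Rightarrow> 'i oper set" where
  "opers I = {M. \<forall>i j. i \<notin> I \<or> j \<notin> I \<longrightarrow> M i j = 0}"

definition inner_on :: "'i set \<Rightarrow> ('i \<Rightarrow> complex) \<Rightarrow> ('i \<Rightarrow> complex) \<Rightarrow> complex" where
  "inner_on I v w = (\<Sum>i\<in>I. cnj (v i) * w i)"

definition apply_op :: "'i set \<Rightarrow> 'i oper \<Rightarrow> ('i \<Rightarrow> complex) \<Rightarrow> ('i \<Rightarrow> complex)" where
  "apply_op I M v = (\<lambda>i. \<Sum>j\<in>I. M i j * v j)"

definition mult_op :: "'i set \<Rightarrow> 'i oper \<Rightarrow> 'i oper \<Rightarrow> 'i oper" where
  "mult_op I M N = (\<lambda>i j. \<Sum>l\<in>I. M i l * N l j)"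

definition adj :: "'i oper \<Rightarrow> 'i oper" where
  "adj M = (\<lambda>i j. cnj (M j i))"

definition diag_op :: "'i set \<Rightarrow> ('i \<Rightarrow> complex) \<Rightarrow> 'i oper" where
  "diag_op I d = (\<lambda>i j. if i \<in> I \<and> i = j then d i else 0)"

definition id_op :: "'i set \<Rightarrow> 'i oper" where
  "id_op I = diag_op I (\<lambda>_. 1)"

definition trace_op :: "'i set \<Rightarrow> 'i oper \<Rightarrow> complex" where
  "trace_op I M = (\<Sum>i\<in>I. M i i)"

definition unitaries :: "'i set \<Rightarrow> 'i oper set" where
  "unitaries I = {U \<in> opers I. mult_op I U (adj U) = id_op I \<and> mult_op I (adj U) U = id_op I}"

definition psd :: "'i set \<Rightarrow> 'i oper \<Rightarrow> bool" where
  "psd I M \<longleftrightarrow> M \<in> opers I \<and> adj M = M \<and>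
     (\<forall>v\<in>vecs I. 0 \<le> Re (inner_on I v (apply_op I M v)))"

definition subnormalised :: "'i set \<Rightarrow> 'i oper \<Rightarrow> bool" where
  "subnormalised I M \<longleftrightarrow> psd I M \<and> Re (trace_op I M) \<le> 1"

text \<open>The support of a Hermitian operator: the orthogonal complement of its kernel.\<close>

definition supp_op :: "'i set \<Rightarrow> 'i oper \<Rightarrow> ('i \<Rightarrow> complex) set" where
  "supp_op I M =
     {v \<in> vecs I. \<forall>w\<in>vecs I. apply_op I M w = (\<lambda>_. 0) \<longrightarrow> inner_on I w v = 0}"

text \<open>
  Real powers of a positive semidefinite operator via the spectral theorem. The result does not
  depend on the diagonalisation. As \<open>0 powr p = 0\<close>, negative powers are taken on the support.
\<close>

definition powr_op :: "'i set \<Rightarrow> 'i oper \<Rightarrow> real \<Rightarrow> 'i oper" where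
  "powr_op I M p = (THE N. \<exists>U\<in>unitaries I. \<exists>d :: 'i \<Rightarrow> real.
     M = mult_op I U (mult_op I (diag_op I (\<lambda>i. of_real (d i))) (adj U)) \<and>
     N = mult_op I U (mult_op I (diag_op I (\<lambda>i. of_real (d i powr p))) (adj U)))"

definition schatten_norm :: "'i set \<Rightarrow> real \<Rightarrow> 'i oper \<Rightarrow> real" where
  "schatten_norm I p M =
     Re (trace_op I (powr_op I (mult_op I (adj M) M) (p / 2))) powr (1 / p)"

definition tensor_op :: "'i oper \<Rightarrow> 'j oper \<Rightarrow> ('i \<times> 'j) oper" where
  "tensor_op M N = (\<lambda>(i, j) (i', j'). M i i' * N j j')"

definition tensor_fam ::
    "nat set \<Rightarrow> (nat \<Rightarrow> 'a set) \<Rightarrow> (nat \<Rightarrow> 'a oper) \<Rightarrow> (nat \<Rightarrow> 'a) oper" where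
  "tensor_fam S A M =
     (\<lambda>f g. if f \<in> PiE S A \<and> g \<in> PiE S A then \<Prod>s\<in>S. M s (f s) (g s) else 0)"

definition swap_op :: "('i \<times> 'j) oper \<Rightarrow> ('j \<times> 'i) oper" where
  "swap_op M = (\<lambda>(j, i) (j', i'). M (i, j) (i', j'))"

text \<open>Marginal on the second factor: the first one is traced out.\<close>

definition marginal_snd :: "'i set \<Rightarrow> ('i \<times> 'j) oper \<Rightarrow> 'j oper" where
  "marginal_snd I M = (\<lambda>j j'. \<Sum>i\<in>I. M (i, j) (i, j'))"

text \<open>
  For an operator on the tensor product of the \<open>A s\<close> (\<open>s \<in> K\<close>) with a further space, the marginal
  on the factors \<open>s \<in> S\<close> and that further space, where \<open>S \<subseteq> K\<close>.
\<close>

definition marginal_fam ::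
    "nat set \<Rightarrow> nat set \<Rightarrow> (nat \<Rightarrow> 'a set) \<Rightarrow> ((nat \<Rightarrow> 'a) \<times> 'r) oper \<Rightarrow> ((nat \<Rightarrow> 'a) \<times> 'r) oper"
  where
  "marginal_fam K S A M = (\<lambda>(f, r) (g, r').
     if f \<in> PiE S A \<and> g \<in> PiE S A
     then \<Sum>h\<in>PiE (K - S) A. M (merge S (K - S) (f, h), r) (merge S (K - S) (g, h), r')
     else 0)"

definition superoperator :: "'i set \<Rightarrow> 'j set \<Rightarrow> ('i, 'j) superoper \<Rightarrow> bool" where
  "superoperator I J T \<longleftrightarrow> (\<forall>M\<in>opers I. T M \<in> opers J) \<and>
     (\<forall>M\<in>opers I. \<forall>N\<in>opers I. T (\<lambda>i j. M i j + N i j) = (\<lambda>i j. T M i j + T N i j)) \<and>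
     (\<forall>M\<in>opers I. \<forall>c. T (\<lambda>i j. c * M i j) = (\<lambda>i j. c * T M i j))"

text \<open>The superoperator \<open>T \<otimes> \<bbbI>\<close>, which applies \<open>T\<close> to each block \<open>\<langle>r|M|r'\<rangle>\<close> of its argument.\<close>

definition ext_superop :: "('i, 'j) superoper \<Rightarrow> ('i \<times> 'r, 'j \<times> 'r) superoper" where
  "ext_superop T M = (\<lambda>(j, r) (j', r'). T (\<lambda>i i'. M (i, r) (i', r')) j j')"

definition completely_positive :: "'i set \<Rightarrow> 'j set \<Rightarrow> ('i, 'j) superoper \<Rightarrow> bool" where
  "completely_positive I J T \<longleftrightarrow>
     (\<forall>n :: nat. \<forall>M. psd (I \<times> {..<n}) M \<longrightarrow> psd (J \<times> {..<n}) (ext_superop T M))"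

definition trace_nonincreasing :: "'i set \<Rightarrow> 'j set \<Rightarrow> ('i, 'j) superoper \<Rightarrow> bool" where
  "trace_nonincreasing I J T \<longleftrightarrow>
     (\<forall>M. psd I M \<longrightarrow> Re (trace_op J (T M)) \<le> Re (trace_op I M))"

definition epr :: "'a set \<Rightarrow> ('a \<times> 'a) oper" where
  "epr X = (\<lambda>(a\<^sub>1, a\<^sub>1') (a\<^sub>2, a\<^sub>2').
     if a\<^sub>1 \<in> X \<and> a\<^sub>2 \<in> X \<and> a\<^sub>1 = a\<^sub>1' \<and> a\<^sub>2 = a\<^sub>2' then 1 / of_nat (card X) else 0)"

text \<open>
  The product of the EPR states of the \<open>A s\<close>, as an operator on \<open>PiE S A \<times> PiE S A\<close>: all unprimed
  copies come first, followed by all primed copies.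
\<close>

definition epr_fam :: "nat set \<Rightarrow> (nat \<Rightarrow> 'a set) \<Rightarrow> ((nat \<Rightarrow> 'a) \<times> (nat \<Rightarrow> 'a)) oper" where
  "epr_fam S A = (\<lambda>(f, f') (g, g').
     if {f, f', g, g'} \<subseteq> PiE S A then \<Prod>s\<in>S. epr (A s) (f s, f' s) (g s, g' s) else 0)"

text \<open>The Choi state, with the primed systems in front of the output system.\<close>

definition choi ::
    "nat set \<Rightarrow> (nat \<Rightarrow> 'a set) \<Rightarrow> (nat \<Rightarrow> 'a, 'b) superoper \<Rightarrow> ((nat \<Rightarrow> 'a) \<times> 'b) oper" where
  "choi K A T = swap_op (ext_superop T (epr_fam K A))"

definition elog2 :: "real \<Rightarrow> ereal" where
  "elog2 x = (if 0 < x then ereal (log 2 x) else -\<infinity>)"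

definition exp2 :: "ereal \<Rightarrow> ennreal" where
  "exp2 x = (if x = \<infinity> then \<infinity> else if x = -\<infinity> then 0 else ennreal (2 powr real_of_ereal x))"

definition D2 :: "'i set \<Rightarrow> 'i oper \<Rightarrow> 'i oper \<Rightarrow> ereal" where
  "D2 I \<alpha> \<beta> =
     (if supp_op I \<alpha> \<subseteq> supp_op I \<beta>
      then 2 * elog2 (schatten_norm I 2
             (mult_op I (powr_op I \<beta> (-1/4)) (mult_op I \<alpha> (powr_op I \<beta> (-1/4)))))
      else \<infinity>)"

text \<open>The infimum is attained: \<open>\<alpha>'\<close> ranges over a compact set, on which \<open>D2\<close> is lower
  semicontinuous.\<close>

definition D2_smooth :: "real \<Rightarrow> 'i set \<Rightarrow> 'i oper \<Rightarrow> 'i oper \<Rightarrow> ereal" where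
  "D2_smooth \<epsilon> I \<alpha> \<beta> =
     (INF \<alpha>' \<in> {\<alpha>'. subnormalised I \<alpha>' \<and>
                  schatten_norm I 1 (\<alpha>' - \<alpha>) \<le> \<epsilon> * Re (trace_op I \<alpha>)}. D2 I \<alpha>' \<beta>)"

text \<open>\<open>H2_smooth \<epsilon> I J \<rho>\<close> is the entropy of the first system \<open>I\<close> conditioned on the second one.\<close>

definition H2_smooth :: "real \<Rightarrow> 'i set \<Rightarrow> 'j set \<Rightarrow> ('i \<times> 'j) oper \<Rightarrow> ereal" where
  "H2_smooth \<epsilon> I J \<rho> =
     - D2_smooth \<epsilon> (I \<times> J) \<rho> (tensor_op (id_op I) (marginal_snd I \<rho>))"

definition D_const :: "(nat \<Rightarrow> 'a set) \<Rightarrow> nat set \<Rightarrow> real" where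
  "D_const A S = 2 powi (int (card S) - 1) *
     (\<Prod>s\<in>S. (1 - real (card (A s)) powi (-2)) powr (-1/2))"

text \<open>
  The Haar probability measure on the unitary group, a measure on its Borel sets. On operators,
  \<open>borel\<close> refers to the topology of entrywise convergence.
\<close>

definition haar_measure :: "'i set \<Rightarrow> 'i oper measure \<Rightarrow> bool" where
  "haar_measure I \<mu> \<longleftrightarrow> prob_space \<mu> \<and>
     space \<mu> = unitaries I \<and> sets \<mu> = sets (restrict_space borel (unitaries I)) \<and>
     (\<forall>V\<in>unitaries I. distr \<mu> \<mu> (mult_op I V) = \<mu> \<and> distr \<mu> \<mu> (\<lambda>U. mult_op I U V) = \<mu>)"

text \<open>The state \<open>(T \<otimes> \<bbbI>\<^sup>R) (U \<rho> U\<^sup>\<dagger>)\<close> with \<open>U\<close> the product of the \<open>U s\<close> (\<open>s \<in> K\<close>) and \<open>1\<^sup>R\<close>.\<close>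

definition perturbed ::
    "nat set \<Rightarrow> (nat \<Rightarrow> 'a set) \<Rightarrow> 'r set \<Rightarrow> (nat \<Rightarrow> 'a, 'b) superoper \<Rightarrow>
     ((nat \<Rightarrow> 'a) \<times> 'r) oper \<Rightarrow> (nat \<Rightarrow> 'a oper) \<Rightarrow> ('b \<times> 'r) oper" where
  "perturbed K A R T \<rho> U =
     (let I = PiE K A \<times> R; W = tensor_op (tensor_fam K A U) (id_op R)
      in ext_superop T (mult_op I W (mult_op I \<rho> (adj W))))"

end

theory Submission
  imports Defs "Jordan_Normal_Form.Spectral_Radius"
begin

text \<open>
  On each system write the conjugation \<open>X \<mapsto> U X U\<^sup>\<dagger>\<close> as the full depolarisation \<open>E\<close> plus a fluctuation.
  Expanding the tensor product of these sums over the systems gives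
  \<open>\<sigma>(U) - \<tau>\<^sup>B \<otimes> \<rho>\<^sup>R = \<Sum>\<^sub>S M\<^sub>S(U)\<close>, summed over nonempty \<open>S\<close>, where \<open>M\<^sub>S\<close> is the fluctuation on the systems in
  \<open>S\<close>. As \<open>E\<close> discards the other systems, \<open>M\<^sub>S\<close> depends only on the marginals \<open>\<tau>\<^sub>S\<close> and \<open>\<rho>\<^sub>S\<close>, bilinearly;
  hence the marginals can be smoothed separately for each \<open>S\<close>.

  The smoothing error is bounded through the expansion of the fluctuation into the \<open>2^|S|\<close> products of
  conjugations and depolarisations, all of them completely positive: only the first moment of the Haar
  measure enters. For the smoothed operators, the trace norm is bounded by a Hilbert-Schmidt norm weighted
  with the fourth roots of the marginals on \<open>B\<close> and \<open>R\<close>. Its mean square follows from the covariance of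
  \<open>U X U\<^sup>\<dagger>\<close> for one system, since a covariance bound tensorises over independent systems.
\<close>

subsection \<open>Spectral theorem\<close>

text \<open>A smoothed marginal of the Choi state need not be the Choi state of a trace
  non-increasing map. Images are therefore written as bilinear contractions of a kernel with two
  matrices \<open>t\<close> and \<open>x\<close> (\<open>contract\<close>), of which only
  positivity, traces and \<open>D2\<close> values are used. Complete positivity becomes positivity
  of the kernel, and the bound becomes a statement about Gram matrices. The entropies weight the
  smoothed operators with the marginals of the unsmoothed ones. Pulling fourth roots of these out of
  \<open>t\<close> and \<open>x\<close> leaves a weight whose square has Hilbert-Schmidt norm at
  most 1, since the marginals have trace at most 1. Origin of the constants: \<open>t\<close> and
  \<open>x\<close> are replaced one after the other, each at cost 2^|S| \<epsilon>, and 2 * 2^|S|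
  sums to 2 (3^k - 1) over nonempty S. The smoothed term carries the square root of the product of 2
  / (1 - |A_s|^-2), which stays below 2^|S| D_S. Two analytic points are bypassed: trace norms are
  integrated through measurable majorants, and the infimum in the smooth entropy is approached with
  a slack \<eta> that is removed at the end.\<close>

lemma mult_op_assoc: "mult_op I (mult_op I L M) N = mult_op I L (mult_op I M N)"
  unfolding mult_op_def fun_eq_iff
  by (auto simp: sum_distrib_left sum_distrib_right mult.assoc intro: sum.swap)

lemma adj_mult_op: "adj (mult_op I M N) = mult_op I (adj N) (adj M)"
  by (auto simp: mult_op_def adj_def fun_eq_iff mult.commute)

lemma mult_op_opers: "M \<in> opers I \<Longrightarrow> N \<in> opers I \<Longrightarrow> mult_op I M N \<in> opers I"
  by (auto simp: mult_op_def opers_def)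

lemma adj_opers: "M \<in> opers I \<Longrightarrow> adj M \<in> opers I"
  by (auto simp: adj_def opers_def)

lemma mult_id_op:
  assumes "finite I" "M \<in> opers I"
  shows "mult_op I (id_op I) M = M" "mult_op I M (id_op I) = M"
proof -
  have "(\<Sum>l\<in>I. id_op I i l * M l j) = M i j" for i j
    using assms sum.delta[of I i "\<lambda>l. M l j"]
    by (cases "i \<in> I") (auto simp: id_op_def diag_op_def opers_def if_distrib[of "\<lambda>x. x * _"] cong: if_cong)
  moreover have "(\<Sum>l\<in>I. M i l * id_op I l j) = M i j" for i j
  proof -
    have "(\<Sum>l\<in>I. M i l * id_op I l j) = (\<Sum>l\<in>I. if l = j then M i j else 0)"
      by (intro sum.cong) (auto simp: id_op_def diag_op_def)
    then show ?thesis using assms by (auto simp: opers_def)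
  qed
  ultimately show "mult_op I (id_op I) M = M" "mult_op I M (id_op I) = M"
    by (auto simp: mult_op_def fun_eq_iff)
qed

lemma unitaries_mult:
  assumes "finite I" "U \<in> unitaries I" "V \<in> unitaries I"
  shows "mult_op I U V \<in> unitaries I"
proof -
  have o: "U \<in> opers I" "V \<in> opers I" "adj U \<in> opers I" "adj V \<in> opers I"
    using assms by (auto simp: unitaries_def adj_opers)
  have "mult_op I (mult_op I U V) (mult_op I (adj V) (adj U)) = mult_op I U (mult_op I (mult_op I V (adj V)) (adj U))"
    by (simp add: mult_op_assoc)
  moreover have "mult_op I (mult_op I (adj V) (adj U)) (mult_op I U V) = mult_op I (adj V) (mult_op I (mult_op I (adj U) U) V)"
    by (simp add: mult_op_assoc)
  ultimately show ?thesis
    using assms o by (auto simp: unitaries_def adj_mult_op mult_id_op mult_op_opers)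
qed

text \<open>Enumerating \<open>I\<close> turns \<open>M\<close> into a square matrix of positive
  size, whose spectrum over the complex numbers is nonempty; the eigenvector is carried back along
  the enumeration and extended by 0.\<close>

lemma eigenvector_exists:
  fixes M :: "'i oper"
  assumes "finite I" "I \<noteq> {}" "M \<in> opers I"
  shows "\<exists>v\<in>vecs I. v \<noteq> (\<lambda>_. 0) \<and> (\<exists>c. \<forall>i. apply_op I M v i = c * v i)"
proof -
  define n where "n = card I"
  have "n > 0" using assms by (auto simp: n_def card_gt_0_iff)
  obtain h where h: "bij_betw h {0..<n} I"
    using ex_bij_betw_nat_finite[OF assms(1)] by (auto simp: n_def)
  define X where "X = Matrix.mat n n (\<lambda>(i,j). M (h i) (h j))"
  have X: "X \<in> carrier_mat n n" by (simp add: X_def)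
  from spectrum_non_empty[OF X \<open>n > 0\<close>] obtain c where "eigenvalue X c"
    by (auto simp: spectrum_def)
  then obtain v where v: "v \<in> carrier_vec n" "v \<noteq> 0\<^sub>v n" "X *\<^sub>v v = c \<cdot>\<^sub>v v"
    by (auto simp: eigenvalue_def eigenvector_def X_def)
  define g where "g = the_inv_into {0..<n} h"
  have gh: "g (h i) = i" if "i < n" for i
    using h that by (auto simp: g_def bij_betw_def the_inv_into_f_f)
  define w where "w = (\<lambda>i. if i \<in> I then v $ (g i) else 0)"
  have hI: "h i \<in> I" if "i < n" for i using h that by (auto simp: bij_betw_def)
  have "w \<in> vecs I" by (simp add: w_def vecs_def)
  moreover have "w \<noteq> (\<lambda>_. 0)"
  proof
    assume *: "w = (\<lambda>_. 0)"
    have "v $ i = 0" if "i < n" for i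
      using fun_cong[OF *, of "h i"] gh[OF that] hI[OF that] by (simp add: w_def)
    then have "v = 0\<^sub>v n" using v(1) by (intro eq_vecI) auto
    with v(2) show False by simp
  qed
  moreover have "apply_op I M w i = c * w i" for i
  proof (cases "i \<in> I")
    case False
    then show ?thesis using assms by (auto simp: apply_op_def w_def opers_def)
  next
    case True
    then obtain a where a: "a < n" "i = h a" using h by (auto simp: bij_betw_def)
    have "apply_op I M w i = (\<Sum>b\<in>{0..<n}. M i (h b) * w (h b))"
      unfolding apply_op_def by (rule sum.reindex_bij_betw[OF h, symmetric])
    also have "\<dots> = (\<Sum>b\<in>{0..<n}. M i (h b) * v $ b)"
      by (intro sum.cong) (auto simp: w_def gh hI)
    also have "\<dots> = (X *\<^sub>v v) $ a"
      using v(1) a by (simp add: X_def scalar_prod_def)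
    also have "\<dots> = c * w i" using a v gh hI by (simp add: w_def)
    finally show ?thesis .
  qed
  ultimately show ?thesis by blast
qed

definition spectral_op :: "'i set \<Rightarrow> 'i oper \<Rightarrow> ('i \<Rightarrow> real) \<Rightarrow> 'i oper" where
  "spectral_op I U d = (\<lambda>i j. \<Sum>l\<in>I. U i l * of_real (d l) * cnj (U j l))"

lemma spec_eq:
  assumes "finite I"
  shows "mult_op I U (mult_op I (diag_op I (\<lambda>i. of_real (d i))) (adj U)) = spectral_op I U d"
proof -
  have "(\<Sum>l\<in>I. diag_op I (\<lambda>i. of_real (d i)) k l * cnj (U j l)) = of_real (d k) * cnj (U j k)"
    if "k \<in> I" for k j
  proof -
    have "(\<Sum>l\<in>I. diag_op I (\<lambda>i. of_real (d i)) k l * cnj (U j l)) =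
      (\<Sum>l\<in>I. if k = l then of_real (d k) * cnj (U j k) else 0)"
      using that by (intro sum.cong) (auto simp: diag_op_def)
    then show ?thesis using assms that by simp
  qed
  then show ?thesis
    by (auto simp: spectral_op_def mult_op_def adj_def fun_eq_iff mult.assoc intro!: sum.cong)
qed

lemma unitaries_sum:
  assumes "U \<in> unitaries I" "i \<in> I" "j \<in> I"
  shows "(\<Sum>l\<in>I. U i l * cnj (U j l)) = (if i = j then 1 else 0)"
    and "(\<Sum>l\<in>I. cnj (U l i) * U l j) = (if i = j then 1 else 0)"
proof -
  have "mult_op I U (adj U) i j = id_op I i j" "mult_op I (adj U) U i j = id_op I i j"
    using assms by (auto simp: unitaries_def)
  then show "(\<Sum>l\<in>I. U i l * cnj (U j l)) = (if i = j then 1 else 0)"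
    "(\<Sum>l\<in>I. cnj (U l i) * U l j) = (if i = j then 1 else 0)"
    using assms(2) by (auto simp: mult_op_def adj_def id_op_def diag_op_def)
qed

lemma unitariesI:
  assumes "U \<in> opers I"
    and "\<And>i j. i \<in> I \<Longrightarrow> j \<in> I \<Longrightarrow> (\<Sum>l\<in>I. U i l * cnj (U j l)) = (if i = j then 1 else 0)"
    and "\<And>i j. i \<in> I \<Longrightarrow> j \<in> I \<Longrightarrow> (\<Sum>l\<in>I. cnj (U l i) * U l j) = (if i = j then 1 else 0)"
  shows "U \<in> unitaries I"
proof -
  have "mult_op I U (adj U) i j = id_op I i j" for i j
    using assms(1) assms(2)[of i j]
    by (cases "i \<in> I"; cases "j \<in> I") (auto simp: mult_op_def adj_def id_op_def diag_op_def opers_def)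
  moreover have "mult_op I (adj U) U i j = id_op I i j" for i j
    using assms(1) assms(3)[of i j]
    by (cases "i \<in> I"; cases "j \<in> I") (auto simp: mult_op_def adj_def id_op_def diag_op_def opers_def)
  ultimately show ?thesis using assms(1) by (auto simp: unitaries_def fun_eq_iff)
qed

text \<open>The reflection along \<open>w = e - u\<close>, where \<open>u\<close> is the normalised
  multiple of \<open>v\<close> with real \<open>x\<close> entry, exchanges \<open>e\<close> and
  \<open>u\<close>. It serves twice: to split off an eigenvector in the spectral theorem, and to mix
  two rows of a random unitary in \<open>mom4_diag\<close>.\<close>

lemma householder_exists:
  fixes v :: "'i \<Rightarrow> complex"
  assumes I: "finite I" "x \<in> I" and v: "v \<in> vecs I" "v \<noteq> (\<lambda>_. 0)"
  shows "\<exists>H\<in>unitaries I. adj H = H \<and> (\<exists>c. c \<noteq> 0 \<and> (\<forall>i. H i x = c * v i))"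
proof -
  define N where "N = (\<Sum>i\<in>I. (cmod (v i))\<^sup>2)"
  have N: "N > 0"
  proof -
    obtain i where "v i \<noteq> 0" using v(2) by auto
    moreover from this v(1) have "i \<in> I" by (auto simp: vecs_def)
    ultimately show ?thesis unfolding N_def using I(1) by (intro sum_pos2[of _ i]) auto
  qed
  \<comment> \<open>The phase makes the \<open>x\<close> entry real, so that the reflection below maps \<open>e\<^sub>x\<close> to \<open>u\<close>.\<close>
  define ph where "ph = (if v x = 0 then 1 else cnj (v x) / of_real (cmod (v x)))"
  have ph: "cmod ph = 1" by (auto simp: ph_def norm_divide)
  define c where "c = ph / of_real (sqrt N)"
  have "c \<noteq> 0" using ph N by (auto simp: c_def)
  define u where "u = (\<lambda>i. c * v i)"
  have nu: "(\<Sum>i\<in>I. (cmod (u i))\<^sup>2) = 1"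
    using N ph unfolding u_def c_def N_def
    by (simp add: norm_mult norm_divide power_mult_distrib power_divide sum_divide_distrib[symmetric]
        sum_distrib_left[symmetric] real_sqrt_pow2)
  have "ph * v x = of_real (cmod (v x))"
    by (auto simp: ph_def mult.commute[of "cnj _"] complex_norm_square[symmetric] power2_eq_square)
  then have ux: "u x = of_real (cmod (v x) / sqrt N)"
    unfolding u_def c_def by (metis of_real_divide times_divide_eq_left)
  then have uxr: "cnj (u x) = u x" by simp
  define e where "e = (\<lambda>i. if i = x then 1 else 0 :: complex)"
  define w where "w = (\<lambda>i. e i - u i)"
  have uI: "u i = 0" if "i \<notin> I" for i using v(1) that by (auto simp: u_def vecs_def)
  have wI: "w i = 0" if "i \<notin> I" for i using uI[OF that] that I by (auto simp: w_def e_def)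
  have nuc: "(\<Sum>i\<in>I. u i * cnj (u i)) = 1"
    using nu by (simp add: complex_norm_square[symmetric] flip: of_real_power of_real_sum)
  have ue: "(\<Sum>i\<in>I. e i * f i) = f x" for f
    using I by (auto simp: e_def if_distrib[of "\<lambda>y. y * _"] cong: if_cong)
  have ecnj: "cnj (e i) = e i" for i by (simp add: e_def)
  have ww: "(\<Sum>i\<in>I. w i * cnj (w i)) = 2 - 2 * u x"
  proof -
    have "(\<Sum>i\<in>I. w i * cnj (w i)) = (\<Sum>i\<in>I. e i * e i) - (\<Sum>i\<in>I. e i * cnj (u i)) - (\<Sum>i\<in>I. e i * u i)
       + (\<Sum>i\<in>I. u i * cnj (u i))"
      by (simp add: w_def ecnj algebra_simps sum.distrib sum_subtractf)
    also have "\<dots> = 2 - 2 * u x" by (simp add: ue nuc uxr) (simp add: e_def)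
    finally show ?thesis .
  qed
  define K where "K = (\<Sum>i\<in>I. (cmod (w i))\<^sup>2)"
  have K: "of_real K = 2 - 2 * u x"
    using ww unfolding K_def by (simp only: of_real_sum complex_norm_square)
  \<comment> \<open>The coefficient 2 / |w|^2 of the reflection. If \<open>w = 0\<close>, then
    \<open>2 / 0 = 0\<close> makes \<open>H\<close> the identity, which is correct because
    \<open>u = e\<close> in that case.\<close>
  define q :: complex where "q = of_real (2 / K)"
  have cq: "cnj q = q" by (simp add: q_def)
  define H where "H = (\<lambda>i j. id_op I i j - q * w i * cnj (w j))"
  have KK: "q * (q * of_real K) = 2 * q"
    by (cases "K = 0") (auto simp: q_def)
  have wK: "(\<Sum>i\<in>I. w i * cnj (w i)) = of_real K"
    using ww K by simp
  have idsum: "(\<Sum>l\<in>I. id_op I i l * f l) = (if i \<in> I then f i else 0)" for i f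
    using I(1) sum.delta[of I i f]
    by (auto simp: id_op_def diag_op_def if_distrib[of "\<lambda>y. y * _"] cong: if_cong)
  have idc: "cnj (id_op I i j) = id_op I j i" for i j
    by (auto simp: id_op_def diag_op_def)
  have adjH: "adj H = H"
    by (auto simp: adj_def H_def fun_eq_iff idc cq mult.commute mult.left_commute)
  have HH: "(\<Sum>l\<in>I. H i l * cnj (H j l)) = (if i = j then 1 else 0)" if "i \<in> I" "j \<in> I" for i j
  proof -
    have "id_op I l j = id_op I j l" for l by (auto simp: id_op_def diag_op_def)
    then have "(\<Sum>l\<in>I. H i l * cnj (H j l)) = (\<Sum>l\<in>I. id_op I i l * id_op I l j)
      - (\<Sum>l\<in>I. id_op I i l * (q * cnj (w j) * w l))
      - (\<Sum>l\<in>I. id_op I j l * (q * w i * cnj (w l)))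
      + (q * q) * (w i * cnj (w j)) * (\<Sum>l\<in>I. w l * cnj (w l))"
      by (simp add: H_def idc cq algebra_simps sum.distrib sum_subtractf sum_distrib_left)
    also have "\<dots> = id_op I i j - 2 * q * (w i * cnj (w j)) + (q * (q * of_real K)) * (w i * cnj (w j))"
      unfolding idsum wK using that by (simp add: algebra_simps)
    also have "\<dots> = id_op I i j" unfolding KK by simp
    finally show ?thesis using that by (simp add: id_op_def diag_op_def)
  qed
  have Ho: "H \<in> opers I"
    using wI by (auto simp: opers_def H_def id_op_def diag_op_def)
  have sym: "H l i = cnj (H i l)" for i l using fun_cong[OF fun_cong[OF adjH, of l], of i] by (simp add: adj_def)
  have "(\<Sum>l\<in>I. cnj (H l i) * H l j) = (if i = j then 1 else 0)" if "i \<in> I" "j \<in> I" for i j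
    using HH[OF that] by (simp add: sym[of _ i] sym[of _ j])
  with HH Ho have "H \<in> unitaries I" by (intro unitariesI) auto
  moreover have "H i x = u i" for i
  proof (cases "K = 0")
    case True
    then have "\<forall>i\<in>I. w i = 0" using I(1) by (simp add: K_def sum_nonneg_eq_0_iff)
    then have "w i = 0" for i using wI by blast
    then have "u i = e i" for i unfolding w_def by (metis eq_iff_diff_eq_0)
    moreover have "q = 0" using True by (simp add: q_def)
    ultimately show ?thesis using I(2) by (auto simp: H_def id_op_def diag_op_def e_def)
  next
    case False
    have "cnj (w x) = of_real K / 2" by (simp add: w_def e_def uxr K)
    then have "q * cnj (w x) = q * (of_real K / 2)" by (simp only:)
    also have "\<dots> = 1" using False by (simp add: q_def)
    finally have "q * cnj (w x) = 1" .
    then have "q * w i * cnj (w x) = w i" by (simp add: mult.assoc mult.left_commute)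
    moreover have "H i x = e i - q * w i * cnj (w x)"
      using I(2) by (auto simp: H_def id_op_def diag_op_def e_def)
    ultimately have "H i x = e i - w i" by (simp only:)
    then show ?thesis by (simp add: w_def)
  qed
  ultimately show ?thesis using adjH \<open>c \<noteq> 0\<close> by (auto simp: u_def intro!: bexI[of _ H])
qed

text \<open>Deflation by induction on the basis: conjugation with a self-inverse unitary whose
  column \<open>x\<close> is an eigenvector decouples the basis vector \<open>x\<close> from the
  rest, and the induction hypothesis diagonalises what remains on \<open>I0\<close>.\<close>

theorem spectral_theorem:
  fixes M :: "'i oper"
  assumes "finite I" "M \<in> opers I" "adj M = M"
  shows "\<exists>U\<in>unitaries I. \<exists>d. M = spectral_op I U d"
  using assms
proof (induction I arbitrary: M rule: finite_induct)
  case empty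
  \<comment> \<open>On the empty index set the only operator is 0; it is also unitary there, so
    \<open>M\<close> can be its own diagonalising unitary.\<close>
  then have "M = spectral_op {} M (\<lambda>_. 0)" by (auto simp: opers_def spectral_op_def)
  moreover have "M \<in> unitaries {}" using empty by (intro unitariesI) auto
  ultimately show ?case by blast
next
  case (insert x I0)
  let ?I = "insert x I0"
  have fin: "finite ?I" using insert by simp
  obtain v c where v: "v \<in> vecs ?I" "v \<noteq> (\<lambda>_. 0)" "\<And>i. apply_op ?I M v i = c * v i"
    using eigenvector_exists[OF fin _ insert.prems(1)] by blast
  obtain H a where H: "H \<in> unitaries ?I" "adj H = H" "a \<noteq> 0" "\<And>i. H i x = a * v i"
    using householder_exists[OF fin _ v(1,2), of x] by blast
  have Ho: "H \<in> opers ?I" and H2: "mult_op ?I H H = id_op ?I"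
    using H(1,2) by (auto simp: unitaries_def)
  define M' where "M' = mult_op ?I H (mult_op ?I M H)"
  have M'o: "M' \<in> opers ?I" unfolding M'_def by (intro mult_op_opers Ho insert.prems)
  have M'a: "adj M' = M'" unfolding M'_def adj_mult_op by (simp add: H insert.prems mult_op_assoc)
  have "mult_op ?I M H i x = c * H i x" for i
  proof -
    have "mult_op ?I M H i x = a * apply_op ?I M v i"
      unfolding mult_op_def apply_op_def by (simp only: H(4) sum_distrib_left mult.left_commute)
    then show ?thesis by (simp add: v(3) H(4))
  qed
  then have "M' i x = c * mult_op ?I H H i x" for i
    unfolding M'_def mult_op_def[of _ H] by (simp only: sum_distrib_left mult.left_commute)
  then have M'x: "M' i x = (if i = x then c else 0)" for i
    unfolding H2 by (auto simp: id_op_def diag_op_def)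
  have adjM': "M' i j = cnj (M' j i)" for i j using fun_cong[OF fun_cong[OF M'a, of i], of j] by (simp add: adj_def)
  \<comment> \<open>Hermiticity carries the zeros of column \<open>x\<close> over to row
    \<open>x\<close>, so that \<open>M'\<close> splits into the eigenvalue \<open>c\<close> and an
    operator on \<open>I0\<close>.\<close>
  have xM': "M' x i = (if i = x then c else 0)" for i
    using adjM'[of x i] M'x[of i] M'x[of x] adjM'[of x x] by (cases "i = x") auto
  have creal: "c = of_real (Re c)" using adjM'[of x x] M'x[of x] by (auto simp: complex_eq_iff)
  define M0 where "M0 = (\<lambda>i j. if i \<in> I0 \<and> j \<in> I0 then M' i j else 0)"
  have "M0 \<in> opers I0" "adj M0 = M0"
    by (auto simp: M0_def opers_def adj_def fun_eq_iff adjM'[symmetric])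
  from insert.IH[OF this] obtain U0 d0 where U0: "U0 \<in> unitaries I0" "M0 = spectral_op I0 U0 d0" by blast
  have U0o: "U0 i j = 0" if "i \<notin> I0 \<or> j \<notin> I0" for i j
    using U0(1) that by (auto simp: unitaries_def opers_def)
  define U1 where "U1 = (\<lambda>i j. if i = x \<and> j = x then 1 else U0 i j)"
  define d1 where "d1 = d0(x := Re c)"
  have sx: "(\<Sum>l\<in>?I. f l) = f x + (\<Sum>l\<in>I0. f l)" for f :: "'i \<Rightarrow> complex"
    using insert.hyps by simp
  have U1x: "U1 i l = U0 i l" "l \<noteq> x" if "l \<in> I0" for i l using that insert.hyps by (auto simp: U1_def)
  have U1x': "U1 i x = (if i = x then 1 else 0)" "U1 x i = (if i = x then 1 else 0)" for i
    using U0o insert.hyps by (auto simp: U1_def)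
  have U1: "U1 \<in> unitaries ?I"
  proof (rule unitariesI)
    show "U1 \<in> opers ?I" using U0o by (auto simp: opers_def U1_def)
  next
    fix i j assume "i \<in> ?I" "j \<in> ?I"
    then show "(\<Sum>l\<in>?I. U1 i l * cnj (U1 j l)) = (if i = j then 1 else 0)"
      unfolding sx using unitaries_sum(1)[OF U0(1), of i j] U0o insert.hyps
      by (cases "i = x"; cases "j = x") (auto simp: U1x' U1x U1_def cong: sum.cong)
  next
    fix i j assume "i \<in> ?I" "j \<in> ?I"
    then show "(\<Sum>l\<in>?I. cnj (U1 l i) * U1 l j) = (if i = j then 1 else 0)"
      unfolding sx using unitaries_sum(2)[OF U0(1), of i j] U0o insert.hyps
      by (cases "i = x"; cases "j = x") (auto simp: U1x' U1x U1_def cong: sum.cong)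
  qed
  have "M' i j = spectral_op ?I U1 d1 i j" for i j
  proof -
    have "spectral_op ?I U1 d1 i j = U1 i x * of_real (Re c) * cnj (U1 j x) + spectral_op I0 U0 d0 i j"
      unfolding spectral_op_def sx by (simp add: U1x d1_def cong: sum.cong)
    also have "\<dots> = (if i = x \<and> j = x then c else 0) + M0 i j"
      using creal by (auto simp: U1x' U0(2))
    also have "\<dots> = M' i j"
    proof (cases "i \<in> ?I \<and> j \<in> ?I")
      case True
      then show ?thesis using M'x xM' insert.hyps by (auto simp: M0_def)
    next
      case False
      then have "M' i j = 0" using M'o unfolding opers_def by blast
      then show ?thesis using False by (auto simp: M0_def)
    qed
    finally show ?thesis by simp
  qed
  then have M': "M' = mult_op ?I U1 (mult_op ?I (diag_op ?I (\<lambda>i. of_real (d1 i))) (adj U1))"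
    unfolding spec_eq[OF fin] by (simp add: fun_eq_iff)
  have "M = mult_op ?I (mult_op ?I H H) (mult_op ?I M (mult_op ?I H H))"
    unfolding H2 using mult_id_op[OF fin insert.prems(1)] by simp
  also have "\<dots> = mult_op ?I H (mult_op ?I M' H)"
    by (simp add: M'_def mult_op_assoc)
  also have "\<dots> = spectral_op ?I (mult_op ?I H U1) d1"
    unfolding spec_eq[OF fin, symmetric] M' adj_mult_op H(2) by (simp add: mult_op_assoc)
  finally show ?case using unitaries_mult[OF fin H(1) U1] by blast
qed

lemma sum_swap4:
  "(\<Sum>i\<in>A. \<Sum>j\<in>B. \<Sum>k\<in>C. \<Sum>m\<in>D. f i j k m) = (\<Sum>k\<in>C. \<Sum>m\<in>D. \<Sum>i\<in>A. \<Sum>j\<in>B. f i j k m)"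
proof -
  have "(\<Sum>i\<in>A. \<Sum>j\<in>B. \<Sum>k\<in>C. \<Sum>m\<in>D. f i j k m) = (\<Sum>i\<in>A. \<Sum>k\<in>C. \<Sum>j\<in>B. \<Sum>m\<in>D. f i j k m)"
    by (rule sum.cong[OF refl], rule sum.swap)
  also have "\<dots> = (\<Sum>k\<in>C. \<Sum>i\<in>A. \<Sum>j\<in>B. \<Sum>m\<in>D. f i j k m)" by (rule sum.swap)
  also have "\<dots> = (\<Sum>k\<in>C. \<Sum>i\<in>A. \<Sum>m\<in>D. \<Sum>j\<in>B. f i j k m)"
    by (rule sum.cong[OF refl], rule sum.cong[OF refl], rule sum.swap)
  also have "\<dots> = (\<Sum>k\<in>C. \<Sum>m\<in>D. \<Sum>i\<in>A. \<Sum>j\<in>B. f i j k m)"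
    by (rule sum.cong[OF refl], rule sum.swap)
  finally show ?thesis .
qed

section \<open>Functional calculus of Hermitian operators\<close>

lemma spec_opers: "U \<in> opers I \<Longrightarrow> spectral_op I U d \<in> opers I"
  by (auto simp: spectral_op_def opers_def)

lemma unitaries_opers: "U \<in> unitaries I \<Longrightarrow> U \<in> opers I"
  by (simp add: unitaries_def)

lemma adj_spec: "adj (spectral_op I U d) = spectral_op I U d"
  by (simp add: adj_def spectral_op_def mult_ac)

lemma spec_cong: "(\<And>l. l \<in> I \<Longrightarrow> d l = e l) \<Longrightarrow> spectral_op I U d = spectral_op I U e"
  by (simp add: spectral_op_def)

lemma spec_intertwine_right:
  assumes "finite I" "U \<in> unitaries I" "k \<in> I"
  shows "(\<Sum>j\<in>I. spectral_op I U d i j * U j k) = U i k * of_real (d k)"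
proof -
  have "(\<Sum>j\<in>I. spectral_op I U d i j * U j k)
      = (\<Sum>l\<in>I. U i l * of_real (d l) * (\<Sum>j\<in>I. cnj (U j l) * U j k))"
    unfolding spectral_op_def sum_distrib_left sum_distrib_right
    by (subst sum.swap) (simp add: mult.assoc)
  also have "\<dots> = (\<Sum>l\<in>I. if l = k then U i k * of_real (d k) else 0)"
    using assms by (intro sum.cong) (auto simp: unitaries_sum)
  finally show ?thesis using assms by simp
qed

lemma spec_intertwine_left:
  assumes "finite I" "U \<in> unitaries I" "k \<in> I"
  shows "(\<Sum>i\<in>I. cnj (U i k) * spectral_op I U d i j) = of_real (d k) * cnj (U j k)"
proof -
  have s: "spectral_op I U d i j = cnj (spectral_op I U d j i)" for i
    using fun_cong[OF fun_cong[OF adj_spec[of I U d], of i], of j] by (simp add: adj_def)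
  have "(\<Sum>i\<in>I. cnj (U i k) * spectral_op I U d i j) = cnj (\<Sum>i\<in>I. spectral_op I U d j i * U i k)"
    by (subst s) (simp add: mult.commute)
  then show ?thesis unfolding spec_intertwine_right[OF assms] by simp
qed

text \<open>The matrix \<open>W\<close> of \<open>V\<^sup>\<dagger> U\<close> intertwines the two
  diagonal matrices, so its entry at \<open>k\<close>, \<open>l\<close> vanishes unless
  \<open>d l = e k\<close>. Hence it intertwines their images under any \<open>f\<close> as well.
  This makes the definite description in \<open>powr_op\<close> meaningful.\<close>

lemma spec_fun_unique:
  assumes I: "finite I" and U: "U \<in> unitaries I" and V: "V \<in> unitaries I"
    and eq: "spectral_op I U d = spectral_op I V e"
  shows "spectral_op I U (\<lambda>i. f (d i)) = spectral_op I V (\<lambda>i. f (e i))"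
proof -
  define W where "W = (\<lambda>k l. \<Sum>i\<in>I. cnj (V i k) * U i l)"
  have W: "W k l * of_real (d l) = of_real (e k) * W k l" if "k \<in> I" "l \<in> I" for k l
  proof -
    have "W k l * of_real (d l) = (\<Sum>i\<in>I. cnj (V i k) * (U i l * of_real (d l)))"
      by (simp add: W_def sum_distrib_right mult.assoc)
    also have "\<dots> = (\<Sum>i\<in>I. \<Sum>j\<in>I. cnj (V i k) * (spectral_op I V e i j * U j l))"
      unfolding spec_intertwine_right[OF I U that(2), symmetric] eq by (simp add: sum_distrib_left)
    also have "\<dots> = (\<Sum>j\<in>I. (\<Sum>i\<in>I. cnj (V i k) * spectral_op I V e i j) * U j l)"
      by (subst sum.swap) (simp add: sum_distrib_right mult.assoc)
    also have "\<dots> = of_real (e k) * W k l"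
      unfolding spec_intertwine_left[OF I V that(1)] by (simp add: W_def sum_distrib_left mult.assoc)
    finally show ?thesis .
  qed
  have Wf: "W k l * of_real (f (d l)) = of_real (f (e k)) * W k l" if "k \<in> I" "l \<in> I" for k l
    using W[OF that] by (cases "W k l = 0") (auto simp: mult.commute)
  have UVW: "U i l = (\<Sum>k\<in>I. V i k * W k l)" if "i \<in> I" for i l
  proof -
    have "(\<Sum>k\<in>I. V i k * W k l) = (\<Sum>m\<in>I. (\<Sum>k\<in>I. V i k * cnj (V m k)) * U m l)"
      unfolding W_def sum_distrib_left sum_distrib_right by (subst sum.swap) (simp add: mult.assoc)
    also have "\<dots> = (\<Sum>m\<in>I. if i = m then U m l else 0)"
      using that by (intro sum.cong) (auto simp: unitaries_sum[OF V])
    finally show ?thesis using that I by simp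
  qed
  have WU: "(\<Sum>l\<in>I. W k l * cnj (U j l)) = cnj (V j k)" if "j \<in> I" for j k
  proof -
    have "(\<Sum>l\<in>I. W k l * cnj (U j l)) = (\<Sum>m\<in>I. cnj (V m k) * (\<Sum>l\<in>I. U m l * cnj (U j l)))"
      unfolding W_def sum_distrib_left sum_distrib_right by (subst sum.swap) (simp add: mult.assoc)
    also have "\<dots> = (\<Sum>m\<in>I. if m = j then cnj (V m k) else 0)"
      using that by (intro sum.cong) (auto simp: unitaries_sum[OF U])
    finally show ?thesis using that I by simp
  qed
  have "spectral_op I U (\<lambda>i. f (d i)) i j = spectral_op I V (\<lambda>i. f (e i)) i j" if "i \<in> I" "j \<in> I" for i j
  proof -
    have "spectral_op I U (\<lambda>i. f (d i)) i j = (\<Sum>l\<in>I. \<Sum>k\<in>I. V i k * (W k l * of_real (f (d l))) * cnj (U j l))"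
      unfolding spectral_op_def using that by (simp add: UVW[symmetric] sum_distrib_right[symmetric] mult.assoc[symmetric])
    also have "\<dots> = (\<Sum>l\<in>I. \<Sum>k\<in>I. V i k * (of_real (f (e k)) * W k l) * cnj (U j l))"
      by (intro sum.cong refl) (simp add: Wf)
    also have "\<dots> = (\<Sum>k\<in>I. V i k * of_real (f (e k)) * (\<Sum>l\<in>I. W k l * cnj (U j l)))"
      by (subst sum.swap) (simp add: sum_distrib_left mult.assoc)
    finally show ?thesis using that by (simp add: WU spectral_op_def)
  qed
  moreover have "spectral_op I U (\<lambda>i. f (d i)) i j = spectral_op I V (\<lambda>i. f (e i)) i j" if "i \<notin> I \<or> j \<notin> I" for i j
    using that unitaries_opers[OF U] unitaries_opers[OF V] by (auto simp: spectral_op_def opers_def)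
  ultimately show ?thesis by (auto simp: fun_eq_iff)
qed

lemma powr_op_spec:
  assumes "finite I" "U \<in> unitaries I"
  shows "powr_op I (spectral_op I U d) p = spectral_op I U (\<lambda>i. d i powr p)"
  unfolding powr_op_def spec_eq[OF assms(1)]
proof (rule the_equality)
  show "\<exists>V\<in>unitaries I. \<exists>e. spectral_op I U d = spectral_op I V e \<and> spectral_op I U (\<lambda>i. d i powr p) = spectral_op I V (\<lambda>i. e i powr p)"
    using assms by blast
next
  fix N
  assume "\<exists>V\<in>unitaries I. \<exists>e. spectral_op I U d = spectral_op I V e \<and> N = spectral_op I V (\<lambda>i. e i powr p)"
  then obtain V e where "V \<in> unitaries I" "spectral_op I U d = spectral_op I V e" "N = spectral_op I V (\<lambda>i. e i powr p)" by blast
  then show "N = spectral_op I U (\<lambda>i. d i powr p)"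
    using spec_fun_unique[OF assms, of V d e "\<lambda>x. x powr p"] by simp
qed

lemma spec_mult:
  assumes "finite I" "U \<in> unitaries I"
  shows "mult_op I (spectral_op I U d) (spectral_op I U e) = spectral_op I U (\<lambda>i. d i * e i)"
proof -
  have "(\<Sum>m\<in>I. spectral_op I U d i m * spectral_op I U e m j) = spectral_op I U (\<lambda>i. d i * e i) i j" for i j
  proof -
    have "(\<Sum>m\<in>I. spectral_op I U d i m * spectral_op I U e m j)
        = (\<Sum>k\<in>I. (\<Sum>m\<in>I. spectral_op I U d i m * U m k) * of_real (e k) * cnj (U j k))"
      unfolding spectral_op_def[of I U e] sum_distrib_left sum_distrib_right
      by (subst sum.swap) (simp add: mult.assoc)
    also have "\<dots> = (\<Sum>k\<in>I. U i k * of_real (d k) * of_real (e k) * cnj (U j k))"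
      using spec_intertwine_right[OF assms] by (intro sum.cong) auto
    finally show ?thesis by (simp add: spectral_op_def mult.assoc)
  qed
  then show ?thesis by (simp add: mult_op_def fun_eq_iff)
qed

lemma trace_spec:
  assumes "U \<in> unitaries I"
  shows "trace_op I (spectral_op I U d) = of_real (\<Sum>l\<in>I. d l)"
proof -
  have "trace_op I (spectral_op I U d) = (\<Sum>l\<in>I. of_real (d l) * (\<Sum>i\<in>I. cnj (U i l) * U i l))"
    unfolding trace_op_def spectral_op_def sum_distrib_left by (subst sum.swap) (simp add: mult_ac)
  also have "\<dots> = (\<Sum>l\<in>I. of_real (d l))"
    using assms by (intro sum.cong) (auto simp: unitaries_sum)
  finally show ?thesis by simp
qed

lemma spec_eigenvalue:
  assumes "finite I" "U \<in> unitaries I" "l \<in> I"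
  shows "(\<Sum>i\<in>I. \<Sum>j\<in>I. cnj (U i l) * spectral_op I U d i j * U j l) = of_real (d l)"
proof -
  have "(\<Sum>i\<in>I. \<Sum>j\<in>I. cnj (U i l) * spectral_op I U d i j * U j l)
     = (\<Sum>i\<in>I. cnj (U i l) * (\<Sum>j\<in>I. spectral_op I U d i j * U j l))"
    by (simp add: sum_distrib_left mult.assoc)
  also have "\<dots> = (\<Sum>i\<in>I. cnj (U i l) * U i l) * of_real (d l)"
    unfolding spec_intertwine_right[OF assms] by (simp add: sum_distrib_right mult.assoc)
  finally show ?thesis using assms by (simp add: unitaries_sum)
qed

lemma psd_quadratic_form:
  assumes "psd I P"
  shows "0 \<le> Re (\<Sum>i\<in>I. \<Sum>j\<in>I. cnj (v i) * P i j * v j)"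
proof -
  define w where "w = (\<lambda>i. if i \<in> I then v i else 0)"
  have "w \<in> vecs I" by (simp add: w_def vecs_def)
  then have "0 \<le> Re (inner_on I w (apply_op I P w))" using assms by (simp add: psd_def)
  also have "inner_on I w (apply_op I P w) = (\<Sum>i\<in>I. \<Sum>j\<in>I. cnj (v i) * P i j * v j)"
    by (simp add: inner_on_def apply_op_def w_def sum_distrib_left mult.assoc)
  finally show ?thesis .
qed

lemma psd_spec_nonneg:
  assumes "finite I" "U \<in> unitaries I" "l \<in> I" "psd I (spectral_op I U d)"
  shows "0 \<le> d l"
  using psd_quadratic_form[OF assms(4), of "\<lambda>i. U i l"] spec_eigenvalue[OF assms(1-3), of d] by simp

text \<open>With positive semidefinite kernels given as Gram matrices, the Schur product theorem is immediate.\<close>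

definition gram :: "'i set \<Rightarrow> 'i oper \<Rightarrow> bool" where
  "gram X k \<longleftrightarrow> (\<exists>N::nat. \<exists>u. \<forall>x\<in>X. \<forall>y\<in>X. k x y = (\<Sum>n<N. u n x * cnj (u n y)))"

lemma gramI:
  assumes "finite J" "\<And>x y. x \<in> X \<Longrightarrow> y \<in> X \<Longrightarrow> k x y = (\<Sum>n\<in>J. u n x * cnj (u n y))"
  shows "gram X k"
proof -
  obtain h where "bij_betw h {0..<card J} J" using ex_bij_betw_nat_finite[OF assms(1)] by blast
  then have h: "bij_betw h {..<card J} J" by (simp add: atLeast0LessThan)
  have "k x y = (\<Sum>n<card J. u (h n) x * cnj (u (h n) y))" if "x \<in> X" "y \<in> X" for x y
    unfolding assms(2)[OF that] by (rule sum.reindex_bij_betw[OF h, symmetric])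
  then show ?thesis unfolding gram_def by (intro exI[of _ "card J"] exI[of _ "\<lambda>n. u (h n)"]) simp
qed

lemma gram_mult:
  assumes "gram X k" "gram X l"
  shows "gram X (\<lambda>x y. k x y * l x y)"
proof -
  obtain M u where u: "\<forall>x\<in>X. \<forall>y\<in>X. k x y = (\<Sum>n<(M::nat). u n x * cnj (u n y))" using assms(1) by (auto simp: gram_def)
  obtain N v where v: "\<forall>x\<in>X. \<forall>y\<in>X. l x y = (\<Sum>n<(N::nat). v n x * cnj (v n y))" using assms(2) by (auto simp: gram_def)
  show ?thesis
  proof (rule gramI[of "{..<M} \<times> {..<N}"])
    fix x y assume "x \<in> X" "y \<in> X"
    then have "k x y * l x y = (\<Sum>m<M. u m x * cnj (u m y)) * (\<Sum>n<N. v n x * cnj (v n y))"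
      using u v by simp
    also have "\<dots> = (\<Sum>p\<in>{..<M} \<times> {..<N}. (u (fst p) x * v (snd p) x) * cnj (u (fst p) y * v (snd p) y))"
      by (simp add: sum_product sum.cartesian_product mult_ac case_prod_beta)
    finally show "k x y * l x y = (\<Sum>p\<in>{..<M} \<times> {..<N}. (\<lambda>p x. u (fst p) x * v (snd p) x) p x * cnj ((\<lambda>p x. u (fst p) x * v (snd p) x) p y))" .
  qed simp
qed

lemma gram_rank_one: "gram X (\<lambda>x y. u x * cnj (u y))"
  by (rule gramI[of "{()}" _ _ "\<lambda>_. u"]) auto

lemma gram_const: "0 \<le> c \<Longrightarrow> gram X (\<lambda>x y. complex_of_real c)"
  using gram_rank_one[of X "\<lambda>_. complex_of_real (sqrt c)"] by (simp flip: of_real_mult)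

lemma gram_prod:
  assumes "\<And>s. s \<in> S \<Longrightarrow> gram X (k s)"
  shows "gram X (\<lambda>x y. \<Prod>s\<in>S. k s x y)"
  using assms
proof (induction S rule: infinite_finite_induct)
  case (insert s S)
  then show ?case using gram_mult[of X "k s"] by simp
qed (use gram_const[of 1 X] in auto)

lemma gram_pullback:
  assumes "gram Y k" "\<And>x. x \<in> X \<Longrightarrow> h x \<in> Y"
  shows "gram X (\<lambda>x y. k (h x) (h y))"
proof -
  obtain N u where "\<forall>x\<in>Y. \<forall>y\<in>Y. k x y = (\<Sum>n<(N::nat). u n x * cnj (u n y))"
    using assms(1) by (auto simp: gram_def)
  then show ?thesis
    using assms(2) unfolding gram_def by (intro exI[of _ N] exI[of _ "\<lambda>n x. u n (h x)"]) auto
qed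

text \<open>The Gram vector of \<open>x\<close> is the basis vector labelled by
  \<open>h x\<close>.\<close>

lemma gram_delta:
  assumes "finite Y" "\<And>x. x \<in> X \<Longrightarrow> h x \<in> Y"
  shows "gram X (\<lambda>x y. if h x = h y then 1 else 0)"
proof (rule gramI[OF assms(1)])
  fix x y assume "x \<in> X" "y \<in> X"
  have "(\<Sum>n\<in>Y. (if h x = n then 1 else 0) * cnj (if h y = n then 1 else 0))
      = (\<Sum>n\<in>Y. if h x = n then if h y = h x then 1 else 0 else (0::complex))"
    by (intro sum.cong) auto
  then show "(if h x = h y then 1 else 0) = (\<Sum>n\<in>Y. (\<lambda>n x. if h x = n then 1 else 0) n x * cnj ((\<lambda>n x. if h x = n then 1 else (0::complex)) n y))"
    using assms \<open>x \<in> X\<close> by auto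
qed

lemma gram_quadratic_form:
  assumes "gram X k"
  shows "0 \<le> Re (\<Sum>x\<in>X. \<Sum>y\<in>X. cnj (v x) * k x y * v y)"
proof -
  obtain N u where u: "\<forall>x\<in>X. \<forall>y\<in>X. k x y = (\<Sum>n<(N::nat). u n x * cnj (u n y))"
    using assms by (auto simp: gram_def)
  have "(\<Sum>x\<in>X. \<Sum>y\<in>X. cnj (v x) * k x y * v y)
      = (\<Sum>x\<in>X. \<Sum>y\<in>X. \<Sum>n<N. (cnj (v x) * u n x) * (cnj (u n y) * v y))"
    using u by (intro sum.cong) (auto simp: sum_distrib_left sum_distrib_right mult_ac)
  also have "\<dots> = (\<Sum>n<N. (\<Sum>x\<in>X. cnj (v x) * u n x) * (\<Sum>y\<in>X. cnj (u n y) * v y))"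
    by (subst sum.swap[of _ "{..<N}"], subst sum.swap[of _ "{..<N}"]) (simp add: sum_product)
  also have "\<dots> = (\<Sum>n<N. of_real ((cmod (\<Sum>x\<in>X. cnj (v x) * u n x))\<^sup>2))"
    by (intro sum.cong refl) (simp add: complex_norm_square mult.commute del: of_real_power)
  finally show ?thesis by (simp add: sum_nonneg)
qed

lemma gram_hermitian:
  assumes "gram X k" "x \<in> X" "y \<in> X"
  shows "cnj (k x y) = k y x"
  using assms by (auto simp: gram_def mult.commute)

lemma psd_if_gram:
  assumes "M \<in> opers I" "gram I M"
  shows "psd I M"
proof -
  have "adj M i j = M i j" for i j
    using gram_hermitian[OF assms(2), of j i] assms(1) by (cases "i \<in> I \<and> j \<in> I") (auto simp: adj_def opers_def)
  then show ?thesis using gram_quadratic_form[OF assms(2)] assms(1)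
    by (auto simp: psd_def inner_on_def apply_op_def sum_distrib_left mult.assoc fun_eq_iff)
qed

lemma gram_spec:
  assumes "finite I" "\<And>l. l \<in> I \<Longrightarrow> 0 \<le> d l"
  shows "gram I (spectral_op I U d)"
proof (rule gramI[OF assms(1), of _ _ "\<lambda>l i. U i l * of_real (sqrt (d l))"])
  fix i j
  have "complex_of_real (d l) = of_real (sqrt (d l)) * of_real (sqrt (d l))" if "l \<in> I" for l
    using assms(2)[OF that] by (simp flip: of_real_mult)
  then show "spectral_op I U d i j = (\<Sum>l\<in>I. U i l * of_real (sqrt (d l)) * cnj (U j l * of_real (sqrt (d l))))"
    unfolding spectral_op_def by (intro sum.cong) (auto simp: mult_ac)
qed

lemma psd_spectral:
  assumes "finite I" "psd I M"
  obtains U d where "U \<in> unitaries I" "M = spectral_op I U d" "\<And>l. l \<in> I \<Longrightarrow> 0 \<le> d l"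
proof -
  obtain U d where "U \<in> unitaries I" "M = spectral_op I U d"
    using spectral_theorem[of I M] assms by (auto simp: psd_def)
  then show thesis using psd_spec_nonneg[OF assms(1), of U _ d] assms(2) that by blast
qed

text \<open>The columns of the diagonalising unitary, scaled by square roots of the eigenvalues, are
  the Gram vectors. Together with \<open>psd_if_gram\<close> this allows every later positivity
  proof to be carried out on kernels.\<close>

lemma psd_gram: "finite I \<Longrightarrow> psd I M \<Longrightarrow> gram I M"
  using gram_spec by (metis psd_spectral)

lemma psd_diag:
  assumes "psd I M" "finite I" "i \<in> I"
  shows "0 \<le> Re (M i i)" "Im (M i i) = 0"
proof -
  obtain N u where "\<forall>x\<in>I. \<forall>y\<in>I. M x y = (\<Sum>n<(N::nat). u n x * cnj (u n y))"
    using psd_gram[OF assms(2,1)] by (auto simp: gram_def)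
  then have "M i i = of_real (\<Sum>n<N. (cmod (u n i))\<^sup>2)"
    using assms(3) by (simp add: complex_norm_square del: of_real_power)
  then show "0 \<le> Re (M i i)" "Im (M i i) = 0" by (auto simp: sum_nonneg)
qed

lemma psd_trace_nonneg: "psd I M \<Longrightarrow> finite I \<Longrightarrow> 0 \<le> Re (trace_op I M)"
  by (auto simp: trace_op_def psd_diag intro!: sum_nonneg)

lemma psd_trace_real: "psd I M \<Longrightarrow> finite I \<Longrightarrow> trace_op I M = of_real (Re (trace_op I M))"
  by (auto simp: trace_op_def psd_diag complex_eq_iff)

subsection \<open>Schatten norms\<close>

definition hs :: "'i set \<Rightarrow> 'i oper \<Rightarrow> real" where
  "hs I M = (\<Sum>i\<in>I. \<Sum>j\<in>I. (cmod (M i j))\<^sup>2)"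

lemma hs_nonneg: "0 \<le> hs I M"
  by (simp add: hs_def sum_nonneg)

lemma schatten_2:
  assumes "finite I" "M \<in> opers I"
  shows "schatten_norm I 2 M = sqrt (hs I M)"
proof -
  let ?N = "mult_op I (adj M) M"
  have "gram I ?N"
    by (rule gramI[OF assms(1), of _ _ "\<lambda>l i. cnj (M l i)"]) (simp add: mult_op_def adj_def)
  then have "psd I ?N" using assms by (intro psd_if_gram mult_op_opers adj_opers)
  then obtain U d where U: "U \<in> unitaries I" "?N = spectral_op I U d" "\<And>l. l \<in> I \<Longrightarrow> 0 \<le> d l"
    using psd_spectral[OF assms(1)] by blast
  have "powr_op I ?N (2/2) = ?N"
    using U(3) unfolding U(2) powr_op_spec[OF assms(1) U(1)] by (intro spec_cong) auto
  moreover have "trace_op I ?N = of_real (hs I M)"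
    unfolding trace_op_def mult_op_def adj_def hs_def of_real_sum
    by (subst sum.swap) (simp add: complex_norm_square mult.commute del: of_real_power)
  ultimately show ?thesis using hs_nonneg[of I M] by (simp add: schatten_norm_def powr_half_sqrt)
qed

lemma schatten_1_spec:
  assumes "finite I" "U \<in> unitaries I"
  shows "schatten_norm I 1 (spectral_op I U d) = (\<Sum>l\<in>I. \<bar>d l\<bar>)"
proof -
  have "spectral_op I U (\<lambda>i. (d i * d i) powr (1/2)) = spectral_op I U (\<lambda>i. \<bar>d i\<bar>)"
    by (intro spec_cong) (simp add: powr_half_sqrt)
  then show ?thesis
    by (simp add: schatten_norm_def adj_spec spec_mult assms powr_op_spec trace_spec sum_nonneg)
qed

lemma psd_add:
  assumes "psd I P" "psd I Q"
  shows "psd I (\<lambda>i j. P i j + Q i j)"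
proof -
  have "inner_on I v (apply_op I (\<lambda>i j. P i j + Q i j) v)
      = inner_on I v (apply_op I P v) + inner_on I v (apply_op I Q v)" for v
    by (simp add: inner_on_def apply_op_def distrib_left distrib_right sum.distrib)
  then show ?thesis using assms by (auto simp: psd_def opers_def adj_def fun_eq_iff)
qed

lemma trace_add: "trace_op I (\<lambda>i j. P i j + Q i j) = trace_op I P + trace_op I Q"
  by (simp add: trace_op_def sum.distrib)

text \<open>The positive and negative spectral parts attain the bound of
  \<open>schatten_1_le_traces\<close>. The trace norm is thus handled as the least total trace of a
  decomposition into two positive operators.\<close>

lemma jordan_decomposition:
  assumes "finite I" "M \<in> opers I" "adj M = M"
  obtains P Q where "psd I P" "psd I Q" "M = (\<lambda>i j. P i j - Q i j)"
    "Re (trace_op I P) + Re (trace_op I Q) = schatten_norm I 1 M"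
proof -
  obtain U d where U: "U \<in> unitaries I" "M = spectral_op I U d"
    using spectral_theorem[OF assms] by blast
  let ?P = "spectral_op I U (\<lambda>i. max (d i) 0)" and ?Q = "spectral_op I U (\<lambda>i. max (- d i) 0)"
  have "psd I ?P" "psd I ?Q"
    using assms(1) unitaries_opers[OF U(1)] by (auto intro!: psd_if_gram spec_opers gram_spec)
  moreover have "M = (\<lambda>i j. ?P i j - ?Q i j)"
    unfolding U(2) spectral_op_def sum_subtractf[symmetric]
    by (intro ext sum.cong refl) (auto simp: max_def)
  moreover have "Re (trace_op I ?P) + Re (trace_op I ?Q) = schatten_norm I 1 M"
  proof -
    have "(\<Sum>l\<in>I. max (d l) 0) + (\<Sum>l\<in>I. max (- d l) 0) = (\<Sum>l\<in>I. \<bar>d l\<bar>)"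
      by (subst sum.distrib[symmetric], intro sum.cong) (auto simp: max_def)
    then show ?thesis unfolding U(2) by (simp add: trace_spec schatten_1_spec U(1) assms(1))
  qed
  ultimately show thesis by (rule that)
qed

text \<open>In an eigenbasis of the difference, each eigenvalue is the diagonal entry of
  \<open>P\<close> minus that of \<open>Q\<close>. Both entries are nonnegative, so its modulus is
  at most their sum, and diagonal entries add up to the trace in every orthonormal basis.\<close>

lemma schatten_1_le_traces:
  assumes "finite I" "psd I P" "psd I Q"
  shows "schatten_norm I 1 (\<lambda>i j. P i j - Q i j) \<le> Re (trace_op I P) + Re (trace_op I Q)"
proof -
  let ?M = "\<lambda>i j. P i j - Q i j"
  have "?M \<in> opers I" "adj ?M = ?M"
    using assms by (auto simp: psd_def opers_def adj_def fun_eq_iff)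
  then obtain U d where U: "U \<in> unitaries I" "?M = spectral_op I U d"
    using spectral_theorem[OF assms(1)] by blast
  define p where "p = (\<lambda>N l. Re (\<Sum>i\<in>I. \<Sum>j\<in>I. cnj (U i l) * N i j * U j l))"
  have d: "d l = p P l - p Q l" if "l \<in> I" for l
    using spec_eigenvalue[OF assms(1) U(1) that, of d, symmetric] unfolding U(2)[symmetric]
    by (simp add: p_def algebra_simps sum_subtractf complex_eq_iff)
  have tr: "(\<Sum>l\<in>I. p N l) = Re (trace_op I N)" for N
  proof -
    have "(\<Sum>l\<in>I. p N l) = Re (\<Sum>l\<in>I. \<Sum>i\<in>I. \<Sum>j\<in>I. cnj (U i l) * N i j * U j l)"
      by (simp only: p_def Re_sum)
    also have "(\<Sum>l\<in>I. \<Sum>i\<in>I. \<Sum>j\<in>I. cnj (U i l) * N i j * U j l)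
      = (\<Sum>i\<in>I. \<Sum>j\<in>I. N i j * (\<Sum>l\<in>I. U j l * cnj (U i l)))"
      unfolding sum_distrib_left
      by (subst sum.swap, rule sum.cong[OF refl], subst sum.swap) (simp add: mult_ac)
    also have "\<dots> = (\<Sum>i\<in>I. \<Sum>j\<in>I. if i = j then N i i else 0)"
      by (intro sum.cong refl) (auto simp: unitaries_sum[OF U(1)])
    also have "\<dots> = trace_op I N" using assms(1) by (simp add: trace_op_def)
    finally show ?thesis .
  qed
  have "(\<Sum>l\<in>I. \<bar>d l\<bar>) \<le> (\<Sum>l\<in>I. p P l + p Q l)"
  proof (intro sum_mono)
    fix l assume "l \<in> I"
    moreover have "0 \<le> p P l" "0 \<le> p Q l"
      unfolding p_def by (rule psd_quadratic_form[OF assms(2)], rule psd_quadratic_form[OF assms(3)])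
    ultimately show "\<bar>d l\<bar> \<le> p P l + p Q l" using d by auto
  qed
  then show ?thesis unfolding U(2) schatten_1_spec[OF assms(1) U(1)] by (simp add: sum.distrib tr)
qed

lemma schatten_1_psd:
  assumes "finite I" "psd I P"
  shows "schatten_norm I 1 P \<le> Re (trace_op I P)"
proof -
  have "psd I (\<lambda>i j. 0)" by (auto simp: psd_def opers_def adj_def inner_on_def apply_op_def)
  from schatten_1_le_traces[OF assms this] show ?thesis by (simp add: trace_op_def)
qed

text \<open>The sums of the two positive and of the two negative parts decompose the sum of the
  operators, though in general not orthogonally.\<close>

lemma schatten_1_triangle:
  assumes "finite I" "M \<in> opers I" "adj M = M" "N \<in> opers I" "adj N = N"
  shows "schatten_norm I 1 (\<lambda>i j. M i j + N i j) \<le> schatten_norm I 1 M + schatten_norm I 1 N"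
proof -
  obtain P Q where P: "psd I P" "psd I Q" "M = (\<lambda>i j. P i j - Q i j)"
    "Re (trace_op I P) + Re (trace_op I Q) = schatten_norm I 1 M"
    using jordan_decomposition[OF assms(1,2,3)] by blast
  obtain P' Q' where P': "psd I P'" "psd I Q'" "N = (\<lambda>i j. P' i j - Q' i j)"
    "Re (trace_op I P') + Re (trace_op I Q') = schatten_norm I 1 N"
    using jordan_decomposition[OF assms(1,4,5)] by blast
  have "(\<lambda>i j. M i j + N i j) = (\<lambda>i j. (P i j + P' i j) - (Q i j + Q' i j))"
    unfolding P(3) P'(3) by (simp add: algebra_simps)
  then show ?thesis
    using schatten_1_le_traces[OF assms(1) psd_add[OF P(1) P'(1)] psd_add[OF P(2) P'(2)]] P(4) P'(4)
    by (simp add: trace_add)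
qed

section \<open>Trace norm against weighted Hilbert-Schmidt norm\<close>

lemma cmod_sum_mult_le:
  fixes f g :: "'x \<Rightarrow> complex"
  shows "(cmod (\<Sum>x\<in>X. f x * g x))\<^sup>2 \<le> (\<Sum>x\<in>X. (cmod (f x))\<^sup>2) * (\<Sum>x\<in>X. (cmod (g x))\<^sup>2)"
proof -
  have "cmod (\<Sum>x\<in>X. f x * g x) \<le> (\<Sum>x\<in>X. cmod (f x) * cmod (g x))"
    using sum_norm_le[of X "\<lambda>x. f x * g x"] by (simp add: norm_mult)
  then have "(cmod (\<Sum>x\<in>X. f x * g x))\<^sup>2 \<le> (\<Sum>x\<in>X. cmod (f x) * cmod (g x))\<^sup>2"
    by (simp add: power_mono)
  also have "\<dots> \<le> (\<Sum>x\<in>X. (cmod (f x))\<^sup>2) * (\<Sum>x\<in>X. (cmod (g x))\<^sup>2)"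
    by (rule Cauchy_Schwarz_ineq_sum)
  finally show ?thesis .
qed

lemma hs_unitary:
  assumes "finite I" "U \<in> unitaries I"
  shows "(\<Sum>l\<in>I. \<Sum>m\<in>I. (cmod (\<Sum>i\<in>I. \<Sum>j\<in>I. cnj (U i l) * K i j * U j m))\<^sup>2) = hs I K"
proof -
  \<comment> \<open>Parseval's identity for one index; it is applied to the columns with
    \<open>U\<close> and to the rows with the conjugate of \<open>U\<close>.\<close>
  have col: "(\<Sum>m\<in>I. (cmod (\<Sum>j\<in>I. f j * V j m))\<^sup>2) = (\<Sum>j\<in>I. (cmod (f j))\<^sup>2)"
    if "\<And>i j. i \<in> I \<Longrightarrow> j \<in> I \<Longrightarrow> (\<Sum>l\<in>I. V i l * cnj (V j l)) = (if i = j then 1 else 0)"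
    for f and V :: "'a oper"
  proof -
    have "complex_of_real (\<Sum>m\<in>I. (cmod (\<Sum>j\<in>I. f j * V j m))\<^sup>2)
      = (\<Sum>m\<in>I. \<Sum>j\<in>I. \<Sum>k\<in>I. (f j * V j m) * cnj (f k * V k m))"
      unfolding of_real_sum by (simp add: complex_norm_square sum_product del: of_real_power)
    also have "\<dots> = (\<Sum>j\<in>I. \<Sum>k\<in>I. f j * cnj (f k) * (\<Sum>m\<in>I. V j m * cnj (V k m)))"
      unfolding sum_distrib_left
      by (subst sum.swap, rule sum.cong[OF refl], subst sum.swap) (simp add: mult_ac)
    also have "\<dots> = (\<Sum>j\<in>I. \<Sum>k\<in>I. if j = k then f j * cnj (f j) else 0)"
      by (intro sum.cong refl) (auto simp: that)
    also have "\<dots> = complex_of_real (\<Sum>j\<in>I. (cmod (f j))\<^sup>2)"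
      using assms(1) unfolding of_real_sum by (simp add: complex_norm_square del: of_real_power)
    finally show ?thesis using of_real_eq_iff by blast
  qed
  have col_cnj: "(\<Sum>m\<in>I. (cmod (\<Sum>j\<in>I. f j * cnj (U j m)))\<^sup>2) = (\<Sum>j\<in>I. (cmod (f j))\<^sup>2)" for f
  proof (rule col[of "\<lambda>j m. cnj (U j m)"])
    fix i j assume "i \<in> I" "j \<in> I"
    then have "cnj (\<Sum>l\<in>I. U i l * cnj (U j l)) = (if i = j then 1 else 0)"
      using unitaries_sum(1)[OF assms(2)] by simp
    then show "(\<Sum>l\<in>I. cnj (U i l) * cnj (cnj (U j l))) = (if i = j then 1 else 0)" by simp
  qed
  have "(\<Sum>l\<in>I. \<Sum>m\<in>I. (cmod (\<Sum>i\<in>I. \<Sum>j\<in>I. cnj (U i l) * K i j * U j m))\<^sup>2)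
      = (\<Sum>l\<in>I. \<Sum>m\<in>I. (cmod (\<Sum>j\<in>I. (\<Sum>i\<in>I. cnj (U i l) * K i j) * U j m))\<^sup>2)"
  proof -
    have "(\<Sum>i\<in>I. \<Sum>j\<in>I. cnj (U i l) * K i j * U j m) = (\<Sum>j\<in>I. (\<Sum>i\<in>I. cnj (U i l) * K i j) * U j m)" for l m
      unfolding sum_distrib_right by (rule sum.swap)
    then show ?thesis by simp
  qed
  also have "\<dots> = (\<Sum>l\<in>I. \<Sum>j\<in>I. (cmod (\<Sum>i\<in>I. cnj (U i l) * K i j))\<^sup>2)"
    by (intro sum.cong refl col) (rule unitaries_sum(1)[OF assms(2)])
  also have "\<dots> = (\<Sum>j\<in>I. \<Sum>l\<in>I. (cmod (\<Sum>i\<in>I. K i j * cnj (U i l)))\<^sup>2)"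
    by (subst sum.swap) (simp add: mult.commute)
  also have "\<dots> = (\<Sum>j\<in>I. \<Sum>i\<in>I. (cmod (K i j))\<^sup>2)"
    by (intro sum.cong refl col_cnj)
  finally show ?thesis unfolding hs_def by (subst sum.swap)
qed

text \<open>With \<open>M = G N G\<close>, write \<open>d l = \<langle>u\<^sub>l, M u\<^sub>l\<rangle>\<close> for the eigenvalues of \<open>M\<close>; the vectors \<open>c\<^sub>l = G u\<^sub>l\<close>
  have Gram matrix \<open>U\<^sup>\<dagger> G\<^sup>2 U\<close>, and Cauchy-Schwarz for the Hilbert-Schmidt product applies.\<close>

lemma schatten_1_weighted_le:
  assumes I: "finite I" and M: "M \<in> opers I" "adj M = M"
    and G: "\<And>i j. i \<in> I \<Longrightarrow> j \<in> I \<Longrightarrow> cnj (G i j) = G j i"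
    and eq: "\<And>i j. i \<in> I \<Longrightarrow> j \<in> I \<Longrightarrow> M i j = (\<Sum>k\<in>I. \<Sum>l\<in>I. G i k * N k l * G l j)"
  shows "schatten_norm I 1 M \<le> sqrt (hs I (mult_op I G G)) * sqrt (hs I N)"
proof -
  obtain U d where U: "U \<in> unitaries I" "M = spectral_op I U d"
    using spectral_theorem[OF I M] by blast
  define C where "C = (\<lambda>k l. \<Sum>i\<in>I. G k i * U i l)"
  define s where "s = (\<lambda>l. complex_of_real (sgn (d l)))"
  \<comment> \<open>Up to exchanging its indices, \<open>W\<close> is the sum of the rank-one
    operators of the \<open>c\<^sub>l\<close>, each with the sign of its eigenvalue. Pairing it with
    \<open>N\<close> yields the sum of the absolute eigenvalues, that is, the trace norm of
    \<open>M\<close>.\<close>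
  define W where "W = (\<lambda>k m. \<Sum>l\<in>I. s l * C m l * cnj (C k l))"
  have d: "of_real (d l) = (\<Sum>k\<in>I. \<Sum>m\<in>I. cnj (C k l) * N k m * C m l)" if "l \<in> I" for l
  proof -
    have "(of_real (d l) :: complex) = (\<Sum>i\<in>I. \<Sum>j\<in>I. cnj (U i l) * M i j * U j l)"
      using spec_eigenvalue[OF I U(1) that, of d] U(2) by simp
    also have "\<dots> = (\<Sum>i\<in>I. \<Sum>j\<in>I. \<Sum>k\<in>I. \<Sum>m\<in>I. (cnj (U i l) * G i k) * N k m * (G m j * U j l))"
      by (intro sum.cong refl) (simp add: eq sum_distrib_left sum_distrib_right mult_ac)
    also have "\<dots> = (\<Sum>k\<in>I. \<Sum>m\<in>I. \<Sum>i\<in>I. \<Sum>j\<in>I. (cnj (U i l) * G i k) * N k m * (G m j * U j l))"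
      by (rule sum_swap4)
    also have "\<dots> = (\<Sum>k\<in>I. \<Sum>m\<in>I. cnj (C k l) * N k m * C m l)"
      by (intro sum.cong refl) (simp add: C_def sum_distrib_left sum_distrib_right G mult_ac)
    finally show ?thesis .
  qed
  have W: "(\<Sum>k\<in>I. \<Sum>m\<in>I. (cmod (W k m))\<^sup>2) \<le> hs I (mult_op I G G)"
  proof -
    define X where "X = (\<lambda>l l'. \<Sum>k\<in>I. cnj (C k l) * C k l')"
    have cX: "cnj (X l l') = (\<Sum>k\<in>I. C k l * cnj (C k l'))" for l l'
      by (simp add: X_def)
    have X: "X l l' = (\<Sum>i\<in>I. \<Sum>j\<in>I. cnj (U i l) * mult_op I G G i j * U j l')" for l l'
    proof -
      have "X l l' = (\<Sum>k\<in>I. \<Sum>i\<in>I. \<Sum>j\<in>I. cnj (U i l) * (G i k * G k j) * U j l')"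
        unfolding X_def C_def cnj_sum sum_product by (intro sum.cong refl) (simp add: G mult_ac)
      also have "\<dots> = (\<Sum>i\<in>I. \<Sum>j\<in>I. \<Sum>k\<in>I. cnj (U i l) * (G i k * G k j) * U j l')"
        by (subst sum.swap, rule sum.cong[OF refl], rule sum.swap)
      finally show ?thesis by (simp add: mult_op_def sum_distrib_left sum_distrib_right)
    qed
    have cs: "cnj (s l) = s l" for l by (simp add: s_def)
    have "complex_of_real (\<Sum>k\<in>I. \<Sum>m\<in>I. (cmod (W k m))\<^sup>2) = (\<Sum>k\<in>I. \<Sum>m\<in>I. W k m * cnj (W k m))"
      unfolding of_real_sum by (simp add: complex_norm_square del: of_real_power)
    also have "\<dots> = (\<Sum>k\<in>I. \<Sum>m\<in>I. \<Sum>l\<in>I. \<Sum>l'\<in>I. s l * s l' * (C m l * cnj (C m l')) * (cnj (C k l) * C k l'))"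
      unfolding W_def cnj_sum sum_product by (intro sum.cong refl) (simp add: cs mult_ac)
    also have "\<dots> = (\<Sum>l\<in>I. \<Sum>l'\<in>I. \<Sum>k\<in>I. \<Sum>m\<in>I. s l * s l' * (C m l * cnj (C m l')) * (cnj (C k l) * C k l'))"
      by (rule sum_swap4)
    also have "\<dots> = (\<Sum>l\<in>I. \<Sum>l'\<in>I. s l * s l' * (X l l' * cnj (X l l')))"
    proof (intro sum.cong refl)
      fix l l'
      have "X l l' * cnj (X l l') = (\<Sum>k\<in>I. \<Sum>m\<in>I. (cnj (C k l) * C k l') * (C m l * cnj (C m l')))"
        unfolding cX unfolding X_def by (rule sum_product)
      then show "(\<Sum>k\<in>I. \<Sum>m\<in>I. s l * s l' * (C m l * cnj (C m l')) * (cnj (C k l) * C k l'))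
          = s l * s l' * (X l l' * cnj (X l l'))"
        by (simp add: sum_distrib_left mult_ac)
    qed
    also have "\<dots> = complex_of_real (\<Sum>l\<in>I. \<Sum>l'\<in>I. sgn (d l) * sgn (d l') * (cmod (X l l'))\<^sup>2)"
      unfolding of_real_sum by (simp add: s_def complex_norm_square del: of_real_power)
    finally have "(\<Sum>k\<in>I. \<Sum>m\<in>I. (cmod (W k m))\<^sup>2) = (\<Sum>l\<in>I. \<Sum>l'\<in>I. sgn (d l) * sgn (d l') * (cmod (X l l'))\<^sup>2)"
      using of_real_eq_iff by blast
    \<comment> \<open>The signs multiply squared moduli, so dropping them can only increase the sum.
      Without signs the total is the squared Hilbert-Schmidt norm of \<open>G\<^sup>2\<close> in the
      basis \<open>U\<close>.\<close>
    also have "\<dots> \<le> (\<Sum>l\<in>I. \<Sum>l'\<in>I. (cmod (X l l'))\<^sup>2)"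
      by (intro sum_mono) (auto simp: sgn_real_def)
    also have "\<dots> = hs I (mult_op I G G)" unfolding X by (rule hs_unitary[OF I U(1)])
    finally show ?thesis .
  qed
  have "(of_real (\<Sum>l\<in>I. \<bar>d l\<bar>) :: complex) = (\<Sum>l\<in>I. s l * of_real (d l))"
    by (simp add: s_def abs_sgn mult.commute flip: of_real_mult)
  also have "\<dots> = (\<Sum>l\<in>I. \<Sum>k\<in>I. \<Sum>m\<in>I. s l * (cnj (C k l) * N k m * C m l))"
    by (intro sum.cong refl) (simp add: d sum_distrib_left)
  also have "\<dots> = (\<Sum>k\<in>I. \<Sum>m\<in>I. W k m * N k m)"
    unfolding W_def sum_distrib_right
    by (subst sum.swap, rule sum.cong[OF refl], subst sum.swap) (simp add: mult_ac)
  also have "\<dots> = (\<Sum>p\<in>I\<times>I. W (fst p) (snd p) * N (fst p) (snd p))"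
    by (simp add: sum.cartesian_product case_prod_beta)
  finally have e: "(of_real (\<Sum>l\<in>I. \<bar>d l\<bar>) :: complex) = (\<Sum>p\<in>I\<times>I. W (fst p) (snd p) * N (fst p) (snd p))" .
  have "(\<Sum>l\<in>I. \<bar>d l\<bar>)\<^sup>2 = (cmod (of_real (\<Sum>l\<in>I. \<bar>d l\<bar>)))\<^sup>2"
    by (simp only: norm_of_real power2_abs)
  also have "\<dots> \<le> (\<Sum>k\<in>I. \<Sum>m\<in>I. (cmod (W k m))\<^sup>2) * hs I N"
    unfolding e using cmod_sum_mult_le[of "\<lambda>p. W (fst p) (snd p)" "\<lambda>p. N (fst p) (snd p)" "I \<times> I"]
    by (simp add: hs_def sum.cartesian_product case_prod_beta)
  also have "\<dots> \<le> hs I (mult_op I G G) * hs I N"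
    by (intro mult_right_mono W hs_nonneg)
  finally show ?thesis unfolding U(2) schatten_1_spec[OF I U(1)]
    by (simp add: real_le_rsqrt flip: real_sqrt_mult)
qed

section \<open>Integration over the unitary group of one system\<close>

lemma borel_measurable_cnj [measurable (raw)]:
  "f \<in> borel_measurable M \<Longrightarrow> (\<lambda>x. cnj (f x)) \<in> borel_measurable M"
  by (rule borel_measurable_continuous_on[where f = cnj]) (intro continuous_intros)

locale haar_unitary =
  fixes A :: "'a set" and \<mu> :: "'a oper measure"
  assumes fin: "finite A" and card2: "2 \<le> card A" and haar: "haar_measure A \<mu>"
begin

sublocale prob_space \<mu>
  using haar by (simp add: haar_measure_def)

lemma space_haar: "space \<mu> = unitaries A"
  using haar by (simp add: haar_measure_def)

lemma sets_haar: "sets \<mu> = sets (restrict_space borel (unitaries A))"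
  using haar by (simp add: haar_measure_def)

lemma entry_measurable [measurable]: "(\<lambda>U. U i c) \<in> borel_measurable \<mu>"
proof -
  have "continuous_on UNIV (\<lambda>U :: 'a oper. U i c)"
    by (rule continuous_on_compose2[OF continuous_on_product_coordinates continuous_on_product_coordinates]) auto
  then have "(\<lambda>U :: 'a oper. U i c) \<in> borel_measurable borel"
    by (rule borel_measurable_continuous_onI)
  then show ?thesis
    using measurable_restrict_space1[of "\<lambda>U :: 'a oper. U i c" borel borel "unitaries A"]
      measurable_cong_sets[OF sets_haar refl] by blast
qed

lemma left_mult_measurable:
  assumes "V \<in> unitaries A"
  shows "mult_op A V \<in> measurable \<mu> \<mu>"
proof -
  have "continuous_on UNIV (\<lambda>U :: 'a oper. U i c)" for i c
    by (rule continuous_on_compose2[OF continuous_on_product_coordinates continuous_on_product_coordinates]) auto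
  then have "continuous_on UNIV (mult_op A V)"
    unfolding mult_op_def
    by (intro continuous_on_coordinatewise_then_product continuous_on_sum continuous_on_mult continuous_on_const)
  then have "mult_op A V \<in> measurable borel borel"
    by (rule borel_measurable_continuous_onI)
  then have "mult_op A V \<in> measurable (restrict_space borel (unitaries A)) (restrict_space borel (unitaries A))"
    by (rule measurable_restrict_space3) (auto intro: unitaries_mult[OF fin assms])
  then show ?thesis using measurable_cong_sets[OF sets_haar sets_haar] by blast
qed

lemma left_invariant:
  fixes f :: "'a oper \<Rightarrow> complex"
  assumes "V \<in> unitaries A" and [measurable]: "f \<in> borel_measurable \<mu>"
  shows "(\<integral>U. f (mult_op A V U) \<partial>\<mu>) = (\<integral>U. f U \<partial>\<mu>)"
proof -
  have "distr \<mu> \<mu> (mult_op A V) = \<mu>" using haar assms(1) by (simp add: haar_measure_def)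
  then show ?thesis using integral_distr[OF left_mult_measurable[OF assms(1)] assms(2)] by simp
qed

text \<open>Rows of a unitary are unit vectors. Boundedness of the entries makes all their moments
  integrable on a probability space.\<close>

lemma entry_bound:
  assumes "U \<in> unitaries A"
  shows "cmod (U i c) \<le> 1"
proof (cases "i \<in> A \<and> c \<in> A")
  case True
  have "complex_of_real (\<Sum>l\<in>A. (cmod (U i l))\<^sup>2) = 1"
    using unitaries_sum(1)[OF assms, of i i] True
    unfolding of_real_sum by (simp add: complex_norm_square del: of_real_power)
  then have "(\<Sum>l\<in>A. (cmod (U i l))\<^sup>2) = 1" using of_real_eq_1_iff by blast
  moreover have "(cmod (U i c))\<^sup>2 \<le> (\<Sum>l\<in>A. (cmod (U i l))\<^sup>2)"
    using True fin by (intro member_le_sum) auto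
  ultimately show ?thesis by (simp add: abs_square_le_1)
next
  case False
  then have "U i c = 0" using assms by (auto simp: unitaries_def opers_def)
  then show ?thesis by simp
qed

subsection \<open>Second and fourth moments of the entries\<close>

definition mom2 :: "'a \<Rightarrow> 'a \<Rightarrow> 'a \<Rightarrow> 'a \<Rightarrow> complex" where
  "mom2 i k c1 c3 = (\<integral>U. U i c1 * cnj (U k c3) \<partial>\<mu>)"

definition mom4 :: "'a \<Rightarrow> 'a \<Rightarrow> 'a \<Rightarrow> 'a \<Rightarrow> 'a \<Rightarrow> 'a \<Rightarrow> 'a \<Rightarrow> 'a \<Rightarrow> complex" where
  "mom4 i j k l c1 c2 c3 c4 = (\<integral>U. U i c1 * U j c2 * cnj (U k c3) * cnj (U l c4) \<partial>\<mu>)"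

lemma integrable2: "integrable \<mu> (\<lambda>U. U i c1 * cnj (U k c3))"
  by (rule integrable_const_bound[where B = 1])
    (auto simp: space_haar norm_mult entry_bound intro!: mult_le_one)

lemma integrable4: "integrable \<mu> (\<lambda>U. U i c1 * U j c2 * cnj (U k c3) * cnj (U l c4))"
  by (rule integrable_const_bound[where B = 1])
    (auto simp: space_haar norm_mult entry_bound intro!: mult_le_one)

text \<open>Left multiplication by the diagonal matrix multiplies row \<open>x\<close> by
  \<open>\<i>\<close>. The value \<open>\<i>\<close> is taken and not -1 because a row occurring
  twice among the unconjugated factors must also be detected: \<open>\<i>\<^sup>2\<close> still
  differs from 1.\<close>

definition phase :: "'a \<Rightarrow> 'a \<Rightarrow> complex" where
  "phase x = (\<lambda>i. if i = x then \<i> else 1)"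

lemma phase_unitary: "diag_op A (phase x) \<in> unitaries A"
proof (rule unitariesI)
  have ph: "phase x i * cnj (phase x i) = 1" for i by (simp add: phase_def)
  fix i j assume ij: "i \<in> A" "j \<in> A"
  let ?V = "diag_op A (phase x)"
  have "(\<Sum>l\<in>A. ?V i l * cnj (?V j l)) = (\<Sum>l\<in>A. if l = i then (if i = j then 1 else 0) else 0)"
    by (intro sum.cong) (auto simp: diag_op_def ij ph)
  then show "(\<Sum>l\<in>A. ?V i l * cnj (?V j l)) = (if i = j then 1 else 0)" using ij fin by simp
  have "(\<Sum>l\<in>A. cnj (?V l i) * ?V l j) = (\<Sum>l\<in>A. if l = i then (if i = j then 1 else 0) else 0)"
    by (intro sum.cong) (auto simp: diag_op_def ij ph mult.commute)
  then show "(\<Sum>l\<in>A. cnj (?V l i) * ?V l j) = (if i = j then 1 else 0)" using ij fin by simp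
qed (auto simp: opers_def diag_op_def)

lemma phase_mult:
  assumes "i \<in> A"
  shows "mult_op A (diag_op A (phase x)) U i c = phase x i * U i c"
proof -
  have "(\<Sum>l\<in>A. diag_op A (phase x) i l * U l c) = (\<Sum>l\<in>A. if l = i then phase x i * U i c else 0)"
    using assms by (intro sum.cong) (auto simp: diag_op_def)
  then show ?thesis using assms fin by (simp add: mult_op_def)
qed

definition perm_op :: "('a \<Rightarrow> 'a) \<Rightarrow> 'a oper" where
  "perm_op \<pi> = (\<lambda>i j. if i \<in> A \<and> j = \<pi> i then 1 else 0)"

lemma perm_unitary:
  assumes "\<pi> permutes A"
  shows "perm_op \<pi> \<in> unitaries A"
proof (rule unitariesI)
  have in_A: "\<pi> i \<in> A \<longleftrightarrow> i \<in> A" for i using assms by (rule permutes_in_image)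
  have inj: "\<pi> i = \<pi> j \<longleftrightarrow> i = j" for i j using permutes_inj[OF assms] by (simp add: inj_eq)
  show "perm_op \<pi> \<in> opers A" using in_A by (auto simp: opers_def perm_op_def)
  fix i j assume ij: "i \<in> A" "j \<in> A"
  have "(\<Sum>l\<in>A. perm_op \<pi> i l * cnj (perm_op \<pi> j l)) = (\<Sum>l\<in>A. if l = \<pi> i then (if i = j then 1 else 0) else 0)"
    by (intro sum.cong) (auto simp: perm_op_def ij inj)
  then show "(\<Sum>l\<in>A. perm_op \<pi> i l * cnj (perm_op \<pi> j l)) = (if i = j then 1 else 0)"
    using ij in_A fin by simp
  obtain i' where i': "i = \<pi> i'" using permutes_surj[OF assms] by blast
  then have "i' \<in> A" using ij in_A by simp
  have "(\<Sum>l\<in>A. cnj (perm_op \<pi> l i) * perm_op \<pi> l j) = (\<Sum>l\<in>A. if l = i' then (if i = j then 1 else 0) else 0)"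
    by (intro sum.cong) (auto simp: perm_op_def ij inj i')
  then show "(\<Sum>l\<in>A. cnj (perm_op \<pi> l i) * perm_op \<pi> l j) = (if i = j then 1 else 0)"
    using \<open>i' \<in> A\<close> fin by simp
qed

lemma perm_mult:
  assumes "\<pi> permutes A" "i \<in> A"
  shows "mult_op A (perm_op \<pi>) U i c = U (\<pi> i) c"
proof -
  have "(\<Sum>l\<in>A. perm_op \<pi> i l * U l c) = (\<Sum>l\<in>A. if l = \<pi> i then U (\<pi> i) c else 0)"
    using assms by (intro sum.cong) (auto simp: perm_op_def)
  then show ?thesis using assms fin by (simp add: mult_op_def permutes_in_image)
qed

lemma mom2_phase:
  assumes "i \<in> A" "k \<in> A"
  shows "mom2 i k c1 c3 = (phase x i * cnj (phase x k)) * mom2 i k c1 c3"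
proof -
  have "mom2 i k c1 c3 = (\<integral>U. (phase x i * cnj (phase x k)) * (U i c1 * cnj (U k c3)) \<partial>\<mu>)"
    unfolding mom2_def using assms
    by (subst left_invariant[OF phase_unitary[of x], symmetric]) (simp_all add: phase_mult mult_ac)
  then show ?thesis unfolding mom2_def by simp
qed

lemma mom2_perm:
  assumes "\<pi> permutes A" "i \<in> A" "k \<in> A"
  shows "mom2 (\<pi> i) (\<pi> k) c1 c3 = mom2 i k c1 c3"
  unfolding mom2_def using assms
  by (subst (2) left_invariant[OF perm_unitary[OF assms(1)], symmetric]) (simp_all add: perm_mult)

text \<open>Phase invariance annihilates the moments with different rows, permutation invariance
  makes those with equal rows independent of the row, and orthonormality of the columns fixes their
  sum.\<close>

lemma mom2_eq:
  assumes "i \<in> A" "k \<in> A" "c1 \<in> A" "c3 \<in> A"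
  shows "mom2 i k c1 c3 = (if i = k \<and> c1 = c3 then 1 / of_nat (card A) else 0)"
proof (cases "i = k")
  case False
  then have "phase i i * cnj (phase i k) \<noteq> 1" by (simp add: phase_def complex_eq_iff)
  then show ?thesis using mom2_phase[OF assms(1,2), of c1 c3 i] False by (metis mult_cancel_right1)
next
  case True
  have "mom2 j j c1 c3 = mom2 i i c1 c3" if "j \<in> A" for j
    using mom2_perm[of "Transposition.transpose i j" i i c1 c3] permutes_swap_id[OF assms(1) that] assms(1)
    by simp
  then have "of_nat (card A) * mom2 i i c1 c3 = (\<Sum>j\<in>A. mom2 j j c1 c3)" by simp
  also have "\<dots> = (\<integral>U. (\<Sum>j\<in>A. cnj (U j c3) * U j c1) \<partial>\<mu>)"
    unfolding mom2_def using integrable2 by (subst Bochner_Integration.integral_sum) (auto simp: mult.commute)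
  also have "\<dots> = (\<integral>U. (if c3 = c1 then 1 else 0) \<partial>\<mu>)"
    using assms by (intro Bochner_Integration.integral_cong) (auto simp: space_haar unitaries_sum)
  also have "\<dots> = (if c1 = c3 then 1 else 0)" by (simp add: prob_space)
  finally show ?thesis using True card2 by (auto simp: field_simps split: if_splits)
qed

lemma mom4_phase:
  assumes "i \<in> A" "j \<in> A" "k \<in> A" "l \<in> A"
  shows "mom4 i j k l c1 c2 c3 c4 =
    (phase x i * phase x j * cnj (phase x k) * cnj (phase x l)) * mom4 i j k l c1 c2 c3 c4"
proof -
  have "mom4 i j k l c1 c2 c3 c4 = (\<integral>U. (phase x i * phase x j * cnj (phase x k) * cnj (phase x l)) *
      (U i c1 * U j c2 * cnj (U k c3) * cnj (U l c4)) \<partial>\<mu>)"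
    unfolding mom4_def using assms
    by (subst left_invariant[OF phase_unitary[of x], symmetric]) (simp_all add: phase_mult mult_ac)
  then show ?thesis unfolding mom4_def by simp
qed

text \<open>Unless the two unconjugated rows agree with the two conjugated ones up to order, some
  row occurs more often among the former. Its phase multiplies the moment by \<open>\<i>\<close> or
  -1.\<close>

lemma mom4_zero:
  assumes "i \<in> A" "j \<in> A" "k \<in> A" "l \<in> A" "\<not> (i = k \<and> j = l)" "\<not> (i = l \<and> j = k)"
  shows "mom4 i j k l c1 c2 c3 c4 = 0"
proof -
  obtain x where "phase x i * phase x j * cnj (phase x k) * cnj (phase x l) \<noteq> 1"
  proof (cases "i = k \<or> i = l")
    case True
    then show thesis using assms(5,6) that[of j] by (auto simp: phase_def complex_eq_iff split: if_splits)
  next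
    case False
    then show thesis using that[of i] by (auto simp: phase_def complex_eq_iff split: if_splits)
  qed
  then show ?thesis using mom4_phase[OF assms(1-4), of c1 c2 c3 c4 x] by (metis mult_cancel_right1)
qed

lemma mom4_perm:
  assumes "\<pi> permutes A" "i \<in> A" "j \<in> A" "k \<in> A" "l \<in> A"
  shows "mom4 (\<pi> i) (\<pi> j) (\<pi> k) (\<pi> l) c1 c2 c3 c4 = mom4 i j k l c1 c2 c3 c4"
  unfolding mom4_def using assms
  by (subst (2) left_invariant[OF perm_unitary[OF assms(1)], symmetric]) (simp_all add: perm_mult)

text \<open>Two transpositions suffice: the first moves \<open>x\<close> to \<open>x'\<close>, the
  second corrects the image of \<open>y\<close> and leaves \<open>x'\<close> fixed. Thus moments
  with two distinct rows do not depend on which rows they are.\<close>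

lemma two_point_homogeneous:
  assumes "x \<in> A" "y \<in> A" "x' \<in> A" "y' \<in> A" "x \<noteq> y" "x' \<noteq> y'"
  obtains \<pi> where "\<pi> permutes A" "\<pi> x = x'" "\<pi> y = y'"
proof -
  let ?t = "Transposition.transpose x x'"
  have t: "?t permutes A" using assms by (intro permutes_swap_id)
  then have ty: "?t y \<in> A" using assms by (simp add: permutes_in_image)
  let ?u = "Transposition.transpose (?t y) y'"
  have u: "?u permutes A" using assms ty by (intro permutes_swap_id)
  have "?t y \<noteq> x'" using assms by (metis transpose_apply_first transpose_involutory)
  then have "(?u \<circ> ?t) x = x'" "(?u \<circ> ?t) y = y'" using assms by (simp_all add: transpose_apply_other)
  then show thesis using that permutes_compose[OF t u] by blast
qed

text \<open>Phases and permutations alone do not relate a moment with four equal rows to those with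
  two distinct rows. Invariance under a reflection that replaces row \<open>x\<close> by the sum of
  rows \<open>x\<close> and \<open>y\<close>, up to a factor of modulus 1 / sqrt 2, does.\<close>

lemma mom4_diag:
  assumes "x \<in> A" "y \<in> A" "x \<noteq> y"
  shows "mom4 x x x x c1 c2 c3 c4 = mom4 x y x y c1 c2 c3 c4 + mom4 x y y x c1 c2 c3 c4"
proof -
  define v where "v = (\<lambda>i. if i = x \<or> i = y then 1 else 0 :: complex)"
  have "v \<in> vecs A" "v \<noteq> (\<lambda>_. 0)" using assms by (auto simp: v_def vecs_def fun_eq_iff)
  then obtain H c where H: "H \<in> unitaries A" "adj H = H" "\<And>i. H i x = c * v i"
    using householder_exists[OF fin assms(1)] by blast
  have Hx: "H x i = cnj c * v i" for i
    using fun_cong[OF fun_cong[OF H(2), of x], of i] H(3)[of i] by (auto simp: adj_def v_def)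
  have two: "(\<Sum>l\<in>A. v l * f l) = f x + f y" for f
  proof -
    have "(\<Sum>l\<in>A. v l * f l) = (\<Sum>l\<in>{x,y}. v l * f l)"
      using assms fin by (intro sum.mono_neutral_right) (auto simp: v_def)
    then show ?thesis using assms(3) by (simp add: v_def)
  qed
  have HU: "mult_op A H U x a = cnj c * (U x a + U y a)" for U a
    unfolding mult_op_def Hx using two[of "\<lambda>l. U l a"] by (simp add: mult.assoc flip: sum_distrib_left)
  have "(\<Sum>l\<in>A. H x l * cnj (H x l)) = 1" using unitaries_sum(1)[OF H(1), of x x] assms by simp
  moreover have "(\<Sum>l\<in>A. H x l * cnj (H x l)) = cnj c * c * (\<Sum>l\<in>A. v l * v l)"
    unfolding Hx sum_distrib_left by (intro sum.cong) (auto simp: v_def)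
  ultimately have cc: "c * cnj c = 1 / 2" unfolding two by (simp add: v_def field_simps)
  have swap: "mom4 y y y y c1 c2 c3 c4 = mom4 x x x x c1 c2 c3 c4"
    "mom4 y x y x c1 c2 c3 c4 = mom4 x y x y c1 c2 c3 c4"
    "mom4 y x x y c1 c2 c3 c4 = mom4 x y y x c1 c2 c3 c4"
    using mom4_perm[OF permutes_swap_id[OF assms(1,2)], of x x x x c1 c2 c3 c4]
      mom4_perm[OF permutes_swap_id[OF assms(1,2)], of x y x y c1 c2 c3 c4]
      mom4_perm[OF permutes_swap_id[OF assms(1,2)], of x y y x c1 c2 c3 c4] assms by simp_all
  have int: "(\<integral>U. (U x c1 + U y c1) * (U x c2 + U y c2) * cnj (U x c3 + U y c3) * cnj (U x c4 + U y c4) \<partial>\<mu>)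
    = (\<Sum>i\<in>{x,y}. \<Sum>j\<in>{x,y}. \<Sum>k\<in>{x,y}. \<Sum>l\<in>{x,y}. mom4 i j k l c1 c2 c3 c4)" (is "?I = _")
  proof -
    have "?I = (\<integral>U. (\<Sum>i\<in>{x,y}. \<Sum>j\<in>{x,y}. \<Sum>k\<in>{x,y}. \<Sum>l\<in>{x,y}.
        U i c1 * U j c2 * cnj (U k c3) * cnj (U l c4)) \<partial>\<mu>)"
      using assms(3) by (intro Bochner_Integration.integral_cong) (auto simp: algebra_simps)
    then show ?thesis
      unfolding mom4_def using integrable4
      by (simp only: Bochner_Integration.integral_sum Bochner_Integration.integrable_sum)
  qed
  have "mom4 x x x x c1 c2 c3 c4 = (\<integral>U. (c * cnj c) * (c * cnj c) *
      ((U x c1 + U y c1) * (U x c2 + U y c2) * cnj (U x c3 + U y c3) * cnj (U x c4 + U y c4)) \<partial>\<mu>)"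
  proof -
    have "mom4 x x x x c1 c2 c3 c4 = (\<integral>U. mult_op A H U x c1 * mult_op A H U x c2 *
        cnj (mult_op A H U x c3) * cnj (mult_op A H U x c4) \<partial>\<mu>)"
      unfolding mom4_def by (subst left_invariant[OF H(1), symmetric]) simp_all
    then show ?thesis unfolding HU by (simp add: mult_ac)
  qed
  also have "\<dots> = (1 / 4) * (\<Sum>i\<in>{x,y}. \<Sum>j\<in>{x,y}. \<Sum>k\<in>{x,y}. \<Sum>l\<in>{x,y}. mom4 i j k l c1 c2 c3 c4)"
    unfolding cc int[symmetric] by simp
  \<comment> \<open>Of the sixteen terms ten vanish by \<open>mom4_zero\<close>; the other six form
    three pairs under the exchange of \<open>x\<close> and \<open>y\<close>.\<close>
  also have "\<dots> = (1 / 4) * (2 * mom4 x x x x c1 c2 c3 c4 + 2 * mom4 x y x y c1 c2 c3 c4 + 2 * mom4 x y y x c1 c2 c3 c4)"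
    using assms by (simp add: mom4_zero swap)
  finally have "2 * mom4 x x x x c1 c2 c3 c4 = 2 * (mom4 x y x y c1 c2 c3 c4 + mom4 x y y x c1 c2 c3 c4)"
    by simp
  then show ?thesis by (metis mult_cancel_left zero_neq_numeral)
qed

text \<open>Only left invariance enters; the dependence on the columns comes from the two contractions of the
  tensor.\<close>

lemma mom4_eq:
  fixes c1 c2 c3 c4 :: 'a
  defines "d \<equiv> of_nat (card A) :: complex"
    and "\<alpha> \<equiv> if c1 = c3 \<and> c2 = c4 then 1 else 0" and "\<beta> \<equiv> if c1 = c4 \<and> c2 = c3 then 1 else 0"
  assumes "i \<in> A" "j \<in> A" "k \<in> A" "l \<in> A" "c1 \<in> A" "c2 \<in> A" "c3 \<in> A" "c4 \<in> A"
  shows "d * (d\<^sup>2 - 1) * mom4 i j k l c1 c2 c3 c4 =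
     (d * \<alpha> - \<beta>) * (if i = k \<and> j = l then 1 else 0) + (d * \<beta> - \<alpha>) * (if i = l \<and> j = k then 1 else 0)"
proof -
  obtain x y where xy: "x \<in> A" "y \<in> A" "x \<noteq> y"
    using card2 card_2_iff'[of A] by (metis card_le_Suc0_iff_eq fin not_less_eq_eq numeral_2_eq_2)
  define p where "p = mom4 x y x y c1 c2 c3 c4"
  define q where "q = mom4 x y y x c1 c2 c3 c4"
  have off: "mom4 i j i j c1 c2 c3 c4 = p" "mom4 i j j i c1 c2 c3 c4 = q"
    if ij: "i \<in> A" "j \<in> A" "i \<noteq> j" for i j
  proof -
    obtain \<pi> where \<pi>: "\<pi> permutes A" "\<pi> x = i" "\<pi> y = j"
      using two_point_homogeneous[OF xy(1,2) ij(1,2) xy(3) ij(3)] .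
    show "mom4 i j i j c1 c2 c3 c4 = p" "mom4 i j j i c1 c2 c3 c4 = q"
      using mom4_perm[OF \<pi>(1), of x y x y c1 c2 c3 c4] mom4_perm[OF \<pi>(1), of x y y x c1 c2 c3 c4] xy
      by (simp_all add: \<pi> p_def q_def)
  qed
  have diag: "mom4 i i i i c1 c2 c3 c4 = p + q" if "i \<in> A" for i
  proof -
    obtain j where "j \<in> A" "j \<noteq> i" using xy by metis
    then show ?thesis using mom4_diag[OF that, of j] off[OF that, of j] by simp
  qed
  have G: "mom4 i j k l c1 c2 c3 c4 = p * (if i = k \<and> j = l then 1 else 0) + q * (if i = l \<and> j = k then 1 else 0)"
    if "i \<in> A" "j \<in> A" "k \<in> A" "l \<in> A" for i j k l
  proof -
    consider "i = j" "i = k" "i = l" | "i = k" "j = l" "i \<noteq> j" | "i = l" "j = k" "i \<noteq> j"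
      | "\<not> (i = k \<and> j = l)" "\<not> (i = l \<and> j = k)" by blast
    then show ?thesis
    proof cases
      case 1
      then show ?thesis using diag[OF that(1)] by simp
    next
      case 2
      then show ?thesis using off(1)[OF that(1,2)] by simp
    next
      case 3
      then show ?thesis using off(2)[OF that(1,2)] by simp
    next
      case 4
      then show ?thesis by (simp only: mom4_zero[OF that 4] if_False mult_zero_right add_0_right)
    qed
  qed
  have e1: "mom4 i j i j c1 c2 c3 c4 = p + q * (if i = j then 1 else 0)"
    and e2: "mom4 i j j i c1 c2 c3 c4 = p * (if i = j then 1 else 0) + q" if "i \<in> A" "j \<in> A" for i j
    using G[of i j i j] G[of i j j i] that by (cases "i = j"; simp)+
  have "(\<Sum>i\<in>A. \<Sum>j\<in>A. mom4 i j i j c1 c2 c3 c4)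
      = (\<integral>U. (\<Sum>i\<in>A. \<Sum>j\<in>A. U i c1 * U j c2 * cnj (U i c3) * cnj (U j c4)) \<partial>\<mu>)"
    unfolding mom4_def using integrable4
    by (simp only: Bochner_Integration.integral_sum Bochner_Integration.integrable_sum)
  also have "\<dots> = (\<integral>U. (\<Sum>i\<in>A. cnj (U i c3) * U i c1) * (\<Sum>j\<in>A. cnj (U j c4) * U j c2) \<partial>\<mu>)"
    by (intro Bochner_Integration.integral_cong) (auto simp: sum_product mult_ac)
  also have "\<dots> = (\<integral>U. \<alpha> \<partial>\<mu>)"
    using assms by (intro Bochner_Integration.integral_cong) (auto simp: space_haar unitaries_sum)
  also have "\<dots> = \<alpha>" by (simp add: prob_space)
  finally have "(\<Sum>i\<in>A. \<Sum>j\<in>A. p + q * (if i = j then 1 else 0)) = \<alpha>"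
    by (simp add: e1 cong: sum.cong)
  then have 1: "d * d * p + d * q = \<alpha>"
    using fin by (simp add: sum.distrib d_def if_distrib[of "\<lambda>x. _ * x"] algebra_simps cong: if_cong)
  have "(\<Sum>i\<in>A. \<Sum>j\<in>A. mom4 i j j i c1 c2 c3 c4)
      = (\<integral>U. (\<Sum>i\<in>A. \<Sum>j\<in>A. U i c1 * U j c2 * cnj (U j c3) * cnj (U i c4)) \<partial>\<mu>)"
    unfolding mom4_def using integrable4
    by (simp only: Bochner_Integration.integral_sum Bochner_Integration.integrable_sum)
  also have "\<dots> = (\<integral>U. (\<Sum>i\<in>A. cnj (U i c4) * U i c1) * (\<Sum>j\<in>A. cnj (U j c3) * U j c2) \<partial>\<mu>)"
    by (intro Bochner_Integration.integral_cong) (auto simp: sum_product mult_ac)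
  also have "\<dots> = (\<integral>U. \<beta> \<partial>\<mu>)"
    using assms by (intro Bochner_Integration.integral_cong) (auto simp: space_haar unitaries_sum)
  also have "\<dots> = \<beta>" by (simp add: prob_space)
  finally have "(\<Sum>i\<in>A. \<Sum>j\<in>A. p * (if i = j then 1 else 0) + q) = \<beta>"
    by (simp add: e2 cong: sum.cong)
  then have 2: "d * p + d * d * q = \<beta>"
    using fin by (simp add: sum.distrib d_def if_distrib[of "\<lambda>x. _ * x"] algebra_simps cong: if_cong)
  \<comment> \<open>Elimination in the linear system formed by facts \<open>1\<close> and
    \<open>2\<close>. The common factor is kept on the left, which avoids division.\<close>
  have "d * (d\<^sup>2 - 1) * p = d * \<alpha> - \<beta>" "d * (d\<^sup>2 - 1) * q = d * \<beta> - \<alpha>"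
    unfolding 1[symmetric] 2[symmetric] by (simp_all add: algebra_simps power2_eq_square)
  then show ?thesis using G[of i j k l] assms by (simp add: distrib_left mult.assoc[symmetric])
qed

end

text \<open>Entries of \<open>X \<mapsto> V X V\<^sup>\<dagger> - tr X / d\<close> (times the
  identity). The pair \<open>p\<close> holds the output and the input row index and \<open>q\<close>
  the two column indices; \<open>p = q\<close> therefore says that the trace of the input is taken
  and a multiple of the identity returned.\<close>

definition fluct :: "'a set \<Rightarrow> 'a oper \<Rightarrow> 'a \<times> 'a \<Rightarrow> 'a \<times> 'a \<Rightarrow> complex" where
  "fluct A V p q = V (fst p) (snd p) * cnj (V (fst q) (snd q)) - (if p = q then 1 / of_nat (card A) else 0)"

lemma cmod_sum_square:
  fixes f :: "'x \<Rightarrow> complex"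
  shows "of_real ((cmod (\<Sum>x\<in>X. f x))\<^sup>2) = (\<Sum>x\<in>X. \<Sum>y\<in>X. f x * cnj (f y))"
  by (simp add: complex_norm_square sum_product del: of_real_power)

context haar_unitary
begin

lemma fluct_mult:
  "fluct A V p q * cnj (fluct A V p' q') =
     V (fst p) (snd p) * V (fst q') (snd q') * cnj (V (fst q) (snd q)) * cnj (V (fst p') (snd p'))
     - (if p' = q' then 1 / of_nat (card A) else 0) * (V (fst p) (snd p) * cnj (V (fst q) (snd q)))
     - (if p = q then 1 / of_nat (card A) else 0) * (V (fst q') (snd q') * cnj (V (fst p') (snd p')))
     + (if p = q then 1 / of_nat (card A) else 0) * (if p' = q' then 1 / of_nat (card A) else 0)"
  by (simp add: fluct_def algebra_simps)

lemma integrable_fluct_mult: "integrable \<mu> (\<lambda>V. fluct A V p q * cnj (fluct A V p' q'))"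
  unfolding fluct_mult
  by (intro Bochner_Integration.integrable_add Bochner_Integration.integrable_diff integrable_mult_right
      integrable4 integrable2 integrable_const)

text \<open>The right-hand side is arranged as a rank-one kernel plus a multiple of the identity
  kernel, minus \<open>d\<close> times a sum of two Gram kernels. The subtracted part can then be
  discarded in an upper bound. The \<open>cnj\<close> around real values exhibits the rank-one
  shape.\<close>

lemma fluct_covariance:
  fixes p q p' q' :: "'a \<times> 'a"
  defines "d \<equiv> of_nat (card A) :: complex"
  assumes "p \<in> A \<times> A" "q \<in> A \<times> A" "p' \<in> A \<times> A" "q' \<in> A \<times> A"
  shows "d\<^sup>2 * (d\<^sup>2 - 1) * (\<integral>V. fluct A V p q * cnj (fluct A V p' q') \<partial>\<mu>) =
     (if p = q then 1 else 0) * cnj (if p' = q' then 1 else 0)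
     + d\<^sup>2 * (if p = p' \<and> q = q' then 1 else 0)
     - d * ((if fst p = fst q then 1 else 0) * cnj (if fst p' = fst q' then 1 else 0)
            * (if (snd p, snd q) = (snd p', snd q') then 1 else 0)
          + (if snd p = snd q then 1 else 0) * cnj (if snd p' = snd q' then 1 else 0)
            * (if (fst p, fst q) = (fst p', fst q') then 1 else 0))"
proof -
  obtain a c b e a' c' b' e' where pq: "p = (a, c)" "q = (b, e)" "p' = (a', c')" "q' = (b', e')"
    by (metis prod.exhaust)
  have mem: "a \<in> A" "b \<in> A" "c \<in> A" "e \<in> A" "a' \<in> A" "b' \<in> A" "c' \<in> A" "e' \<in> A"
    using assms pq by auto
  have d0: "d \<noteq> 0" using card2 by (auto simp: d_def)
  define \<alpha> :: complex where "\<alpha> = (if c = e \<and> e' = c' then 1 else 0)"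
  define \<beta> :: complex where "\<beta> = (if c = c' \<and> e' = e then 1 else 0)"
  define r1 :: complex where "r1 = (if a = b \<and> b' = a' then 1 else 0)"
  define r2 :: complex where "r2 = (if a = a' \<and> b' = b then 1 else 0)"
  have m4: "d * (d\<^sup>2 - 1) * mom4 a b' b a' c e' e c' = (d * \<alpha> - \<beta>) * r1 + (d * \<beta> - \<alpha>) * r2"
    unfolding d_def \<alpha>_def \<beta>_def r1_def r2_def by (rule mom4_eq) (fact mem)+
  have pq1: "(if p = q then 1 / d else 0) * (if p' = q' then 1 / d else 0) = \<alpha> * r1 / d\<^sup>2"
    by (auto simp: pq \<alpha>_def r1_def power2_eq_square)
  have "(\<integral>V. fluct A V p q * cnj (fluct A V p' q') \<partial>\<mu>) =
     mom4 a b' b a' c e' e c'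
     - (if p' = q' then 1 / d else 0) * mom2 a b c e
     - (if p = q then 1 / d else 0) * mom2 b' a' e' c'
     + (if p = q then 1 / d else 0) * (if p' = q' then 1 / d else 0)"
    unfolding fluct_mult mom4_def mom2_def d_def[symmetric] pq fst_conv snd_conv
    by (simp only: Bochner_Integration.integral_add Bochner_Integration.integral_diff integral_mult_right_zero
      Bochner_Integration.integrable_add Bochner_Integration.integrable_diff integrable_mult_right
      integrable4 integrable2 integrable_const lebesgue_integral_const prob_space scaleR_one)
  also have "mom2 a b c e = (if p = q then 1 / d else 0)"
    using mom2_eq[of a b c e] mem by (simp add: pq d_def)
  also have "mom2 b' a' e' c' = (if p' = q' then 1 / d else 0)"
    using mom2_eq[of b' a' e' c'] mem by (auto simp: pq d_def)
  finally have "(\<integral>V. fluct A V p q * cnj (fluct A V p' q') \<partial>\<mu>) = mom4 a b' b a' c e' e c' - \<alpha> * r1 / d\<^sup>2"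
    using pq1 by (simp add: mult.commute)
  then have E: "d\<^sup>2 * (\<integral>V. fluct A V p q * cnj (fluct A V p' q') \<partial>\<mu>) = d\<^sup>2 * mom4 a b' b a' c e' e c' - \<alpha> * r1"
    using d0 by (simp add: right_diff_distrib)
  have "d\<^sup>2 * (d\<^sup>2 - 1) * (\<integral>V. fluct A V p q * cnj (fluct A V p' q') \<partial>\<mu>)
      = (d\<^sup>2 - 1) * (d\<^sup>2 * (\<integral>V. fluct A V p q * cnj (fluct A V p' q') \<partial>\<mu>))"
    by (simp only: mult_ac)
  also have "\<dots> = d * (d * (d\<^sup>2 - 1) * mom4 a b' b a' c e' e c') - (d\<^sup>2 - 1) * (\<alpha> * r1)"
    unfolding E by (simp add: algebra_simps power2_eq_square)
  also have "\<dots> = \<alpha> * r1 + d\<^sup>2 * (\<beta> * r2) - d * (r1 * \<beta> + \<alpha> * r2)"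
    unfolding m4 by (simp add: algebra_simps power2_eq_square)
  also have "\<alpha> * r1 = (if p = q then 1 else 0) * cnj (if p' = q' then 1 else 0)"
    by (auto simp: pq \<alpha>_def r1_def)
  also have "\<beta> * r2 = (if p = p' \<and> q = q' then 1 else 0)"
    by (auto simp: pq \<beta>_def r2_def)
  also have "r1 * \<beta> = (if fst p = fst q then 1 else 0) * cnj (if fst p' = fst q' then 1 else 0)
            * (if (snd p, snd q) = (snd p', snd q') then 1 else 0)"
    by (auto simp: pq \<beta>_def r1_def)
  also have "\<alpha> * r2 = (if snd p = snd q then 1 else 0) * cnj (if snd p' = snd q' then 1 else 0)
            * (if (fst p, fst q) = (fst p', fst q') then 1 else 0)"
    by (auto simp: pq \<alpha>_def r2_def)
  finally show ?thesis .
qed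

text \<open>The exact constant would be \<open>1 / (d\<^sup>2 - 1)\<close>; the factor 2 is absorbed by \<open>D_const\<close> in the end.\<close>

lemma fluct_second_moment:
  fixes m :: "('a \<times> 'a) \<times> ('a \<times> 'a) \<Rightarrow> complex"
  defines "X \<equiv> (A \<times> A) \<times> (A \<times> A)"
  shows "(\<integral>\<^sup>+V. ennreal ((cmod (\<Sum>P\<in>X. m P * fluct A V (fst P) (snd P)))\<^sup>2) \<partial>\<mu>)
    \<le> ennreal (2 / ((real (card A))\<^sup>2 - 1) * (\<Sum>P\<in>X. (cmod (m P))\<^sup>2))"
proof -
  define d where "d = real (card A)"
  have d2: "2 \<le> d" using card2 by (simp add: d_def)
  then have d1: "d\<^sup>2 - 1 > 0" using power_mono[of 2 d 2] by simp
  have finX: "finite X" using fin by (simp add: X_def)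
  define w where "w = (\<lambda>V P. fluct A V (fst P) (snd P))"
  define F where "F = (\<lambda>V. \<Sum>P\<in>X. m P * w V P)"
  define N where "N = (\<Sum>P\<in>X. (cmod (m P))\<^sup>2)"
  have FF: "complex_of_real ((cmod (F V))\<^sup>2) = (\<Sum>P\<in>X. \<Sum>Q\<in>X. m P * cnj (m Q) * (w V P * cnj (w V Q)))" for V
    unfolding F_def cmod_sum_square by (simp add: mult_ac)
  have int: "integrable \<mu> (\<lambda>V. \<Sum>P\<in>X. \<Sum>Q\<in>X. m P * cnj (m Q) * (w V P * cnj (w V Q)))"
    unfolding w_def
    by (intro Bochner_Integration.integrable_sum integrable_mult_right integrable_fluct_mult)
  then have "integrable \<mu> (\<lambda>V. complex_of_real ((cmod (F V))\<^sup>2))" unfolding FF .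
  then have intF: "integrable \<mu> (\<lambda>V. (cmod (F V))\<^sup>2)" by (metis complex_of_real_integrable_eq)
  define C where "C = (\<lambda>P Q. \<integral>V. w V P * cnj (w V Q) \<partial>\<mu>)"
  define kY where "kY = (\<lambda>P :: ('a \<times> 'a) \<times> ('a \<times> 'a). if fst P = snd P then 1 else 0 :: complex)"
  define k1 where "k1 = (\<lambda>(P :: ('a \<times> 'a) \<times> ('a \<times> 'a)) (Q :: ('a \<times> 'a) \<times> ('a \<times> 'a)). (if fst (fst P) = fst (snd P) then 1 else 0)
    * cnj (if fst (fst Q) = fst (snd Q) then 1 else 0)
    * (if (snd (fst P), snd (snd P)) = (snd (fst Q), snd (snd Q)) then 1 else 0 :: complex))"
  define k2 where "k2 = (\<lambda>(P :: ('a \<times> 'a) \<times> ('a \<times> 'a)) (Q :: ('a \<times> 'a) \<times> ('a \<times> 'a)). (if snd (fst P) = snd (snd P) then 1 else 0)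
    * cnj (if snd (fst Q) = snd (snd Q) then 1 else 0)
    * (if (fst (fst P), fst (snd P)) = (fst (fst Q), fst (snd Q)) then 1 else 0 :: complex))"
  have C: "of_real (d\<^sup>2 * (d\<^sup>2 - 1)) * C P Q
      = kY P * cnj (kY Q) + of_real (d\<^sup>2) * (if P = Q then 1 else 0) - of_real d * (k1 P Q + k2 P Q)"
    if "P \<in> X" "Q \<in> X" for P Q
  proof -
    have mem: "fst P \<in> A \<times> A" "snd P \<in> A \<times> A" "fst Q \<in> A \<times> A" "snd Q \<in> A \<times> A"
      using that by (auto simp: X_def)
    have eq: "(P = Q) = (fst P = fst Q \<and> snd P = snd Q)" by (simp add: prod_eq_iff)
    show ?thesis
      using fluct_covariance[OF mem]
      unfolding C_def w_def kY_def k1_def k2_def d_def eq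
      by (simp only: of_real_mult of_real_diff of_real_power of_real_1 of_real_of_nat_eq)
  qed
  define S where "S = (\<lambda>k. \<Sum>P\<in>X. \<Sum>Q\<in>X. m P * k P Q * cnj (m Q))"
  have Spos: "0 \<le> Re (S k)" if "gram X k" for k
    using gram_quadratic_form[OF that, of "\<lambda>P. cnj (m P)"] by (simp add: S_def)
  have "gram X k1" unfolding k1_def
    by (intro gram_mult gram_rank_one gram_delta[of "A \<times> A"]) (use fin in \<open>auto simp: X_def\<close>)
  moreover have "gram X k2" unfolding k2_def
    by (intro gram_mult gram_rank_one gram_delta[of "A \<times> A"]) (use fin in \<open>auto simp: X_def\<close>)
  ultimately have pos: "0 \<le> Re (S k1)" "0 \<le> Re (S k2)" using Spos by blast+
  have SY: "S (\<lambda>P Q. kY P * cnj (kY Q)) = of_real ((cmod (\<Sum>P\<in>X. m P * kY P))\<^sup>2)"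
    unfolding cmod_sum_square S_def by (simp add: mult_ac)
  \<comment> \<open>The vector \<open>kY\<close> has squared norm \<open>d\<^sup>2\<close>, so the
    rank-one kernel contributes at most \<open>d\<^sup>2 * N\<close>. The identity kernel
    contributes exactly that amount, whence the factor 2.\<close>
  have "(cmod (\<Sum>P\<in>X. m P * kY P))\<^sup>2 \<le> N * (\<Sum>P\<in>X. (cmod (kY P))\<^sup>2)"
    unfolding N_def by (rule cmod_sum_mult_le)
  also have "(\<Sum>P\<in>X. (cmod (kY P))\<^sup>2) = (\<Sum>p\<in>A\<times>A. \<Sum>q\<in>A\<times>A. if p = q then 1 else 0)"
    unfolding X_def sum.cartesian_product by (intro sum.cong) (auto simp: kY_def)
  also have "\<dots> = d\<^sup>2" using fin by (simp add: d_def power2_eq_square)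
  finally have Y: "Re (S (\<lambda>P Q. kY P * cnj (kY Q))) \<le> d\<^sup>2 * N" unfolding SY by (simp add: mult.commute)
  have SI: "S (\<lambda>P Q. if P = Q then 1 else 0) = of_real N"
  proof -
    have "S (\<lambda>P Q. if P = Q then 1 else 0) = (\<Sum>P\<in>X. \<Sum>Q\<in>X. if P = Q then m P * cnj (m P) else 0)"
      unfolding S_def by (intro sum.cong refl) auto
    then show ?thesis using finX by (simp add: N_def complex_norm_square del: of_real_power)
  qed
  have "complex_of_real (\<integral>V. (cmod (F V))\<^sup>2 \<partial>\<mu>) = (\<integral>V. complex_of_real ((cmod (F V))\<^sup>2) \<partial>\<mu>)"
    by (rule integral_complex_of_real[symmetric])
  also have "\<dots> = (\<Sum>P\<in>X. \<Sum>Q\<in>X. m P * cnj (m Q) * C P Q)"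
    unfolding FF C_def w_def using integrable_fluct_mult
    by (simp only: Bochner_Integration.integral_sum Bochner_Integration.integrable_sum integrable_mult_right
        integral_mult_right_zero)
  finally have "of_real (d\<^sup>2 * (d\<^sup>2 - 1) * (\<integral>V. (cmod (F V))\<^sup>2 \<partial>\<mu>))
      = (\<Sum>P\<in>X. \<Sum>Q\<in>X. m P * cnj (m Q) * (of_real (d\<^sup>2 * (d\<^sup>2 - 1)) * C P Q))"
    by (simp only: of_real_mult[of "d\<^sup>2 * (d\<^sup>2 - 1)"] sum_distrib_left mult.left_commute)
  also have "\<dots> = (\<Sum>P\<in>X. \<Sum>Q\<in>X. m P * cnj (m Q) * (kY P * cnj (kY Q)
      + of_real (d\<^sup>2) * (if P = Q then 1 else 0) - of_real d * (k1 P Q + k2 P Q)))"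
    by (intro sum.cong refl) (simp only: C)
  also have "\<dots> = S (\<lambda>P Q. kY P * cnj (kY Q)) + of_real (d\<^sup>2) * S (\<lambda>P Q. if P = Q then 1 else 0)
      - of_real d * (S k1 + S k2)"
    unfolding S_def by (simp add: algebra_simps sum.distrib sum_subtractf sum_distrib_left del: of_real_power)
  finally have "Re (of_real (d\<^sup>2 * (d\<^sup>2 - 1) * (\<integral>V. (cmod (F V))\<^sup>2 \<partial>\<mu>)))
      = Re (S (\<lambda>P Q. kY P * cnj (kY Q)) + of_real (d\<^sup>2) * of_real N - of_real d * (S k1 + S k2))"
    unfolding SI by (rule arg_cong)
  then have "d\<^sup>2 * (d\<^sup>2 - 1) * (\<integral>V. (cmod (F V))\<^sup>2 \<partial>\<mu>)
      = Re (S (\<lambda>P Q. kY P * cnj (kY Q))) + d\<^sup>2 * N - d * (Re (S k1) + Re (S k2))"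
    unfolding Re_complex_of_real by (simp del: of_real_power)
  also have "\<dots> \<le> d\<^sup>2 * N + d\<^sup>2 * N"
    using Y mult_nonneg_nonneg[of d "Re (S k1) + Re (S k2)"] pos d2 by linarith
  finally have "d\<^sup>2 * ((d\<^sup>2 - 1) * (\<integral>V. (cmod (F V))\<^sup>2 \<partial>\<mu>)) \<le> d\<^sup>2 * (2 * N)"
    by (simp only: mult.assoc mult_2 distrib_left)
  then have "(d\<^sup>2 - 1) * (\<integral>V. (cmod (F V))\<^sup>2 \<partial>\<mu>) \<le> 2 * N" using d2 by simp
  then have "(\<integral>V. (cmod (F V))\<^sup>2 \<partial>\<mu>) \<le> 2 / (d\<^sup>2 - 1) * N" using d1 by (simp add: field_simps)
  then show ?thesis
    using nn_integral_eq_integral[OF intF] by (simp add: F_def w_def N_def d_def ennreal_leI)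
qed

end

section \<open>Tensorisation of second moment bounds\<close>

lemma sum_PiE_insert:
  assumes "x \<notin> S"
  shows "(\<Sum>w\<in>PiE (insert x S) J. f w) = (\<Sum>j\<in>J x. \<Sum>w\<in>PiE S J. f (w(x := j)))"
proof -
  have "(\<Sum>w\<in>PiE (insert x S) J. f w) = (\<Sum>p\<in>J x \<times> PiE S J. f ((snd p)(x := fst p)))"
    unfolding PiE_insert_eq using inj_combinator[OF assms, of J]
    by (subst sum.reindex) (auto simp: case_prod_beta)
  then show ?thesis by (simp add: sum.cartesian_product case_prod_beta)
qed

text \<open>The bound for one coordinate holds for every coefficient vector, so it may be applied
  with coefficients that depend on the remaining coordinates. It leaves a sum of squares of such
  coefficients, and the induction hypothesis treats each of them separately. Coordinates outside
  \<open>S\<close> integrate to 1.\<close>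

lemma tensor_second_moment:
  fixes M :: "nat \<Rightarrow> 'm measure" and z :: "nat \<Rightarrow> 'm \<Rightarrow> 'j \<Rightarrow> complex"
  assumes prob: "\<And>s. prob_space (M s)"
    and "finite K" and "S \<subseteq> K"
    and J: "\<And>s. s \<in> K \<Longrightarrow> finite (J s)"
    and meas: "\<And>s j. s \<in> K \<Longrightarrow> (\<lambda>V. z s V j) \<in> borel_measurable (M s)"
    and c: "\<And>s. s \<in> K \<Longrightarrow> 0 \<le> c s"
    and bound: "\<And>s m. s \<in> K \<Longrightarrow> (\<integral>\<^sup>+V. ennreal ((cmod (\<Sum>j\<in>J s. m j * z s V j))\<^sup>2) \<partial>M s)
       \<le> ennreal (c s * (\<Sum>j\<in>J s. (cmod (m j))\<^sup>2))"
  shows "(\<integral>\<^sup>+U. ennreal ((cmod (\<Sum>w\<in>PiE S J. m w * (\<Prod>s\<in>S. z s (U s) (w s))))\<^sup>2) \<partial>PiM K M)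
       \<le> ennreal ((\<Prod>s\<in>S. c s) * (\<Sum>w\<in>PiE S J. (cmod (m w))\<^sup>2))"
  using assms(2-)
proof (induction K arbitrary: S m rule: finite_induct)
  case empty
  then show ?case
    by (simp add: PiM_empty nn_integral_count_space_finite space_PiM_empty)
next
  case (insert x K)
  interpret product_sigma_finite M
    using prob by (auto simp: product_sigma_finite_def intro: prob_space_imp_sigma_finite)
  interpret px: prob_space "M x" by (rule prob)
  have finS: "finite S" using insert.prems(1) insert.hyps(1) by (meson finite.insertI finite_subset)
  have m1: "(\<lambda>U. z s (U s) j) \<in> borel_measurable (PiM (insert x K) M)" if "s \<in> insert x K" for s j
    by (rule measurable_compose[of "\<lambda>U. U s" _ "M s" "\<lambda>V. z s V j"])
      (use that insert.prems(3) in auto)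
  have m2: "(\<lambda>U. z s (U s) j) \<in> borel_measurable (PiM K M)" if "s \<in> K" for s j
    by (rule measurable_compose[of "\<lambda>U. U s" _ "M s" "\<lambda>V. z s V j"])
      (use that insert.prems(3) in auto)
  have meas: "(\<lambda>U. ennreal ((cmod (\<Sum>w\<in>PiE S J. m w * (\<Prod>s\<in>S. z s (U s) (w s))))\<^sup>2))
      \<in> borel_measurable (PiM (insert x K) M)"
    using insert.prems(1)
    by (intro measurable_compose[OF _ measurable_ennreal] borel_measurable_power measurable_compose[OF _ borel_measurable_norm]
        borel_measurable_sum borel_measurable_times borel_measurable_const borel_measurable_prod m1) auto
  show ?case
  proof (cases "x \<in> S")
    case False
    then have SK: "S \<subseteq> K" using insert.prems(1) by blast
    have "(U(x := y)) s = U s" if "s \<in> S" for U :: "nat \<Rightarrow> 'm" and y s using that False by auto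
    then have "(\<integral>\<^sup>+U. ennreal ((cmod (\<Sum>w\<in>PiE S J. m w * (\<Prod>s\<in>S. z s (U s) (w s))))\<^sup>2) \<partial>PiM (insert x K) M)
        = (\<integral>\<^sup>+U. ennreal ((cmod (\<Sum>w\<in>PiE S J. m w * (\<Prod>s\<in>S. z s (U s) (w s))))\<^sup>2) \<partial>PiM K M)"
      using insert.hyps meas
      by (subst product_nn_integral_insert) (simp_all add: px.emeasure_space_1 cong: prod.cong)
    also have "\<dots> \<le> ennreal ((\<Prod>s\<in>S. c s) * (\<Sum>w\<in>PiE S J. (cmod (m w))\<^sup>2))"
      by (rule insert.IH[OF SK]) (use insert.prems in auto)
    finally show ?thesis .
  next
    case True
    define T where "T = S - {x}"
    have T: "x \<notin> T" "S = insert x T" "T \<subseteq> K" "finite T"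
      using True insert.prems(1) finS by (auto simp: T_def)
    have zp: "0 \<le> (\<Prod>s\<in>T. c s)" using T insert.prems by (intro prod_nonneg) auto
    \<comment> \<open>\<open>G U j\<close> collects everything multiplying \<open>z x y j\<close>;
      it does not involve the coordinate \<open>x\<close> of \<open>U\<close>, so it is constant in
      the inner integral.\<close>
    define G where "G = (\<lambda>U j. \<Sum>w\<in>PiE T J. m (w(x := j)) * (\<Prod>s\<in>T. z s (U s) (w s)))"
    have eq: "(\<Sum>w\<in>PiE S J. m w * (\<Prod>s\<in>S. z s ((U(x := y)) s) (w s))) = (\<Sum>j\<in>J x. G U j * z x y j)" for U y
    proof -
      have "(\<Prod>s\<in>T. z s ((U(x := y)) s) ((w(x := j)) s)) = (\<Prod>s\<in>T. z s (U s) (w s))" for w j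
        using T(1) by (intro prod.cong) auto
      then show ?thesis
        unfolding T(2) sum_PiE_insert[OF T(1)] G_def sum_distrib_right
        using T by (simp add: mult_ac)
    qed
    have mG: "(\<lambda>U. ennreal ((cmod (G U j))\<^sup>2)) \<in> borel_measurable (PiM K M)" for j
      unfolding G_def using T(3)
      by (intro measurable_compose[OF _ measurable_ennreal] borel_measurable_power measurable_compose[OF _ borel_measurable_norm]
        borel_measurable_sum borel_measurable_times borel_measurable_const borel_measurable_prod m2) auto
    have "(\<integral>\<^sup>+U. ennreal ((cmod (\<Sum>w\<in>PiE S J. m w * (\<Prod>s\<in>S. z s (U s) (w s))))\<^sup>2) \<partial>PiM (insert x K) M)
        = (\<integral>\<^sup>+U. (\<integral>\<^sup>+y. ennreal ((cmod (\<Sum>j\<in>J x. G U j * z x y j))\<^sup>2) \<partial>M x) \<partial>PiM K M)"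
      unfolding product_nn_integral_insert[OF insert.hyps meas] eq ..
    also have "\<dots> \<le> (\<integral>\<^sup>+U. ennreal (c x * (\<Sum>j\<in>J x. (cmod (G U j))\<^sup>2)) \<partial>PiM K M)"
      by (intro nn_integral_mono insert.prems) auto
    also have "\<dots> = (\<integral>\<^sup>+U. (\<Sum>j\<in>J x. ennreal (c x) * ennreal ((cmod (G U j))\<^sup>2)) \<partial>PiM K M)"
      using insert.prems(4)[of x]
      by (intro nn_integral_cong) (simp add: sum_distrib_left ennreal_mult flip: sum_ennreal)
    also have "\<dots> = (\<Sum>j\<in>J x. ennreal (c x) * (\<integral>\<^sup>+U. ennreal ((cmod (G U j))\<^sup>2) \<partial>PiM K M))"
      using mG by (simp add: nn_integral_sum nn_integral_cmult)
    also have "\<dots> \<le> (\<Sum>j\<in>J x. ennreal (c x) * ennreal ((\<Prod>s\<in>T. c s) * (\<Sum>w\<in>PiE T J. (cmod (m (w(x := j))))\<^sup>2)))"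
      unfolding G_def
      by (intro sum_mono mult_left_mono insert.IH[OF T(3)]) (use insert.prems in auto)
    also have "\<dots> = ennreal (\<Sum>j\<in>J x. c x * ((\<Prod>s\<in>T. c s) * (\<Sum>w\<in>PiE T J. (cmod (m (w(x := j))))\<^sup>2)))"
      using insert.prems(4)[of x] zp
      by (subst sum_ennreal[symmetric]) (auto simp: ennreal_mult sum_nonneg)
    also have "(\<Sum>j\<in>J x. c x * ((\<Prod>s\<in>T. c s) * (\<Sum>w\<in>PiE T J. (cmod (m (w(x := j))))\<^sup>2)))
        = (\<Prod>s\<in>S. c s) * (\<Sum>w\<in>PiE S J. (cmod (m w))\<^sup>2)"
      unfolding T(2) sum_PiE_insert[OF T(1)] using T by (simp add: sum_distrib_left mult.assoc)
    finally show ?thesis .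
  qed
qed

subsection \<open>Contractions with product kernels\<close>

lemma sum_swap3:
  "(\<Sum>i\<in>A. \<Sum>j\<in>B. \<Sum>k\<in>C. f i j k) = (\<Sum>k\<in>C. \<Sum>i\<in>A. \<Sum>j\<in>B. f i j k)"
proof -
  have "(\<Sum>i\<in>A. \<Sum>j\<in>B. \<Sum>k\<in>C. f i j k) = (\<Sum>i\<in>A. \<Sum>k\<in>C. \<Sum>j\<in>B. f i j k)"
    by (rule sum.cong[OF refl], rule sum.swap)
  also have "\<dots> = (\<Sum>k\<in>C. \<Sum>i\<in>A. \<Sum>j\<in>B. f i j k)" by (rule sum.swap)
  finally show ?thesis .
qed

lemma gram_sum:
  assumes "\<And>h. h \<in> H \<Longrightarrow> gram X (k h)"
  shows "gram X (\<lambda>x y. \<Sum>h\<in>H. k h x y)"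
proof (cases "finite H")
  case True
  have "\<exists>N u. \<forall>x\<in>X. \<forall>y\<in>X. k h x y = (\<Sum>n<(N::nat). u n x * cnj (u n y))" if "h \<in> H" for h
    using assms[OF that] by (simp add: gram_def)
  then obtain N u where u: "\<And>h x y. h \<in> H \<Longrightarrow> x \<in> X \<Longrightarrow> y \<in> X \<Longrightarrow>
      k h x y = (\<Sum>n<(N h::nat). u h n x * cnj (u h n y))" by metis
  show ?thesis
  proof (rule gramI[of "SIGMA h:H. {..<N h}" _ _ "\<lambda>p. u (fst p) (snd p)"])
    show "finite (SIGMA h:H. {..<N h})" using True by auto
    fix x y assume "x \<in> X" "y \<in> X"
    then have "(\<Sum>h\<in>H. k h x y) = (\<Sum>h\<in>H. \<Sum>n<N h. u h n x * cnj (u h n y))"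
      using u by (intro sum.cong) auto
    also have "\<dots> = (\<Sum>p\<in>(SIGMA h:H. {..<N h}). u (fst p) (snd p) x * cnj (u (fst p) (snd p) y))"
      using True by (subst sum.Sigma) (auto simp: case_prod_beta)
    finally show "(\<Sum>h\<in>H. k h x y) = (\<Sum>p\<in>(SIGMA h:H. {..<N h}). u (fst p) (snd p) x * cnj (u (fst p) (snd p) y))" .
  qed
next
  case False
  then show ?thesis using gram_const[of 0 X] by simp
qed

text \<open>Adding the Gram vectors over \<open>Z\<close> gives Gram vectors of the sum. This is how
  inner indices of a contraction are summed out without losing positivity.\<close>

lemma gram_double_sum:
  assumes "gram (Z \<times> X) k"
  shows "gram X (\<lambda>x y. \<Sum>p\<in>Z. \<Sum>q\<in>Z. k (p, x) (q, y))"
proof -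
  obtain N u where u: "\<forall>x\<in>Z\<times>X. \<forall>y\<in>Z\<times>X. k x y = (\<Sum>n<(N::nat). u n x * cnj (u n y))"
    using assms by (auto simp: gram_def)
  show ?thesis
  proof (rule gramI[of "{..<N}" _ _ "\<lambda>n x. \<Sum>p\<in>Z. u n (p, x)"])
    fix x y assume xy: "x \<in> X" "y \<in> X"
    then have "(\<Sum>p\<in>Z. \<Sum>q\<in>Z. k (p, x) (q, y)) = (\<Sum>p\<in>Z. \<Sum>q\<in>Z. \<Sum>n<N. u n (p, x) * cnj (u n (q, y)))"
      using u by (intro sum.cong) auto
    also have "\<dots> = (\<Sum>n<N. \<Sum>p\<in>Z. \<Sum>q\<in>Z. u n (p, x) * cnj (u n (q, y)))"
      by (rule sum_swap3)
    also have "\<dots> = (\<Sum>n<N. (\<Sum>p\<in>Z. u n (p, x)) * cnj (\<Sum>p\<in>Z. u n (p, y)))"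
      unfolding cnj_sum sum_product ..
    finally show "(\<Sum>p\<in>Z. \<Sum>q\<in>Z. k (p, x) (q, y)) = (\<Sum>n<N. (\<Sum>p\<in>Z. u n (p, x)) * cnj (\<Sum>p\<in>Z. u n (p, y)))" .
  qed simp
qed

lemma psd_zero: "psd I (\<lambda>i j. 0)"
  by (auto simp: psd_def opers_def adj_def inner_on_def apply_op_def)

lemma psd_sum: "(\<And>h. h \<in> H \<Longrightarrow> psd I (P h)) \<Longrightarrow> psd I (\<lambda>i j. \<Sum>h\<in>H. P h i j)"
proof (induction H rule: infinite_finite_induct)
  case (insert h H)
  then show ?case using psd_add[of I "P h" "\<lambda>i j. \<Sum>h\<in>H. P h i j"] by simp
qed (auto simp: psd_zero)

lemma trace_sum: "trace_op I (\<lambda>i j. \<Sum>h\<in>H. P h i j) = (\<Sum>h\<in>H. trace_op I (P h))"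
  unfolding trace_op_def by (rule sum.swap)

lemma schatten_1_sum:
  assumes "finite I" "finite H" "\<And>h. h \<in> H \<Longrightarrow> M h \<in> opers I" "\<And>h. h \<in> H \<Longrightarrow> adj (M h) = M h"
  shows "schatten_norm I 1 (\<lambda>i j. \<Sum>h\<in>H. M h i j) \<le> (\<Sum>h\<in>H. schatten_norm I 1 (M h))"
  using assms(2-)
proof (induction H rule: finite_induct)
  case empty
  then show ?case using schatten_1_psd[OF assms(1) psd_zero] by (simp add: trace_op_def)
next
  case (insert h H)
  let ?N = "\<lambda>i j. \<Sum>h\<in>H. M h i j"
  have a: "cnj (M h i j) = M h j i" if "h \<in> H" for h i j
    using insert.prems(2)[of h] that by (auto simp: adj_def fun_eq_iff)
  have "?N \<in> opers I" using insert.prems(1) by (force simp: opers_def intro!: sum.neutral)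
  moreover have "adj ?N = ?N" by (simp add: adj_def a)
  ultimately have "schatten_norm I 1 (\<lambda>i j. M h i j + ?N i j) \<le> schatten_norm I 1 (M h) + schatten_norm I 1 ?N"
    using insert.prems by (intro schatten_1_triangle assms(1)) auto
  also have "\<dots> \<le> schatten_norm I 1 (M h) + (\<Sum>h\<in>H. schatten_norm I 1 (M h))"
    using insert by simp
  finally show ?case using insert.hyps by simp
qed

text \<open>With \<open>t\<close> a Choi matrix and \<open>\<kappa>\<close> the (rescaled) kernel of a superoperator \<open>E\<close>, this is the image of \<open>x\<close>
  under \<open>(T \<circ> E) \<otimes> \<bbbI>\<close>; the first components of \<open>p, q\<close> are the output indices of \<open>E\<close>.\<close>

definition contract ::
    "'f set \<Rightarrow> ('f \<times> 'f) oper \<Rightarrow> ('f \<times> 'b) oper \<Rightarrow> ('f \<times> 'r) oper \<Rightarrow> ('b \<times> 'r) oper" where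
  "contract X \<kappa> t x = (\<lambda>br br'. \<Sum>p\<in>X\<times>X. \<Sum>q\<in>X\<times>X.
     \<kappa> p q * t (fst p, fst br) (fst q, fst br') * x (snd p, snd br) (snd q, snd br'))"

lemma contract_opers:
  assumes "t \<in> opers (X \<times> B)" "x \<in> opers (X \<times> R)"
  shows "contract X \<kappa> t x \<in> opers (B \<times> R)"
proof -
  have "t (f, b) (f', b') * x (g, r) (g', r') = 0" if "(b, r) \<notin> B \<times> R \<or> (b', r') \<notin> B \<times> R" for f b f' b' g r g' r'
    using assms that by (auto simp: opers_def)
  then show ?thesis unfolding opers_def contract_def
    by (auto intro!: sum.neutral simp: mult.assoc)
qed

lemma contract_hermitian:
  assumes "\<And>p q. p \<in> X\<times>X \<Longrightarrow> q \<in> X\<times>X \<Longrightarrow> cnj (\<kappa> p q) = \<kappa> q p" and "adj t = t" "adj x = x"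
  shows "adj (contract X \<kappa> t x) = contract X \<kappa> t x"
proof -
  have "cnj (t i j) = t j i" "cnj (x k l) = x l k" for i j k l
    by (metis adj_def assms(2)) (metis adj_def assms(3))
  then have "cnj (contract X \<kappa> t x j i) = contract X \<kappa> t x i j" for i j
    unfolding contract_def by (subst sum.swap) (simp add: assms(1))
  then show ?thesis by (simp add: adj_def)
qed

lemma contract_diff_left:
  "contract X \<kappa> (\<lambda>i j. t i j - t' i j) x = (\<lambda>i j. contract X \<kappa> t x i j - contract X \<kappa> t' x i j)"
  by (simp add: contract_def algebra_simps sum_subtractf)

lemma contract_diff_right:
  "contract X \<kappa> t (\<lambda>i j. x i j - x' i j) = (\<lambda>i j. contract X \<kappa> t x i j - contract X \<kappa> t x' i j)"
  by (simp add: contract_def algebra_simps sum_subtractf)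

lemma contract_sum_kernel:
  "contract X (\<lambda>p q. \<Sum>h\<in>H. c h * \<kappa> h p q) t x = (\<lambda>i j. \<Sum>h\<in>H. c h * contract X (\<kappa> h) t x i j)"
proof -
  have "contract X (\<lambda>p q. \<Sum>h\<in>H. c h * \<kappa> h p q) t x i j = (\<Sum>h\<in>H. c h * contract X (\<kappa> h) t x i j)" for i j
    unfolding contract_def sum_distrib_left sum_distrib_right
    by (subst sum_swap3) (simp add: mult.assoc)
  then show ?thesis by (simp add: fun_eq_iff)
qed

text \<open>Over inner and outer indices jointly, the summand is an entrywise product of three
  positive kernels; summing out the inner indices on both sides preserves positivity. Thus complete
  positivity of the superoperators reduces to the Schur product theorem.\<close>

lemma contract_psd:
  assumes fin: "finite X" "finite B" "finite R" and \<kappa>: "gram (X \<times> X) \<kappa>"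
    and t: "psd (X \<times> B) t" and x: "psd (X \<times> R) x"
  shows "psd (B \<times> R) (contract X \<kappa> t x)"
proof (rule psd_if_gram)
  show "contract X \<kappa> t x \<in> opers (B \<times> R)"
    using t x by (intro contract_opers) (auto simp: psd_def)
  let ?Z = "(X \<times> X) \<times> (B \<times> R)"
  have "gram ?Z (\<lambda>y z. \<kappa> (fst y) (fst z))"
    by (rule gram_pullback[OF \<kappa>]) auto
  moreover have "gram ?Z (\<lambda>y z. t (fst (fst y), fst (snd y)) (fst (fst z), fst (snd z)))"
    by (rule gram_pullback[OF psd_gram[OF _ t], of ?Z "\<lambda>y. (fst (fst y), fst (snd y))"]) (use fin in auto)
  moreover have "gram ?Z (\<lambda>y z. x (snd (fst y), snd (snd y)) (snd (fst z), snd (snd z)))"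
    by (rule gram_pullback[OF psd_gram[OF _ x], of ?Z "\<lambda>y. (snd (fst y), snd (snd y))"]) (use fin in auto)
  ultimately have "gram ?Z (\<lambda>y z. \<kappa> (fst y) (fst z) * t (fst (fst y), fst (snd y)) (fst (fst z), fst (snd z))
      * x (snd (fst y), snd (snd y)) (snd (fst z), snd (snd z)))"
    by (intro gram_mult)
  from gram_double_sum[OF this] show "gram (B \<times> R) (contract X \<kappa> t x)"
    by (simp add: contract_def)
qed

lemma trace_contract:
  "trace_op (B \<times> R) (contract X \<kappa> t x) = (\<Sum>p\<in>X\<times>X. \<Sum>q\<in>X\<times>X. \<kappa> p q *
     ((\<Sum>b\<in>B. t (fst p, b) (fst q, b)) * (\<Sum>r\<in>R. x (snd p, r) (snd q, r))))"
proof -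
  have "trace_op (B \<times> R) (contract X \<kappa> t x) = (\<Sum>br\<in>B\<times>R. \<Sum>p\<in>X\<times>X. \<Sum>q\<in>X\<times>X. \<kappa> p q *
     (t (fst p, fst br) (fst q, fst br) * x (snd p, snd br) (snd q, snd br)))"
    by (simp add: trace_op_def contract_def mult.assoc)
  also have "\<dots> = (\<Sum>p\<in>X\<times>X. \<Sum>q\<in>X\<times>X. \<Sum>br\<in>B\<times>R. \<kappa> p q *
     (t (fst p, fst br) (fst q, fst br) * x (snd p, snd br) (snd q, snd br)))"
    by (rule sum_swap3[symmetric])
  also have "\<dots> = (\<Sum>p\<in>X\<times>X. \<Sum>q\<in>X\<times>X. \<kappa> p q *
     ((\<Sum>b\<in>B. t (fst p, b) (fst q, b)) * (\<Sum>r\<in>R. x (snd p, r) (snd q, r))))"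
    by (intro sum.cong refl)
      (simp add: sum_distrib_left[symmetric], simp add: sum_product sum.cartesian_product case_prod_beta)
  finally show ?thesis .
qed

section \<open>Kernels of conjugations, depolarisations and fluctuations on several systems\<close>

definition comp_at :: "nat \<Rightarrow> (nat \<Rightarrow> 'a) \<times> (nat \<Rightarrow> 'a) \<Rightarrow> 'a \<times> 'a" where
  "comp_at s p = (fst p s, snd p s)"

definition conj_ker :: "'a oper \<Rightarrow> 'a \<times> 'a \<Rightarrow> 'a \<times> 'a \<Rightarrow> complex" where
  "conj_ker V p q = V (fst p) (snd p) * cnj (V (fst q) (snd q))"

definition depol_ker :: "'a set \<Rightarrow> 'a \<times> 'a \<Rightarrow> 'a \<times> 'a \<Rightarrow> complex" where
  "depol_ker A p q = (if p = q then 1 / of_nat (card A) else 0)"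

lemma fluct_eq: "fluct A V p q = conj_ker V p q - depol_ker A p q"
  by (simp add: fluct_def conj_ker_def depol_ker_def)

lemma prod_depol_ker:
  assumes "finite S" "p \<in> PiE S A \<times> PiE S A" "q \<in> PiE S A \<times> PiE S A"
  shows "(\<Prod>s\<in>S. depol_ker (A s) (comp_at s p) (comp_at s q)) = (if p = q then 1 / of_nat (card (PiE S A)) else 0)"
proof (cases "p = q")
  case True
  then show ?thesis using assms by (simp add: depol_ker_def card_PiE prod_dividef)
next
  case False
  have "\<exists>s\<in>S. comp_at s p \<noteq> comp_at s q"
  proof (rule ccontr)
    assume "\<not> ?thesis"
    then have "fst p s = fst q s" "snd p s = snd q s" if "s \<in> S" for s using that by (auto simp: comp_at_def)
    moreover have "fst p \<in> PiE S A" "fst q \<in> PiE S A" "snd p \<in> PiE S A" "snd q \<in> PiE S A"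
      using assms by auto
    ultimately have "fst p = fst q" "snd p = snd q" by (metis PiE_ext)+
    then show False using False by (simp add: prod_eq_iff)
  qed
  then show ?thesis using assms False by (auto simp: depol_ker_def)
qed

text \<open>The factor \<open>card (PiE S A)\<close> undoes the normalisation of the EPR states in
  the Choi matrix.\<close>

definition fluct_fam ::
  "nat set \<Rightarrow> (nat \<Rightarrow> 'a set) \<Rightarrow> (nat \<Rightarrow> 'a oper) \<Rightarrow> ((nat \<Rightarrow> 'a) \<times> (nat \<Rightarrow> 'a)) oper" where
  "fluct_fam S A U p q = of_nat (card (PiE S A)) * (\<Prod>s\<in>S. fluct (A s) (U s) (comp_at s p) (comp_at s q))"

definition mixed_fam ::
  "nat set \<Rightarrow> nat set \<Rightarrow> (nat \<Rightarrow> 'a set) \<Rightarrow> (nat \<Rightarrow> 'a oper) \<Rightarrow> ((nat \<Rightarrow> 'a) \<times> (nat \<Rightarrow> 'a)) oper" where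
  "mixed_fam S Q A U p q = of_nat (card (PiE S A)) * ((\<Prod>s\<in>Q. conj_ker (U s) (comp_at s p) (comp_at s q))
      * (\<Prod>s\<in>S - Q. depol_ker (A s) (comp_at s p) (comp_at s q)))"

lemma fluct_fam_expand:
  assumes "finite S"
  shows "fluct_fam S A U p q = (\<Sum>Q\<in>Pow S. (-1) ^ card (S - Q) * mixed_fam S Q A U p q)"
proof -
  have "(\<Prod>s\<in>S. fluct (A s) (U s) (comp_at s p) (comp_at s q))
      = (\<Sum>Q\<in>Pow S. (\<Prod>s\<in>Q. conj_ker (U s) (comp_at s p) (comp_at s q))
         * (\<Prod>s\<in>S - Q. - depol_ker (A s) (comp_at s p) (comp_at s q)))"
    unfolding fluct_eq diff_conv_add_uminus by (rule prod_add[OF assms])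
  then show ?thesis
    unfolding fluct_fam_def mixed_fam_def sum_distrib_left
    by (simp add: prod_uminus sum_distrib_left mult_ac)
qed

lemma fluct_fam_hermitian: "cnj (fluct_fam S A U p q) = fluct_fam S A U q p"
  by (auto simp: fluct_fam_def fluct_def intro!: prod.cong)

lemma gram_mixed_fam:
  assumes "\<And>s. s \<in> S \<Longrightarrow> finite (A s)"
  shows "gram (PiE S A \<times> PiE S A) (mixed_fam S Q A U)"
proof -
  let ?X = "PiE S A \<times> PiE S A"
  have "gram ?X (\<lambda>p q. conj_ker (U s) (comp_at s p) (comp_at s q))" for s
    unfolding conj_ker_def by (rule gram_rank_one[of ?X "\<lambda>p. U s (fst (comp_at s p)) (snd (comp_at s p))"])
  moreover have "gram ?X (\<lambda>p q. depol_ker (A s) (comp_at s p) (comp_at s q))" if "s \<in> S" for s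
  proof -
    have "gram ?X (\<lambda>p q. complex_of_real (1 / real (card (A s))) * (if comp_at s p = comp_at s q then 1 else 0))"
      using that assms
      by (intro gram_mult gram_const gram_delta[of "A s \<times> A s"]) (auto simp: comp_at_def PiE_mem)
    then show ?thesis by (simp add: depol_ker_def if_distrib[of "\<lambda>x. _ * x"] cong: if_cong)
  qed
  ultimately have "gram ?X (\<lambda>p q. complex_of_real (real (card (PiE S A))) *
      ((\<Prod>s\<in>Q. conj_ker (U s) (comp_at s p) (comp_at s q))
      * (\<Prod>s\<in>S - Q. depol_ker (A s) (comp_at s p) (comp_at s q))))"
    by (intro gram_mult gram_const gram_prod) auto
  then show ?thesis by (simp add: mixed_fam_def[abs_def])
qed

text \<open>The Booleans select positive (\<open>True\<close>) or negative parts. Each term of the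
  expansion carries the product of three signs: that of \<open>Q\<close>, that of the part of
  \<open>t\<close> and that of the part of \<open>x\<close>. Terms of total sign plus go into
  \<open>P\<close>, the others into \<open>N\<close>, and both are positive because every single
  term is.\<close>

lemma schatten_1_contract_fluct_le:
  fixes A :: "nat \<Rightarrow> 'a set"
  assumes fin: "finite S" "\<And>s. s \<in> S \<Longrightarrow> finite (A s)" "finite B" "finite R"
    and t: "\<And>i. psd (PiE S A \<times> B) (t i)" and x: "\<And>i. psd (PiE S A \<times> R) (x i)"
  shows "schatten_norm (B \<times> R) 1 (contract (PiE S A) (fluct_fam S A U)
       (\<lambda>a b. t True a b - t False a b) (\<lambda>a b. x True a b - x False a b))
    \<le> (\<Sum>Q\<in>Pow S. \<Sum>i\<in>UNIV. \<Sum>j\<in>UNIV.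
         Re (trace_op (B \<times> R) (contract (PiE S A) (mixed_fam S Q A U) (t i) (x j))))"
proof -
  define X where "X = PiE S A"
  have finX: "finite X" unfolding X_def using fin by (intro finite_PiE)
  define L where "L = (\<lambda>Q i j. contract X (mixed_fam S Q A U) (t i) (x j))"
  have L: "psd (B \<times> R) (L Q i j)" for Q i j
    unfolding L_def X_def using fin finX t x
    by (intro contract_psd gram_mixed_fam) (auto simp: X_def)
  define e where "e = (\<lambda>Q. even (card (S - Q)))"
  define P where "P = (\<lambda>y z. \<Sum>Q\<in>Pow S. (L Q True (e Q) y z + L Q False (\<not> e Q) y z))"
  define N where "N = (\<lambda>y z. \<Sum>Q\<in>Pow S. (L Q True (\<not> e Q) y z + L Q False (e Q) y z))"
  have "contract X (fluct_fam S A U) (\<lambda>a b. t True a b - t False a b) (\<lambda>a b. x True a b - x False a b)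
      = (\<lambda>y z. P y z - N y z)"
  proof -
    have "contract X (fluct_fam S A U) (\<lambda>a b. t True a b - t False a b) (\<lambda>a b. x True a b - x False a b)
      = (\<lambda>y z. \<Sum>Q\<in>Pow S. (-1) ^ card (S - Q) *
         (L Q True True y z - L Q True False y z - (L Q False True y z - L Q False False y z)))"
      unfolding fluct_fam_expand[OF fin(1), abs_def] contract_sum_kernel contract_diff_left contract_diff_right L_def
      by (simp add: algebra_simps)
    also have "\<dots> = (\<lambda>y z. P y z - N y z)"
      unfolding P_def N_def sum_subtractf[symmetric] e_def
      by (intro ext sum.cong refl) (auto simp: uminus_power_if)
    finally show ?thesis .
  qed
  moreover have "psd (B \<times> R) P" "psd (B \<times> R) N"
    unfolding P_def N_def by (intro psd_sum psd_add L)+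
  ultimately have "schatten_norm (B \<times> R) 1 (contract X (fluct_fam S A U)
       (\<lambda>a b. t True a b - t False a b) (\<lambda>a b. x True a b - x False a b))
     \<le> Re (trace_op (B \<times> R) P) + Re (trace_op (B \<times> R) N)"
    using schatten_1_le_traces[of "B \<times> R" P N] fin by simp
  also have "\<dots> = (\<Sum>Q\<in>Pow S. Re (trace_op (B \<times> R) (L Q True (e Q))) + Re (trace_op (B \<times> R) (L Q False (\<not> e Q)))
      + (Re (trace_op (B \<times> R) (L Q True (\<not> e Q))) + Re (trace_op (B \<times> R) (L Q False (e Q)))))"
    unfolding P_def N_def trace_sum trace_add by (simp add: sum.distrib)
  also have "\<dots> = (\<Sum>Q\<in>Pow S. \<Sum>i\<in>UNIV. \<Sum>j\<in>UNIV. Re (trace_op (B \<times> R) (L Q i j)))"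
  proof (intro sum.cong refl)
    show "Re (trace_op (B \<times> R) (L Q True (e Q))) + Re (trace_op (B \<times> R) (L Q False (\<not> e Q)))
      + (Re (trace_op (B \<times> R) (L Q True (\<not> e Q))) + Re (trace_op (B \<times> R) (L Q False (e Q))))
      = (\<Sum>i\<in>UNIV. \<Sum>j\<in>UNIV. Re (trace_op (B \<times> R) (L Q i j)))" for Q
      by (cases "e Q") (simp_all add: UNIV_bool)
  qed
  finally show ?thesis unfolding L_def X_def .
qed

section \<open>First moments over independent Haar unitaries\<close>

locale haar_family =
  fixes K :: "nat set" and A :: "nat \<Rightarrow> 'a set" and \<mu> :: "nat \<Rightarrow> 'a oper measure"
  assumes finK: "finite K" and hu: "\<And>s. s \<in> K \<Longrightarrow> haar_unitary (A s) (\<mu> s)"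
    and prob: "\<And>s. prob_space (\<mu> s)"
begin

sublocale product_prob_space \<mu> K
  by (intro product_prob_spaceI prob)

lemma finA: "s \<in> K \<Longrightarrow> finite (A s)"
  using hu by (auto simp: haar_unitary_def)

lemma cardA: "s \<in> K \<Longrightarrow> 2 \<le> card (A s)"
  using hu by (auto simp: haar_unitary_def)

lemma entry_measurable_fam: "s \<in> K \<Longrightarrow> (\<lambda>U. U s i c) \<in> borel_measurable (PiM K \<mu>)"
  by (rule measurable_compose[of "\<lambda>U. U s" _ "\<mu> s" "\<lambda>V. V i c"])
    (auto intro: haar_unitary.entry_measurable hu)

text \<open>On average a conjugation is a depolarisation, so the mean is the same for every
  \<open>Q\<close>: the full depolarisation, whose normalisation cancels against the
  prefactor.\<close>

lemma mixed_fam_moment: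
  assumes "S \<subseteq> K" "Q \<subseteq> S" "p \<in> PiE S A \<times> PiE S A" "q \<in> PiE S A \<times> PiE S A"
  shows "integrable (PiM K \<mu>) (\<lambda>U. mixed_fam S Q A U p q)"
    and "(\<integral>U. mixed_fam S Q A U p q \<partial>PiM K \<mu>) = (if p = q then 1 else 0)"
proof -
  \<comment> \<open>The factor 1 outside \<open>S\<close> turns the kernel into a product over all
    of \<open>K\<close>, so that integration over the product measure factorises.\<close>
  define h where "h = (\<lambda>s V. if s \<in> Q then conj_ker V (comp_at s p) (comp_at s q)
     else if s \<in> S then depol_ker (A s) (comp_at s p) (comp_at s q) else 1)"
  have finS: "finite S" using assms(1) finK finite_subset by blast
  have split: "(\<Prod>s\<in>K. f s) = (\<Prod>s\<in>Q. f s) * (\<Prod>s\<in>S - Q. f s) * (\<Prod>s\<in>K - S. f s)" for f :: "nat \<Rightarrow> complex"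
    using prod.subset_diff[OF assms(1) finK, of f] prod.subset_diff[OF assms(2) finS, of f]
    by (simp add: mult_ac)
  have K: "mixed_fam S Q A U p q = of_nat (card (PiE S A)) * (\<Prod>s\<in>K. h s (U s))" for U
  proof -
    have "(\<Prod>s\<in>Q. h s (U s)) = (\<Prod>s\<in>Q. conj_ker (U s) (comp_at s p) (comp_at s q))"
      by (intro prod.cong) (auto simp: h_def)
    moreover have "(\<Prod>s\<in>S-Q. h s (U s)) = (\<Prod>s\<in>S-Q. depol_ker (A s) (comp_at s p) (comp_at s q))"
      by (intro prod.cong) (auto simp: h_def)
    moreover have "(\<Prod>s\<in>K-S. h s (U s)) = 1"
      using assms(2) by (intro prod.neutral) (auto simp: h_def)
    ultimately show ?thesis unfolding split by (simp add: mixed_fam_def)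
  qed
  have mem: "comp_at s p \<in> A s \<times> A s" "comp_at s q \<in> A s \<times> A s" if "s \<in> S" for s
    using assms(3,4) that by (auto simp: comp_at_def PiE_mem)
  have int: "integrable (\<mu> s) (h s)" if "s \<in> K" for s
  proof -
    interpret haar_unitary "A s" "\<mu> s" by (rule hu[OF that])
    show ?thesis
      using integrable2 by (cases "s \<in> Q"; cases "s \<in> S") (auto simp: h_def conj_ker_def)
  qed
  have mom: "(\<integral>V. h s V \<partial>\<mu> s) = (if s \<in> S then depol_ker (A s) (comp_at s p) (comp_at s q) else 1)"
    if "s \<in> K" for s
  proof -
    interpret haar_unitary "A s" "\<mu> s" by (rule hu[OF that])
    show ?thesis
    proof (cases "s \<in> Q")
      case True
      then have "s \<in> S" using assms(2) by blast
      then show ?thesis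
        using True mom2_eq[of "fst (comp_at s p)" "fst (comp_at s q)" "snd (comp_at s p)" "snd (comp_at s q)"] mem[of s]
        by (auto simp: h_def conj_ker_def depol_ker_def mom2_def prod_eq_iff mem_Times_iff)
    next
      case False
      then show ?thesis by (simp add: h_def prob_space.prob_space[OF prob])
    qed
  qed
  show "integrable (PiM K \<mu>) (\<lambda>U. mixed_fam S Q A U p q)"
    unfolding K by (intro integrable_mult_right product_integrable_prod finK int)
  have "(\<integral>U. mixed_fam S Q A U p q \<partial>PiM K \<mu>) = of_nat (card (PiE S A)) * (\<Prod>s\<in>K. \<integral>V. h s V \<partial>\<mu> s)"
    unfolding K using product_integral_prod[OF finK int] by simp
  also have "(\<Prod>s\<in>K. \<integral>V. h s V \<partial>\<mu> s) = (\<Prod>s\<in>K. if s \<in> S then depol_ker (A s) (comp_at s p) (comp_at s q) else 1)"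
    by (intro prod.cong mom) auto
  also have "\<dots> = (\<Prod>s\<in>S. depol_ker (A s) (comp_at s p) (comp_at s q))"
    using assms(1) finK by (simp add: prod.If_cases Int_absorb1)
  also have "of_nat (card (PiE S A)) * \<dots> = (if p = q then 1 else 0)"
  proof -
    have "card (A s) \<noteq> 0" if "s \<in> S" for s using cardA[of s] that assms(1) by auto
    then have "card (PiE S A) \<noteq> 0" using finS by (simp only: card_PiE prod_zero_iff) blast
    then show ?thesis using prod_depol_ker[OF finS assms(3,4)] by simp
  qed
  finally show "(\<integral>U. mixed_fam S Q A U p q \<partial>PiM K \<mu>) = (if p = q then 1 else 0)" .
qed

text \<open>The averaged kernel is the identity kernel. It contracts the inner indices of
  \<open>t\<close> and of \<open>x\<close> with themselves, which together with the outer trace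
  leaves the product of the full traces.\<close>

lemma trace_contract_moment:
  assumes "S \<subseteq> K" "Q \<subseteq> S" "finite B" "finite R" "psd (PiE S A \<times> B) t" "psd (PiE S A \<times> R) x"
  shows "(\<lambda>U. ennreal (Re (trace_op (B \<times> R) (contract (PiE S A) (mixed_fam S Q A U) t x))))
      \<in> borel_measurable (PiM K \<mu>)" (is ?meas)
    and "(\<integral>\<^sup>+U. ennreal (Re (trace_op (B \<times> R) (contract (PiE S A) (mixed_fam S Q A U) t x))) \<partial>PiM K \<mu>)
      = ennreal (Re (trace_op (PiE S A \<times> B) t) * Re (trace_op (PiE S A \<times> R) x))"
proof -
  define X where "X = PiE S A"
  have finX: "finite X" unfolding X_def using assms(1) finK finA by (intro finite_PiE) (auto intro: finite_subset)
  define c where "c = (\<lambda>p q. (\<Sum>b\<in>B. t (fst p, b) (fst q, b)) * (\<Sum>r\<in>R. x (snd p, r) (snd q, r)))"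
  define F where "F = (\<lambda>U. \<Sum>p\<in>X\<times>X. \<Sum>q\<in>X\<times>X. mixed_fam S Q A U p q * c p q)"
  have F: "trace_op (B \<times> R) (contract (PiE S A) (mixed_fam S Q A U) t x) = F U" for U
    unfolding F_def c_def trace_contract X_def ..
  have pos: "0 \<le> Re (F U)" for U
    unfolding F[symmetric] using assms finX finA
    by (intro psd_trace_nonneg contract_psd gram_mixed_fam) (auto simp: X_def)
  have int: "integrable (PiM K \<mu>) (\<lambda>U. mixed_fam S Q A U p q)" if "p \<in> X \<times> X" "q \<in> X \<times> X" for p q
    by (rule mixed_fam_moment(1)) (use assms that in \<open>auto simp: X_def\<close>)
  have intF: "integrable (PiM K \<mu>) F"
    unfolding F_def by (intro Bochner_Integration.integrable_sum integrable_mult_left int)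
  have "(\<integral>U. F U \<partial>PiM K \<mu>) = (\<Sum>p\<in>X\<times>X. \<Sum>q\<in>X\<times>X. (\<integral>U. mixed_fam S Q A U p q \<partial>PiM K \<mu>) * c p q)"
    unfolding F_def
    by (subst Bochner_Integration.integral_sum, intro Bochner_Integration.integrable_sum integrable_mult_left int, assumption+,
        rule sum.cong[OF refl], subst Bochner_Integration.integral_sum, intro integrable_mult_left int, assumption+) simp
  also have "\<dots> = (\<Sum>p\<in>X\<times>X. \<Sum>q\<in>X\<times>X. if p = q then c p p else 0)"
    using assms by (intro sum.cong refl, subst mixed_fam_moment(2)) (auto simp: X_def)
  also have "\<dots> = (\<Sum>p\<in>X\<times>X. c p p)"
    using finX by simp
  also have "\<dots> = trace_op (X \<times> B) t * trace_op (X \<times> R) x"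
  proof -
    have tr: "trace_op (X \<times> B) t = (\<Sum>u\<in>X. \<Sum>b\<in>B. t (u, b) (u, b))"
      "trace_op (X \<times> R) x = (\<Sum>u\<in>X. \<Sum>r\<in>R. x (u, r) (u, r))"
      unfolding trace_op_def sum.cartesian_product by (simp_all add: case_prod_beta)
    show ?thesis
      unfolding tr sum_product[where A = X and B = X] c_def by (simp add: sum.cartesian_product case_prod_beta)
  qed
  finally have EF: "(\<integral>U. F U \<partial>PiM K \<mu>) = trace_op (X \<times> B) t * trace_op (X \<times> R) x" .
  have "trace_op (X \<times> B) t = of_real (Re (trace_op (X \<times> B) t))"
    "trace_op (X \<times> R) x = of_real (Re (trace_op (X \<times> R) x))"
    using assms finX by (intro psd_trace_real; simp add: X_def)+
  then have "(\<integral>U. Re (F U) \<partial>PiM K \<mu>) = Re (trace_op (X \<times> B) t) * Re (trace_op (X \<times> R) x)"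
    using integral_Re[OF intF] EF by (metis Re_complex_of_real of_real_mult)
  moreover have "integrable (PiM K \<mu>) (\<lambda>U. Re (F U))" using intF by (rule integrable_Re)
  ultimately show "(\<integral>\<^sup>+U. ennreal (Re (trace_op (B \<times> R) (contract (PiE S A) (mixed_fam S Q A U) t x))) \<partial>PiM K \<mu>)
      = ennreal (Re (trace_op (PiE S A \<times> B) t) * Re (trace_op (PiE S A \<times> R) x))"
    unfolding X_def[symmetric] F[folded X_def] using nn_integral_eq_integral[of "PiM K \<mu>" "\<lambda>U. Re (F U)"] pos by simp
  show ?meas unfolding F using borel_measurable_integrable[OF intF] by measurable
qed

text \<open>Only the majorant \<open>g\<close> is claimed to be measurable, so that no measurability of the trace norm is
  required.\<close>

lemma fluct_trace_norm_bound:
  assumes "S \<subseteq> K" "finite B" "finite R"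
    and t: "t \<in> opers (PiE S A \<times> B)" "adj t = t" and x: "x \<in> opers (PiE S A \<times> R)" "adj x = x"
  obtains g where "g \<in> borel_measurable (PiM K \<mu>)"
    "\<And>U. ennreal (schatten_norm (B \<times> R) 1 (contract (PiE S A) (fluct_fam S A U) t x)) \<le> g U"
    "(\<integral>\<^sup>+U. g U \<partial>PiM K \<mu>) = ennreal (2 ^ card S * schatten_norm (PiE S A \<times> B) 1 t * schatten_norm (PiE S A \<times> R) 1 x)"
proof -
  define X where "X = PiE S A"
  have finS: "finite S" using assms(1) finK finite_subset by blast
  have finX: "finite X" unfolding X_def using assms(1) finS finA by (intro finite_PiE) auto
  obtain t1 t2 where t12: "psd (X \<times> B) t1" "psd (X \<times> B) t2" "t = (\<lambda>i j. t1 i j - t2 i j)"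
    "Re (trace_op (X \<times> B) t1) + Re (trace_op (X \<times> B) t2) = schatten_norm (X \<times> B) 1 t"
    using jordan_decomposition[of "X \<times> B" t] t finX assms(2) by (auto simp: X_def)
  obtain x1 x2 where x12: "psd (X \<times> R) x1" "psd (X \<times> R) x2" "x = (\<lambda>i j. x1 i j - x2 i j)"
    "Re (trace_op (X \<times> R) x1) + Re (trace_op (X \<times> R) x2) = schatten_norm (X \<times> R) 1 x"
    using jordan_decomposition[of "X \<times> R" x] x finX assms(3) by (auto simp: X_def)
  define ts where "ts = (\<lambda>b. if b then t1 else t2)"
  define xs where "xs = (\<lambda>b. if b then x1 else x2)"
  have ts: "psd (X \<times> B) (ts i)" and xs: "psd (X \<times> R) (xs i)" for i
    using t12 x12 by (auto simp: ts_def xs_def)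
  define L where "L = (\<lambda>Q i j U. Re (trace_op (B \<times> R) (contract X (mixed_fam S Q A U) (ts i) (xs j))))"
  have L0: "0 \<le> L Q i j U" for Q i j U
    unfolding L_def X_def using assms finX finA ts xs
    by (intro psd_trace_nonneg contract_psd gram_mixed_fam) (auto simp: X_def)
  define g where "g = (\<lambda>U. \<Sum>Q\<in>Pow S. \<Sum>i\<in>UNIV. \<Sum>j\<in>UNIV. ennreal (L Q i j U))"
  have Lm: "(\<lambda>U. ennreal (L Q i j U)) \<in> borel_measurable (PiM K \<mu>)" if "Q \<in> Pow S" for Q i j
    unfolding L_def X_def using that assms ts xs by (intro trace_contract_moment(1)) (auto simp: X_def)
  have Li: "(\<integral>\<^sup>+U. ennreal (L Q i j U) \<partial>PiM K \<mu>)
      = ennreal (Re (trace_op (X \<times> B) (ts i)) * Re (trace_op (X \<times> R) (xs j)))" if "Q \<in> Pow S" for Q i j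
    unfolding L_def X_def using that assms ts xs by (intro trace_contract_moment(2)) (auto simp: X_def)
  have tr0: "0 \<le> Re (trace_op (X \<times> B) (ts i))" "0 \<le> Re (trace_op (X \<times> R) (xs i))" for i
    using ts xs finX assms by (auto intro!: psd_trace_nonneg)
  show thesis
  proof (rule that[of g])
    show "g \<in> borel_measurable (PiM K \<mu>)"
      unfolding g_def by (intro borel_measurable_sum Lm)
    show "ennreal (schatten_norm (B \<times> R) 1 (contract (PiE S A) (fluct_fam S A U) t x)) \<le> g U" for U
    proof -
      have "schatten_norm (B \<times> R) 1 (contract X (fluct_fam S A U) t x)
          \<le> (\<Sum>Q\<in>Pow S. \<Sum>i\<in>UNIV. \<Sum>j\<in>UNIV. L Q i j U)"
        using schatten_1_contract_fluct_le[OF finS _ assms(2,3), of A ts xs U] ts xs finA assms(1)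
        unfolding L_def X_def t12(3) x12(3) ts_def xs_def by auto
      also have "ennreal \<dots> = g U" unfolding g_def using L0 by (simp add: sum_ennreal sum_nonneg)
      finally show ?thesis unfolding X_def by (simp add: ennreal_leI)
    qed
    have "(\<integral>\<^sup>+U. g U \<partial>PiM K \<mu>) = (\<Sum>Q\<in>Pow S. \<Sum>i\<in>UNIV. \<Sum>j\<in>UNIV.
        ennreal (Re (trace_op (X \<times> B) (ts i)) * Re (trace_op (X \<times> R) (xs j))))"
    proof -
      have inner: "(\<integral>\<^sup>+U. (\<Sum>i\<in>UNIV. \<Sum>j\<in>UNIV. ennreal (L Q i j U)) \<partial>PiM K \<mu>) = (\<Sum>i\<in>UNIV. \<Sum>j\<in>UNIV.
          ennreal (Re (trace_op (X \<times> B) (ts i)) * Re (trace_op (X \<times> R) (xs j))))" if "Q \<in> Pow S" for Q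
        using Lm[OF that] Li[OF that] by (simp add: nn_integral_sum)
      show ?thesis
        unfolding g_def
        by (subst nn_integral_sum, intro borel_measurable_sum Lm, assumption) (rule sum.cong[OF refl inner])
    qed
    also have "\<dots> = ennreal (\<Sum>Q\<in>Pow S. \<Sum>i\<in>UNIV. \<Sum>j\<in>UNIV. Re (trace_op (X \<times> B) (ts i)) * Re (trace_op (X \<times> R) (xs j)))"
      using tr0 by (simp add: sum_nonneg del: sum_constant)
    \<comment> \<open>The summand does not depend on \<open>Q\<close>, which gives 2^|S|; the sum
      over the signs factorises into the total traces of the two Jordan decompositions, that is,
      into the trace norms.\<close>
    also have "(\<Sum>Q\<in>Pow S. \<Sum>i\<in>UNIV. \<Sum>j\<in>UNIV. Re (trace_op (X \<times> B) (ts i)) * Re (trace_op (X \<times> R) (xs j)))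
       = 2 ^ card S * ((\<Sum>i\<in>UNIV. Re (trace_op (X \<times> B) (ts i))) * (\<Sum>j\<in>UNIV. Re (trace_op (X \<times> R) (xs j))))"
      using finS by (simp add: sum_product card_Pow)
    also have "(\<Sum>i\<in>UNIV. Re (trace_op (X \<times> B) (ts i))) = schatten_norm (X \<times> B) 1 t"
      using t12(4) by (simp add: UNIV_bool ts_def add.commute)
    also have "(\<Sum>j\<in>UNIV. Re (trace_op (X \<times> R) (xs j))) = schatten_norm (X \<times> R) 1 x"
      using x12(4) by (simp add: UNIV_bool xs_def add.commute)
    finally show "(\<integral>\<^sup>+U. g U \<partial>PiM K \<mu>) = ennreal (2 ^ card S * schatten_norm (PiE S A \<times> B) 1 t * schatten_norm (PiE S A \<times> R) 1 x)"
      unfolding X_def by (simp add: mult.assoc)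
  qed
qed

end

subsection \<open>Weighted factorisations and the second moment bound\<close>

lemma sum_PiE_pair:
  "(\<Sum>p\<in>PiE S A \<times> PiE S B. f p) = (\<Sum>w\<in>PiE S (\<lambda>s. A s \<times> B s). f (\<lambda>s\<in>S. fst (w s), \<lambda>s\<in>S. snd (w s)))"
proof -
  let ?i = "\<lambda>w. (\<lambda>s\<in>S. fst (w s), \<lambda>s\<in>S. snd (w s))" and ?j = "\<lambda>p. \<lambda>s\<in>S. (fst p s, snd p s)"
  have ij: "?i (?j p) = p" if "p \<in> PiE S A \<times> PiE S B" for p
    using that by (auto simp: prod_eq_iff PiE_iff extensional_def fun_eq_iff)
  show ?thesis
  proof (rule sum.reindex_bij_witness[of _ ?i ?j])
    show "?j (?i w) = w" if "w \<in> PiE S (\<lambda>s. A s \<times> B s)" for w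
      using that by (auto simp: PiE_iff extensional_def fun_eq_iff)
    show "f (?i (?j p)) = f p" if "p \<in> PiE S A \<times> PiE S B" for p
      by (simp only: ij[OF that])
  qed (use ij in \<open>auto simp: PiE_iff mem_Times_iff\<close>)
qed

lemma sum_times: "(\<Sum>p\<in>B\<times>R. f p) = (\<Sum>k\<in>B. \<Sum>m\<in>R. f (k, m))"
  by (simp add: sum.cartesian_product)

text \<open>The weights act on \<open>B\<close> and \<open>R\<close> alone, so they commute with the
  summation over the inner indices in \<open>X\<close>.\<close>

lemma contract_sandwich:
  assumes t: "\<And>f f' b b'. f \<in> X \<Longrightarrow> f' \<in> X \<Longrightarrow> b \<in> B \<Longrightarrow> b' \<in> B \<Longrightarrow>
      t (f, b) (f', b') = (\<Sum>k\<in>B. \<Sum>l\<in>B. gB b k * Nt (f, k) (f', l) * gB l b')"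
    and x: "\<And>f f' r r'. f \<in> X \<Longrightarrow> f' \<in> X \<Longrightarrow> r \<in> R \<Longrightarrow> r' \<in> R \<Longrightarrow>
      x (f, r) (f', r') = (\<Sum>k\<in>R. \<Sum>l\<in>R. gR r k * Nx (f, k) (f', l) * gR l r')"
    and ij: "i \<in> B \<times> R" "j \<in> B \<times> R"
  shows "contract X \<kappa> t x i j = (\<Sum>k\<in>B\<times>R. \<Sum>l\<in>B\<times>R. tensor_op gB gR i k * contract X \<kappa> Nt Nx k l * tensor_op gB gR l j)"
proof -
  have pairs: "(\<Sum>k\<in>B. \<Sum>l\<in>B. a k l) * (\<Sum>m\<in>R. \<Sum>n\<in>R. c m n)
      = (\<Sum>km\<in>B\<times>R. \<Sum>ln\<in>B\<times>R. a (fst km) (fst ln) * c (snd km) (snd ln))"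
    for a :: "'b \<Rightarrow> 'b \<Rightarrow> complex" and c :: "'c \<Rightarrow> 'c \<Rightarrow> complex"
  proof -
    have "(\<Sum>k\<in>B. \<Sum>l\<in>B. a k l) * (\<Sum>m\<in>R. \<Sum>n\<in>R. c m n) = (\<Sum>k\<in>B. \<Sum>m\<in>R. (\<Sum>l\<in>B. a k l) * (\<Sum>n\<in>R. c m n))"
      by (rule sum_product)
    also have "\<dots> = (\<Sum>k\<in>B. \<Sum>m\<in>R. \<Sum>l\<in>B. \<Sum>n\<in>R. a k l * c m n)"
      by (intro sum.cong refl sum_product)
    finally show ?thesis by (simp add: sum_times)
  qed
  obtain b r b' r' where i: "i = (b, r)" "j = (b', r')" "b \<in> B" "r \<in> R" "b' \<in> B" "r' \<in> R"
    using ij by auto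
  have "contract X \<kappa> t x i j = (\<Sum>p\<in>X\<times>X. \<Sum>q\<in>X\<times>X. \<Sum>k\<in>B\<times>R. \<Sum>l\<in>B\<times>R.
      tensor_op gB gR i k * (\<kappa> p q * Nt (fst p, fst k) (fst q, fst l) * Nx (snd p, snd k) (snd q, snd l)) * tensor_op gB gR l j)"
    unfolding contract_def
  proof (intro sum.cong refl)
    fix p q assume pq: "p \<in> X \<times> X" "q \<in> X \<times> X"
    have "\<kappa> p q * t (fst p, fst i) (fst q, fst j) * x (snd p, snd i) (snd q, snd j)
      = \<kappa> p q * ((\<Sum>k\<in>B. \<Sum>l\<in>B. gB b k * Nt (fst p, k) (fst q, l) * gB l b')
          * (\<Sum>k\<in>R. \<Sum>l\<in>R. gR r k * Nx (snd p, k) (snd q, l) * gR l r'))"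
      using pq i by (simp add: t x mem_Times_iff)
    then show "\<kappa> p q * t (fst p, fst i) (fst q, fst j) * x (snd p, snd i) (snd q, snd j)
      = (\<Sum>k\<in>B\<times>R. \<Sum>l\<in>B\<times>R. tensor_op gB gR i k *
        (\<kappa> p q * Nt (fst p, fst k) (fst q, fst l) * Nx (snd p, snd k) (snd q, snd l)) * tensor_op gB gR l j)"
      unfolding pairs by (simp add: sum_distrib_left tensor_op_def i case_prod_beta mult_ac)
  qed
  also have "\<dots> = (\<Sum>k\<in>B\<times>R. \<Sum>l\<in>B\<times>R. \<Sum>p\<in>X\<times>X. \<Sum>q\<in>X\<times>X.
      tensor_op gB gR i k * (\<kappa> p q * Nt (fst p, fst k) (fst q, fst l) * Nx (snd p, snd k) (snd q, snd l)) * tensor_op gB gR l j)"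
    by (rule sum_swap4)
  finally show ?thesis by (simp add: contract_def sum_distrib_left sum_distrib_right)
qed

section \<open>Tensor products and powers of positive operators\<close>

lemma mult_op_tensor:
  "mult_op (I \<times> J) (tensor_op M N) (tensor_op M' N') = tensor_op (mult_op I M M') (mult_op J N N')"
proof -
  have "(\<Sum>l\<in>I\<times>J. (M i (fst l) * N j (snd l)) * (M' (fst l) i' * N' (snd l) j'))
     = (\<Sum>k\<in>I. M i k * M' k i') * (\<Sum>l\<in>J. N j l * N' l j')" for i j i' j'
    by (simp add: sum_product sum.cartesian_product case_prod_beta mult_ac)
  then show ?thesis by (auto simp: mult_op_def tensor_op_def fun_eq_iff case_prod_beta)
qed

lemma adj_tensor: "adj (tensor_op M N) = tensor_op (adj M) (adj N)"
  by (auto simp: adj_def tensor_op_def fun_eq_iff)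

lemma tensor_opers: "M \<in> opers I \<Longrightarrow> N \<in> opers J \<Longrightarrow> tensor_op M N \<in> opers (I \<times> J)"
  by (auto simp: opers_def tensor_op_def)

lemma tensor_id_op: "tensor_op (id_op I) (id_op J) = id_op (I \<times> J)"
  by (auto simp: tensor_op_def id_op_def diag_op_def fun_eq_iff)

lemma id_op_opers: "id_op I \<in> opers I"
  by (auto simp: id_op_def diag_op_def opers_def)

lemma adj_id_op: "adj (id_op I) = id_op I"
  by (auto simp: id_op_def diag_op_def adj_def fun_eq_iff)

lemma tensor_unitaries:
  assumes "U \<in> unitaries I" "V \<in> unitaries J"
  shows "tensor_op U V \<in> unitaries (I \<times> J)"
  using assms by (simp add: unitaries_def tensor_opers adj_tensor mult_op_tensor tensor_id_op)

lemma id_unitary: "finite I \<Longrightarrow> id_op I \<in> unitaries I"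
  by (simp add: unitaries_def id_op_opers adj_id_op mult_id_op)

lemma hs_tensor: "hs (I \<times> J) (tensor_op M N) = hs I M * hs J N"
proof -
  have "hs (I \<times> J) (tensor_op M N) = (\<Sum>i\<in>I. \<Sum>j\<in>J. \<Sum>i'\<in>I. \<Sum>j'\<in>J. (cmod (M i i'))\<^sup>2 * (cmod (N j j'))\<^sup>2)"
    by (simp add: hs_def sum_times tensor_op_def norm_mult power_mult_distrib)
  also have "\<dots> = (\<Sum>i\<in>I. \<Sum>j\<in>J. (\<Sum>i'\<in>I. (cmod (M i i'))\<^sup>2) * (\<Sum>j'\<in>J. (cmod (N j j'))\<^sup>2))"
    by (simp only: sum_product)
  also have "\<dots> = hs I M * hs J N" by (simp only: hs_def sum_product)
  finally show ?thesis .
qed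

lemma spec_tensor_id:
  assumes "finite X"
  shows "spectral_op (X \<times> R) (tensor_op (id_op X) V) (\<lambda>p. d (snd p)) = tensor_op (id_op X) (spectral_op R V d)"
proof -
  have idsum: "(\<Sum>f\<in>X. id_op X i f * cnj (id_op X i' f)) = id_op X i i'" for i i'
  proof -
    have "mult_op X (id_op X) (adj (id_op X)) i i' = id_op X i i'"
      by (simp add: adj_id_op mult_id_op id_op_opers assms)
    then show ?thesis by (simp only: mult_op_def adj_def)
  qed
  have "spectral_op (X \<times> R) (tensor_op (id_op X) V) (\<lambda>p. d (snd p)) (i, r) (i', r')
    = (\<Sum>f\<in>X. id_op X i f * cnj (id_op X i' f)) * spectral_op R V d r r'" for i r i' r'
    unfolding spectral_op_def sum_product by (simp add: tensor_op_def sum_times mult_ac)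
  then show ?thesis unfolding idsum by (auto simp: tensor_op_def fun_eq_iff)
qed

text \<open>If \<open>V\<close> diagonalises \<open>\<beta>\<close>, then the tensor product of the
  identity with \<open>V\<close> diagonalises the left operator, with eigenvalues read off the
  second index.\<close>

lemma powr_op_tensor_id:
  assumes "finite X" "finite R" "psd R \<beta>"
  shows "powr_op (X \<times> R) (tensor_op (id_op X) \<beta>) p = tensor_op (id_op X) (powr_op R \<beta> p)"
proof -
  obtain V d where V: "V \<in> unitaries R" "\<beta> = spectral_op R V d" using psd_spectral[OF assms(2,3)] by blast
  have W: "tensor_op (id_op X) V \<in> unitaries (X \<times> R)"
    using assms V by (intro tensor_unitaries id_unitary)
  show ?thesis
    unfolding V(2) powr_op_spec[OF assms(2) V(1)]
    using powr_op_spec[OF _ W, of "\<lambda>p. d (snd p)" p] assms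
    by (simp add: spec_tensor_id[OF assms(1), of R V d] spec_tensor_id[OF assms(1), of R V "\<lambda>i. d i powr p"])
qed

text \<open>The exponents may have either sign because \<open>0 powr p = 0\<close>. Opposite
  exponents give the projector onto the support.\<close>

lemma powr_op_mult:
  assumes "finite I" "psd I \<beta>"
  shows "mult_op I (powr_op I \<beta> p) (powr_op I \<beta> q) = powr_op I \<beta> (p + q)"
proof -
  obtain V d where V: "V \<in> unitaries I" "\<beta> = spectral_op I V d" using psd_spectral[OF assms] by blast
  show ?thesis unfolding V(2) powr_op_spec[OF assms(1) V(1)] spec_mult[OF assms(1) V(1)]
    by (simp add: powr_add)
qed

lemma powr_op_one:
  assumes "finite I" "psd I \<beta>"
  shows "powr_op I \<beta> 1 = \<beta>"
proof -
  obtain V d where V: "V \<in> unitaries I" "\<beta> = spectral_op I V d" "\<And>l. l \<in> I \<Longrightarrow> 0 \<le> d l" using psd_spectral[OF assms] by blast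
  show ?thesis unfolding V(2) powr_op_spec[OF assms(1) V(1)] using V(3) by (intro spec_cong) simp
qed

lemma powr_op_props:
  assumes "finite I" "psd I \<beta>"
  shows "powr_op I \<beta> p \<in> opers I" "adj (powr_op I \<beta> p) = powr_op I \<beta> p"
proof -
  obtain V d where V: "V \<in> unitaries I" "\<beta> = spectral_op I V d" using psd_spectral[OF assms] by blast
  show "powr_op I \<beta> p \<in> opers I" "adj (powr_op I \<beta> p) = powr_op I \<beta> p"
    unfolding V(2) powr_op_spec[OF assms(1) V(1)]
    using unitaries_opers[OF V(1)] by (auto simp: spec_opers adj_spec)
qed

lemma hs_powr_half:
  assumes "finite I" "psd I \<beta>"
  shows "hs I (powr_op I \<beta> (1/2)) = Re (trace_op I \<beta>)"
proof -
  have "complex_of_real (hs I (powr_op I \<beta> (1/2))) = trace_op I (mult_op I (powr_op I \<beta> (1/2)) (adj (powr_op I \<beta> (1/2))))"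
    unfolding hs_def of_real_sum trace_op_def mult_op_def adj_def
    by (simp add: complex_norm_square del: of_real_power)
  also have "\<dots> = trace_op I \<beta>"
    using powr_op_mult[OF assms, of "1/2" "1/2"] by (simp add: powr_op_props[OF assms] powr_op_one[OF assms])
  finally show ?thesis by (metis Re_complex_of_real)
qed

text \<open>\<open>powr_op I \<beta> 0\<close> is the projector onto the support of \<open>\<beta>\<close>, since \<open>0 powr 0 = 0\<close>.\<close>

lemma support_projector:
  assumes "finite I" "psd I \<beta>" "psd I \<alpha>" "supp_op I \<alpha> \<subseteq> supp_op I \<beta>"
  shows "mult_op I (powr_op I \<beta> 0) \<alpha> = \<alpha>" "mult_op I \<alpha> (powr_op I \<beta> 0) = \<alpha>"
proof -
  let ?P = "powr_op I \<beta> 0"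
  have \<alpha>: "\<alpha> \<in> opers I" "adj \<alpha> = \<alpha>" using assms(3) by (auto simp: psd_def)
  have P: "?P \<in> opers I" "adj ?P = ?P" by (rule powr_op_props[OF assms(1,2)])+
  have bP: "mult_op I \<beta> ?P = \<beta>"
    using powr_op_mult[OF assms(1,2), of 1 0] by (simp add: powr_op_one[OF assms(1,2)])
  have \<alpha>': "cnj (\<alpha> i j) = \<alpha> j i" for i j by (metis adj_def \<alpha>(2))
  have P': "cnj (?P i j) = ?P j i" for i j by (metis adj_def P(2))
  have col: "(\<lambda>i. \<alpha> i j) \<in> supp_op I \<alpha>" if "j \<in> I" for j
  proof -
    have "inner_on I w (\<lambda>i. \<alpha> i j) = 0" if "apply_op I \<alpha> w = (\<lambda>_. 0)" for w
    proof -
      have "inner_on I w (\<lambda>i. \<alpha> i j) = cnj (apply_op I \<alpha> w j)"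
        by (simp add: inner_on_def apply_op_def \<alpha>' mult.commute)
      then show ?thesis using that by simp
    qed
    then show ?thesis using \<alpha>(1) by (auto simp: supp_op_def vecs_def opers_def)
  qed
  have "mult_op I ?P \<alpha> i j = \<alpha> i j" if "i \<in> I" "j \<in> I" for i j
  proof -
    \<comment> \<open>Column \<open>i\<close> of the complementary projector. It lies in the kernel
      of \<open>\<beta>\<close>, hence it is orthogonal to every column of \<open>\<alpha>\<close>,
      since these lie in the support of \<open>\<beta>\<close>.\<close>
    define w where "w = (\<lambda>k. id_op I k i - ?P k i)"
    have "w \<in> vecs I" using P(1) id_op_opers[of I] by (auto simp: vecs_def w_def opers_def)
    moreover have "apply_op I \<beta> w = (\<lambda>_. 0)"
    proof -
      have "apply_op I \<beta> w k = mult_op I \<beta> (id_op I) k i - mult_op I \<beta> ?P k i" for k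
        by (simp add: apply_op_def w_def mult_op_def right_diff_distrib sum_subtractf)
      then show ?thesis using bP mult_id_op(2)[OF assms(1), of \<beta>] assms(2) by (auto simp: psd_def)
    qed
    moreover have "(\<lambda>i. \<alpha> i j) \<in> supp_op I \<beta>" using col[OF that(2)] assms(4) by blast
    ultimately have "inner_on I w (\<lambda>i. \<alpha> i j) = 0" by (auto simp: supp_op_def)
    moreover have "inner_on I w (\<lambda>i. \<alpha> i j) = mult_op I (id_op I) \<alpha> i j - mult_op I ?P \<alpha> i j"
    proof -
      have "cnj (w k) = id_op I i k - ?P i k" for k
        unfolding w_def complex_cnj_diff P' by (auto simp: id_op_def diag_op_def)
      then show ?thesis by (simp add: inner_on_def mult_op_def left_diff_distrib sum_subtractf)
    qed
    ultimately show ?thesis by (simp add: mult_id_op(1)[OF assms(1) \<alpha>(1)])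
  qed
  moreover have "mult_op I ?P \<alpha> i j = \<alpha> i j" if "i \<notin> I \<or> j \<notin> I" for i j
    using mult_op_opers[OF P(1) \<alpha>(1)] \<alpha>(1) that by (auto simp: opers_def)
  ultimately show 1: "mult_op I ?P \<alpha> = \<alpha>" by (auto simp: fun_eq_iff)
  have "adj (mult_op I ?P \<alpha>) = mult_op I \<alpha> ?P" by (simp add: adj_mult_op \<alpha> P)
  then show "mult_op I \<alpha> ?P = \<alpha>" using 1 \<alpha> by simp
qed

text \<open>\<open>N\<close> is the weighted operator whose norm \<open>D2\<close> measures. The
  support condition implied by finiteness of \<open>D2\<close> lets the fourth root undo the inverse
  fourth root; since the weight is trivial on \<open>X\<close>, it acts through \<open>R\<close>
  alone.\<close>

lemma D2_less_factorisation:
  assumes "finite X" "finite R" "psd R \<beta>" "psd (X \<times> R) \<alpha>"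
    and D: "D2 (X \<times> R) \<alpha> (tensor_op (id_op X) \<beta>) < ereal u"
  defines "g \<equiv> powr_op R \<beta> (1/4)"
  obtains N where "hs (X \<times> R) N \<le> 2 powr u" and
    "\<And>f f' r r'. f \<in> X \<Longrightarrow> f' \<in> X \<Longrightarrow> r \<in> R \<Longrightarrow> r' \<in> R \<Longrightarrow>
      \<alpha> (f, r) (f', r') = (\<Sum>k\<in>R. \<Sum>l\<in>R. g r k * N (f, k) (f', l) * g l r')"
proof -
  define I where "I = X \<times> R"
  have fin: "finite I" using assms by (simp add: I_def)
  define \<gamma> where "\<gamma> = tensor_op (id_op X) \<beta>"
  have \<gamma>: "psd I \<gamma>"
  proof -
    obtain V d where V: "V \<in> unitaries R" "\<beta> = spectral_op R V d" "\<And>l. l \<in> R \<Longrightarrow> 0 \<le> d l"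
      using psd_spectral[OF assms(2,3)] by blast
    have "psd I (spectral_op I (tensor_op (id_op X) V) (\<lambda>p. d (snd p)))"
      using V tensor_unitaries[OF id_unitary[OF assms(1)] V(1)] fin unfolding I_def
      by (intro psd_if_gram gram_spec spec_opers unitaries_opers) auto
    then show ?thesis unfolding I_def \<gamma>_def V(2) spec_tensor_id[OF assms(1)] .
  qed
  define N where "N = mult_op I (powr_op I \<gamma> (-1/4)) (mult_op I \<alpha> (powr_op I \<gamma> (-1/4)))"
  have sup: "supp_op I \<alpha> \<subseteq> supp_op I \<gamma>"
    using D unfolding D2_def I_def[symmetric] \<gamma>_def[symmetric] by (auto split: if_splits)
  have No: "N \<in> opers I"
    using powr_op_props[OF fin \<gamma>] assms(4) unfolding N_def by (intro mult_op_opers) (auto simp: psd_def I_def)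
  have "2 * elog2 (sqrt (hs I N)) < ereal u"
    using D sup schatten_2[OF fin No] unfolding D2_def I_def[symmetric] \<gamma>_def[symmetric] N_def by simp
  \<comment> \<open>If \<open>N\<close> vanishes on \<open>I\<close>, its logarithm is the value
    -\<infinity> of \<open>elog2\<close>, and the claim is positivity of
    \<open>2 powr u\<close>.\<close>
  then have hsN: "hs I N \<le> 2 powr u"
  proof (cases "hs I N > 0")
    case True
    then have "2 * log 2 (sqrt (hs I N)) < u"
      using \<open>2 * elog2 (sqrt (hs I N)) < ereal u\<close> by (simp add: elog2_def)
    moreover have "2 * log 2 (sqrt (hs I N)) = log 2 (hs I N)"
      using True by (simp add: powr_half_sqrt[symmetric] log_powr)
    ultimately show ?thesis using True by (simp add: log_less_iff)
  next
    case False
    then show ?thesis using hs_nonneg[of I N] by (simp add: not_less)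
  qed
  let ?g = "powr_op I \<gamma> (1/4)" and ?h = "powr_op I \<gamma> (-1/4)"
  have gh: "mult_op I ?g ?h = powr_op I \<gamma> 0" "mult_op I ?h ?g = powr_op I \<gamma> 0"
    using powr_op_mult[OF fin \<gamma>, of "1/4" "-1/4"] powr_op_mult[OF fin \<gamma>, of "-1/4" "1/4"] by simp_all
  have proj: "mult_op I (powr_op I \<gamma> 0) \<alpha> = \<alpha>" "mult_op I \<alpha> (powr_op I \<gamma> 0) = \<alpha>"
    using support_projector[OF fin \<gamma> _ sup] assms(4) by (auto simp: I_def)
  have "mult_op I ?g (mult_op I N ?g) = mult_op I (mult_op I ?g ?h) (mult_op I \<alpha> (mult_op I ?h ?g))"
    unfolding N_def by (simp only: mult_op_assoc)
  then have \<alpha>: "\<alpha> = mult_op I ?g (mult_op I N ?g)" by (simp only: gh proj)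
  have g: "?g = tensor_op (id_op X) g"
    unfolding I_def \<gamma>_def g_def by (rule powr_op_tensor_id[OF assms(1-3)])
  have idl: "(\<Sum>p\<in>X\<times>R. tensor_op (id_op X) g (f, r) p * F p) = (\<Sum>k\<in>R. g r k * F (f, k))" if "f \<in> X" for f r F
  proof -
    have "(\<Sum>p\<in>X\<times>R. tensor_op (id_op X) g (f, r) p * F p) = (\<Sum>e\<in>X. \<Sum>k\<in>R. tensor_op (id_op X) g (f, r) (e, k) * F (e, k))"
      by (simp add: sum.cartesian_product)
    also have "\<dots> = (\<Sum>e\<in>X. if e = f then (\<Sum>k\<in>R. g r k * F (f, k)) else 0)"
      by (intro sum.cong refl) (auto simp: tensor_op_def id_op_def diag_op_def)
    finally show ?thesis using assms(1) that by simp
  qed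
  have idr: "(\<Sum>p\<in>X\<times>R. F p * tensor_op (id_op X) g p (f, r)) = (\<Sum>k\<in>R. F (f, k) * g k r)" if "f \<in> X" for f r F
  proof -
    have "(\<Sum>p\<in>X\<times>R. F p * tensor_op (id_op X) g p (f, r)) = (\<Sum>e\<in>X. \<Sum>k\<in>R. F (e, k) * tensor_op (id_op X) g (e, k) (f, r))"
      by (simp add: sum.cartesian_product)
    also have "\<dots> = (\<Sum>e\<in>X. if e = f then (\<Sum>k\<in>R. F (f, k) * g k r) else 0)"
      by (intro sum.cong refl) (auto simp: tensor_op_def id_op_def diag_op_def)
    finally show ?thesis using assms(1) that by simp
  qed
  show thesis
  proof (rule that[of N])
    show "hs (X \<times> R) N \<le> 2 powr u" using hsN by (simp add: I_def)
    fix f f' r r' assume mem: "f \<in> X" "f' \<in> X" "r \<in> R" "r' \<in> R"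
    have "\<alpha> (f, r) (f', r') = (\<Sum>p\<in>X\<times>R. tensor_op (id_op X) g (f, r) p *
        (\<Sum>q\<in>X\<times>R. N p q * tensor_op (id_op X) g q (f', r')))"
      by (subst \<alpha>[unfolded g, unfolded I_def]) (simp only: mult_op_def)
    also have "\<dots> = (\<Sum>k\<in>R. g r k * (\<Sum>l\<in>R. N (f, k) (f', l) * g l r'))"
      by (simp only: idl[OF mem(1)] idr[OF mem(2)])
    finally show "\<alpha> (f, r) (f', r') = (\<Sum>k\<in>R. \<Sum>l\<in>R. g r k * N (f, k) (f', l) * g l r')"
      by (simp add: sum_distrib_left mult.assoc)
  qed
qed

section \<open>Second moments over independent Haar unitaries\<close>

context haar_family
begin

text \<open>Per system, the constant \<open>2 / (d\<^sup>2 - 1)\<close> of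
  \<open>fluct_second_moment\<close> times the \<open>d\<^sup>2\<close> that comes from squaring the
  prefactor of \<open>fluct_fam\<close>.\<close>

definition moment_const :: "nat set \<Rightarrow> real" where
  "moment_const S = (\<Prod>s\<in>S. 2 / (1 - 1 / (real (card (A s)))\<^sup>2))"

lemma fluct_fam_measurable:
  assumes "S \<subseteq> K"
  shows "(\<lambda>U. fluct_fam S A U p q) \<in> borel_measurable (PiM K \<mu>)"
  unfolding fluct_fam_def fluct_def using assms
  by (intro borel_measurable_times borel_measurable_const borel_measurable_prod borel_measurable_diff
      borel_measurable_cnj entry_measurable_fam) auto

lemma contract_measurable:
  assumes "S \<subseteq> K"
  shows "(\<lambda>U. contract X (fluct_fam S A U) t x i j) \<in> borel_measurable (PiM K \<mu>)"
  unfolding contract_def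
  by (intro borel_measurable_sum borel_measurable_times borel_measurable_const fluct_fam_measurable assms)

text \<open>\<open>tensor_second_moment\<close> sums over one family of indices per system, whereas
  \<open>p\<close> and \<open>q\<close> are pairs of families. \<open>dec\<close> splits a family of
  pairs into a pair of families; used twice, it identifies a pair \<open>p\<close>, \<open>q\<close>
  with a family \<open>W\<close> of pairs of pairs.\<close>

lemma fluct_fam_second_moment:
  fixes m :: "(nat \<Rightarrow> 'a) \<times> (nat \<Rightarrow> 'a) \<Rightarrow> (nat \<Rightarrow> 'a) \<times> (nat \<Rightarrow> 'a) \<Rightarrow> complex"
  assumes "S \<subseteq> K"
  defines "X \<equiv> PiE S A"
  shows "(\<integral>\<^sup>+U. ennreal ((cmod (\<Sum>p\<in>X\<times>X. \<Sum>q\<in>X\<times>X. fluct_fam S A U p q * m p q))\<^sup>2) \<partial>PiM K \<mu>)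
    \<le> ennreal (moment_const S * (\<Sum>p\<in>X\<times>X. \<Sum>q\<in>X\<times>X. (cmod (m p q))\<^sup>2))"
proof -
  have finS: "finite S" using assms(1) finK finite_subset by blast
  define J where "J = (\<lambda>s. (A s \<times> A s) \<times> (A s \<times> A s))"
  define dec where "dec = (\<lambda>w :: nat \<Rightarrow> 'a \<times> 'a. (\<lambda>s\<in>S. fst (w s), \<lambda>s\<in>S. snd (w s)))"
  define e1 where "e1 = (\<lambda>W :: nat \<Rightarrow> ('a \<times> 'a) \<times> ('a \<times> 'a). dec (\<lambda>s\<in>S. fst (W s)))"
  define e2 where "e2 = (\<lambda>W :: nat \<Rightarrow> ('a \<times> 'a) \<times> ('a \<times> 'a). dec (\<lambda>s\<in>S. snd (W s)))"
  have reindex: "(\<Sum>p\<in>X\<times>X. \<Sum>q\<in>X\<times>X. F p q) = (\<Sum>W\<in>PiE S J. F (e1 W) (e2 W))"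
    for F :: "_ \<Rightarrow> _ \<Rightarrow> 'z :: comm_monoid_add"
  proof -
    have "(\<Sum>p\<in>X\<times>X. \<Sum>q\<in>X\<times>X. F p q)
        = (\<Sum>w\<in>PiE S (\<lambda>s. A s \<times> A s). \<Sum>w'\<in>PiE S (\<lambda>s. A s \<times> A s). F (dec w) (dec w'))"
      unfolding X_def sum_PiE_pair dec_def ..
    also have "\<dots> = (\<Sum>v\<in>PiE S (\<lambda>s. A s \<times> A s) \<times> PiE S (\<lambda>s. A s \<times> A s). F (dec (fst v)) (dec (snd v)))"
      by (simp add: sum.cartesian_product case_prod_beta)
    also have "\<dots> = (\<Sum>W\<in>PiE S J. F (e1 W) (e2 W))"
      unfolding sum_PiE_pair J_def e1_def e2_def by simp
    finally show ?thesis .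
  qed
  have comp: "comp_at s (e1 W) = fst (W s)" "comp_at s (e2 W) = snd (W s)" if "s \<in> S" for s W
    using that by (auto simp: comp_at_def e1_def e2_def dec_def)
  define c where "c = (\<lambda>s. 2 / ((real (card (A s)))\<^sup>2 - 1))"
  have d1: "(real (card (A s)))\<^sup>2 - 1 > 0" if "s \<in> K" for s
    using cardA[OF that] power_mono[of 2 "real (card (A s))" 2] by simp
  have "(\<integral>\<^sup>+U. ennreal ((cmod (\<Sum>W\<in>PiE S J. (of_nat (card X) * m (e1 W) (e2 W)) *
      (\<Prod>s\<in>S. fluct (A s) (U s) (fst (W s)) (snd (W s)))))\<^sup>2) \<partial>PiM K \<mu>)
    \<le> ennreal ((\<Prod>s\<in>S. c s) * (\<Sum>W\<in>PiE S J. (cmod (of_nat (card X) * m (e1 W) (e2 W)))\<^sup>2))"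
  proof (rule tensor_second_moment[where z = "\<lambda>s V w. fluct (A s) V (fst w) (snd w)", OF prob finK assms(1)])
    show "finite (J s)" if "s \<in> K" for s using finA[OF that] by (simp add: J_def)
    show "0 \<le> c s" if "s \<in> K" for s using d1[OF that] by (simp add: c_def)
    fix s assume s: "s \<in> K"
    interpret haar_unitary "A s" "\<mu> s" by (rule hu[OF s])
    show "(\<lambda>V. fluct (A s) V (fst j) (snd j)) \<in> borel_measurable (\<mu> s)" for j
      unfolding fluct_def by measurable
    show "(\<integral>\<^sup>+V. ennreal ((cmod (\<Sum>j\<in>J s. m' j * fluct (A s) V (fst j) (snd j)))\<^sup>2) \<partial>\<mu> s)
        \<le> ennreal (c s * (\<Sum>j\<in>J s. (cmod (m' j))\<^sup>2))" for m'
      unfolding J_def c_def by (rule fluct_second_moment)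
  qed
  moreover have "(\<Sum>W\<in>PiE S J. (of_nat (card X) * m (e1 W) (e2 W)) *
      (\<Prod>s\<in>S. fluct (A s) (U s) (fst (W s)) (snd (W s))))
     = (\<Sum>p\<in>X\<times>X. \<Sum>q\<in>X\<times>X. fluct_fam S A U p q * m p q)" for U
    unfolding reindex fluct_fam_def X_def[symmetric] using comp by (intro sum.cong refl) (simp add: mult_ac)
  moreover have "(\<Prod>s\<in>S. c s) * (\<Sum>W\<in>PiE S J. (cmod (of_nat (card X) * m (e1 W) (e2 W)))\<^sup>2)
     = moment_const S * (\<Sum>p\<in>X\<times>X. \<Sum>q\<in>X\<times>X. (cmod (m p q))\<^sup>2)"
  proof -
    have "(\<Prod>s\<in>S. c s) * (real (card X))\<^sup>2 = (\<Prod>s\<in>S. c s * (real (card (A s)))\<^sup>2)"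
      using finS by (simp add: X_def card_PiE prod.distrib prod_power_distrib)
    also have "\<dots> = moment_const S"
      unfolding moment_const_def
    proof (intro prod.cong refl)
      fix s assume "s \<in> S"
      then have "real (card (A s)) \<noteq> 0" using cardA[of s] assms(1) by auto
      then show "c s * (real (card (A s)))\<^sup>2 = 2 / (1 - 1 / (real (card (A s)))\<^sup>2)"
        by (simp add: c_def divide_simps)
    qed
    finally have "moment_const S = (\<Prod>s\<in>S. c s) * (real (card X))\<^sup>2" ..
    then show ?thesis
      unfolding reindex by (simp add: norm_mult power_mult_distrib sum_distrib_left mult.assoc)
  qed
  ultimately show ?thesis by simp
qed

lemma moment_const_pos: "S \<subseteq> K \<Longrightarrow> 0 < moment_const S"
  unfolding moment_const_def
proof (intro prod_pos)
  fix s assume "S \<subseteq> K" "s \<in> S"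
  then have "2 \<le> real (card (A s))" using cardA[of s] by auto
  then have "4 \<le> (real (card (A s)))\<^sup>2" using power_mono[of 2 "real (card (A s))" 2] by simp
  then show "0 < 2 / (1 - 1 / (real (card (A s)))\<^sup>2)" by (simp add: divide_simps)
qed

text \<open>Each entry of the contraction is a linear form in the kernel entries, with products of
  an entry of \<open>t\<close> and one of \<open>x\<close> as coefficients. Over all entries, the
  squared moduli of these coefficients add up to the product of the two squared norms.\<close>

lemma hs_contract_moment:
  assumes "S \<subseteq> K" "finite B" "finite R"
  shows "(\<integral>\<^sup>+U. ennreal (hs (B \<times> R) (contract (PiE S A) (fluct_fam S A U) t x)) \<partial>PiM K \<mu>)
    \<le> ennreal (moment_const S * (hs (PiE S A \<times> B) t * hs (PiE S A \<times> R) x))"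
proof -
  define X where "X = PiE S A"
  define T where "T = (\<lambda>i j p q. (cmod (t (fst p, fst i) (fst q, fst j)))\<^sup>2 * (cmod (x (snd p, snd i) (snd q, snd j)))\<^sup>2)"
  have meas: "(\<lambda>U. ennreal ((cmod (contract X (fluct_fam S A U) t x i j))\<^sup>2)) \<in> borel_measurable (PiM K \<mu>)" for i j
    by (intro measurable_compose[OF _ measurable_ennreal] borel_measurable_power
        measurable_compose[OF _ borel_measurable_norm] contract_measurable assms)
  have "(\<integral>\<^sup>+U. ennreal (hs (B \<times> R) (contract X (fluct_fam S A U) t x)) \<partial>PiM K \<mu>)
     = (\<Sum>i\<in>B\<times>R. \<Sum>j\<in>B\<times>R. (\<integral>\<^sup>+U. ennreal ((cmod (contract X (fluct_fam S A U) t x i j))\<^sup>2) \<partial>PiM K \<mu>))"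
    using meas by (simp add: hs_def nn_integral_sum sum_nonneg flip: sum_ennreal)
  also have "\<dots> \<le> (\<Sum>i\<in>B\<times>R. \<Sum>j\<in>B\<times>R. ennreal (moment_const S * (\<Sum>p\<in>X\<times>X. \<Sum>q\<in>X\<times>X. T i j p q)))"
  proof (intro sum_mono)
    fix i j
    show "(\<integral>\<^sup>+U. ennreal ((cmod (contract X (fluct_fam S A U) t x i j))\<^sup>2) \<partial>PiM K \<mu>)
      \<le> ennreal (moment_const S * (\<Sum>p\<in>X\<times>X. \<Sum>q\<in>X\<times>X. T i j p q))"
      using fluct_fam_second_moment[OF assms(1),
          of "\<lambda>p q. t (fst p, fst i) (fst q, fst j) * x (snd p, snd i) (snd q, snd j)"]
      by (simp add: contract_def X_def T_def mult.assoc norm_mult power_mult_distrib)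
  qed
  also have "\<dots> = ennreal (\<Sum>i\<in>B\<times>R. \<Sum>j\<in>B\<times>R. moment_const S * (\<Sum>p\<in>X\<times>X. \<Sum>q\<in>X\<times>X. T i j p q))"
    using moment_const_pos[OF assms(1)] by (simp add: T_def sum_nonneg)
  also have "(\<Sum>i\<in>B\<times>R. \<Sum>j\<in>B\<times>R. moment_const S * (\<Sum>p\<in>X\<times>X. \<Sum>q\<in>X\<times>X. T i j p q))
     = moment_const S * (\<Sum>i\<in>B\<times>R. \<Sum>j\<in>B\<times>R. \<Sum>p\<in>X\<times>X. \<Sum>q\<in>X\<times>X. T i j p q)"
    by (simp add: sum_distrib_left)
  also have "(\<Sum>i\<in>B\<times>R. \<Sum>j\<in>B\<times>R. \<Sum>p\<in>X\<times>X. \<Sum>q\<in>X\<times>X. T i j p q) = hs (X \<times> B) t * hs (X \<times> R) x"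
  proof -
    have "(\<Sum>i\<in>B\<times>R. \<Sum>j\<in>B\<times>R. \<Sum>p\<in>X\<times>X. \<Sum>q\<in>X\<times>X. T i j p q)
       = (\<Sum>z\<in>((B\<times>R)\<times>(B\<times>R))\<times>((X\<times>X)\<times>(X\<times>X)). T (fst (fst z)) (snd (fst z)) (fst (snd z)) (snd (snd z)))"
      by (simp add: sum.cartesian_product case_prod_beta)
        (rule sum.reindex_bij_witness[of _ "\<lambda>z. (fst (fst z), snd (fst z), fst (snd z), snd (snd z))"
          "\<lambda>z. ((fst z, fst (snd z)), (fst (snd (snd z)), snd (snd (snd z))))"]; auto)
    also have "\<dots> = (\<Sum>z\<in>((X\<times>B)\<times>(X\<times>B))\<times>((X\<times>R)\<times>(X\<times>R)).
        (cmod (t (fst (fst z)) (snd (fst z))))\<^sup>2 * (cmod (x (fst (snd z)) (snd (snd z))))\<^sup>2)"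
      by (rule sum.reindex_bij_witness[of _
          "\<lambda>(((f, b), (f', b')), ((g, r), (g', r'))). (((b, r), (b', r')), ((f, g), (f', g')))"
          "\<lambda>(((b, r), (b', r')), ((f, g), (f', g'))). (((f, b), (f', b')), ((g, r), (g', r')))"])
        (auto simp: T_def)
    also have "\<dots> = hs (X \<times> B) t * hs (X \<times> R) x"
    proof -
      have h: "hs I M = (\<Sum>z\<in>I\<times>I. (cmod (M (fst z) (snd z)))\<^sup>2)" for I and M :: "'z oper"
        by (simp add: hs_def sum.cartesian_product case_prod_beta)
      show ?thesis unfolding h sum_product by (simp add: sum.cartesian_product case_prod_beta)
    qed
    finally show ?thesis .
  qed
  finally show ?thesis unfolding X_def .
qed

text \<open>The factors 1 - |A_s|^-2 occur with exponent -1/2 on both sides. What remains is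
  \<open>sqrt (2 ^ n) \<le> 2 ^ n * 2 ^ (n - 1)\<close> for \<open>n = card S\<close>, where
  nonemptiness of \<open>S\<close> makes the exponent \<open>n - 1\<close> a natural number.\<close>

lemma moment_const_le:
  assumes "S \<subseteq> K" "S \<noteq> {}"
  shows "sqrt (moment_const S) \<le> 2 ^ card S * D_const A S"
proof -
  have finS: "finite S" using assms(1) finK finite_subset by blast
  then have n: "1 \<le> card S" using assms(2) by (simp add: Suc_le_eq card_gt_0_iff)
  define P where "P = (\<Prod>s\<in>S. (1 - 1 / (real (card (A s)))\<^sup>2))"
  have pos: "0 < 1 - 1 / (real (card (A s)))\<^sup>2" if "s \<in> S" for s
  proof -
    have "2 \<le> real (card (A s))" using cardA[of s] assms(1) that by auto
    then have "4 \<le> (real (card (A s)))\<^sup>2" using power_mono[of 2 "real (card (A s))" 2] by simp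
    then show ?thesis by (simp add: divide_simps)
  qed
  have P: "0 < P" unfolding P_def by (intro prod_pos pos)
  have D: "D_const A S = 2 ^ (card S - 1) / sqrt P"
  proof -
    have "(2::real) powi (int (card S) - 1) = 2 ^ (card S - 1)"
      using n by (metis of_nat_1 of_nat_diff power_int_of_nat)
    moreover have "(\<Prod>s\<in>S. (1 - real (card (A s)) powi (-2)) powr (-1/2)) = (\<Prod>s\<in>S. 1 / sqrt (1 - 1 / (real (card (A s)))\<^sup>2))"
    proof (intro prod.cong refl)
      fix s assume s: "s \<in> S"
      have "real (card (A s)) powi (-2) = 1 / (real (card (A s)))\<^sup>2"
        by (simp add: power_int_minus inverse_eq_divide)
      then show "(1 - real (card (A s)) powi (-2)) powr (-1/2) = 1 / sqrt (1 - 1 / (real (card (A s)))\<^sup>2)"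
        using pos[OF s] by (simp add: powr_minus powr_half_sqrt inverse_eq_divide)
    qed
    moreover have "sqrt P = (\<Prod>s\<in>S. sqrt (1 - 1 / (real (card (A s)))\<^sup>2))"
      unfolding P_def using finS by (induction S rule: finite_induct) (auto simp: real_sqrt_mult)
    ultimately show ?thesis by (simp add: D_const_def prod_dividef)
  qed
  have M: "moment_const S = 2 ^ card S / P"
    by (simp add: moment_const_def P_def prod_dividef)
  have "sqrt (2 ^ card S) \<le> (2::real) ^ card S"
    by (rule real_le_lsqrt) (auto simp: power2_eq_square)
  also have "\<dots> \<le> 2 ^ card S * 2 ^ (card S - 1)" by simp
  finally show ?thesis unfolding M D using P by (simp add: real_sqrt_divide divide_right_mono)
qed

text \<open>The weights \<open>bB\<close> and \<open>bR\<close> are independent of \<open>t\<close>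
  and \<open>x\<close>, because smoothing changes the operators but not the marginals in the
  entropy. Their fourth roots form a weight \<open>G\<close> for which the squared Hilbert-Schmidt
  norm of \<open>G\<^sup>2\<close> is the product of the traces of \<open>bB\<close> and
  \<open>bR\<close>. Hence the trace norm is at most the Hilbert-Schmidt norm of the contraction of
  \<open>Nt\<close> with \<open>Nx\<close>.\<close>

lemma decoupling_bound:
  assumes "S \<subseteq> K" "S \<noteq> {}" "finite B" "finite R"
    and t: "psd (PiE S A \<times> B) t" and x: "psd (PiE S A \<times> R) x"
    and bB: "psd B bB" "Re (trace_op B bB) \<le> 1" and bR: "psd R bR" "Re (trace_op R bR) \<le> 1"
    and Dt: "D2 (PiE S A \<times> B) t (tensor_op (id_op (PiE S A)) bB) < ereal v"
    and Dx: "D2 (PiE S A \<times> R) x (tensor_op (id_op (PiE S A)) bR) < ereal u"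
  obtains g where "g \<in> borel_measurable (PiM K \<mu>)"
    "\<And>U. ennreal (schatten_norm (B \<times> R) 1 (contract (PiE S A) (fluct_fam S A U) t x)) \<le> g U"
    "(\<integral>\<^sup>+U. g U \<partial>PiM K \<mu>) \<le> ennreal (2 ^ card S * D_const A S * (2 powr (u/2) * 2 powr (v/2)))"
proof -
  define X where "X = PiE S A"
  have finS: "finite S" using assms(1) finK finite_subset by blast
  have finX: "finite X" unfolding X_def using assms(1) finS finA by (intro finite_PiE) auto
  define gB where "gB = powr_op B bB (1/4)"
  define gR where "gR = powr_op R bR (1/4)"
  obtain Nt where Nt: "hs (X \<times> B) Nt \<le> 2 powr v"
    "\<And>f f' r r'. f \<in> X \<Longrightarrow> f' \<in> X \<Longrightarrow> r \<in> B \<Longrightarrow> r' \<in> B \<Longrightarrow>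
      t (f, r) (f', r') = (\<Sum>k\<in>B. \<Sum>l\<in>B. gB r k * Nt (f, k) (f', l) * gB l r')"
    using D2_less_factorisation[OF finX assms(3) bB(1) t[folded X_def] Dt[folded X_def]] unfolding gB_def by blast
  obtain Nx where Nx: "hs (X \<times> R) Nx \<le> 2 powr u"
    "\<And>f f' r r'. f \<in> X \<Longrightarrow> f' \<in> X \<Longrightarrow> r \<in> R \<Longrightarrow> r' \<in> R \<Longrightarrow>
      x (f, r) (f', r') = (\<Sum>k\<in>R. \<Sum>l\<in>R. gR r k * Nx (f, k) (f', l) * gR l r')"
    using D2_less_factorisation[OF finX assms(4) bR(1) x[folded X_def] Dx[folded X_def]] unfolding gR_def by blast
  have hsG: "hs (B \<times> R) (mult_op (B \<times> R) (tensor_op gB gR) (tensor_op gB gR)) \<le> 1"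
  proof -
    have "hs (B \<times> R) (mult_op (B \<times> R) (tensor_op gB gR) (tensor_op gB gR)) = Re (trace_op B bB) * Re (trace_op R bR)"
      unfolding mult_op_tensor hs_tensor gB_def gR_def
        powr_op_mult[OF assms(3) bB(1)] powr_op_mult[OF assms(4) bR(1)]
      by (simp add: hs_powr_half assms(3,4) bB bR)
    also have "\<dots> \<le> 1"
      using bB bR psd_trace_nonneg[OF bB(1) assms(3)] psd_trace_nonneg[OF bR(1) assms(4)]
      by (intro mult_le_one)
    finally show ?thesis .
  qed
  have Gh: "cnj (tensor_op gB gR i j) = tensor_op gB gR j i" for i j
  proof -
    have "adj (tensor_op gB gR) = tensor_op gB gR"
      unfolding adj_tensor gB_def gR_def by (simp add: powr_op_props assms(3,4) bB bR)
    then show ?thesis by (metis adj_def)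
  qed
  define h where "h = (\<lambda>U. hs (B \<times> R) (contract X (fluct_fam S A U) Nt Nx))"
  have h0: "0 \<le> h U" for U by (simp add: h_def hs_nonneg)
  have bound: "schatten_norm (B \<times> R) 1 (contract X (fluct_fam S A U) t x) \<le> sqrt (h U)" for U
  proof -
    have "schatten_norm (B \<times> R) 1 (contract X (fluct_fam S A U) t x)
      \<le> sqrt (hs (B \<times> R) (mult_op (B \<times> R) (tensor_op gB gR) (tensor_op gB gR))) * sqrt (h U)"
      unfolding h_def
    proof (rule schatten_1_weighted_le)
      show "contract X (fluct_fam S A U) t x \<in> opers (B \<times> R)"
        using t x by (intro contract_opers) (auto simp: X_def psd_def)
      show "adj (contract X (fluct_fam S A U) t x) = contract X (fluct_fam S A U) t x"
        using t x by (intro contract_hermitian fluct_fam_hermitian) (auto simp: psd_def)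
      show "contract X (fluct_fam S A U) t x i j = (\<Sum>k\<in>B \<times> R. \<Sum>l\<in>B \<times> R.
          tensor_op gB gR i k * contract X (fluct_fam S A U) Nt Nx k l * tensor_op gB gR l j)"
        if "i \<in> B \<times> R" "j \<in> B \<times> R" for i j
        by (rule contract_sandwich[OF Nt(2) Nx(2) that])
    qed (use assms(3,4) Gh in auto)
    also have "\<dots> \<le> 1 * sqrt (h U)" using hsG h0 by (intro mult_right_mono) auto
    finally show ?thesis by simp
  qed
  define \<Lambda> where "\<Lambda> = moment_const S * (2 powr v * 2 powr u)"
  have \<Lambda>: "0 < \<Lambda>" using moment_const_pos[OF assms(1)] by (simp add: \<Lambda>_def)
  \<comment> \<open>The optimal parameter: as \<open>h\<close> has mean at most
    \<open>l\<^sup>2\<close>, the two halves of the majorant \<open>g\<close> together have mean at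
    most \<open>l\<close>.\<close>
  define l where "l = sqrt \<Lambda>"
  have l: "0 < l" "l * l = \<Lambda>" using \<Lambda> by (auto simp: l_def)
  have hm: "(\<lambda>U. ennreal (h U)) \<in> borel_measurable (PiM K \<mu>)"
    unfolding h_def hs_def
    by (intro measurable_compose[OF _ measurable_ennreal] borel_measurable_sum borel_measurable_power
        measurable_compose[OF _ borel_measurable_norm] contract_measurable assms)
  \<comment> \<open>AM-GM in place of Jensen's inequality for the square root.\<close>
  define g where "g = (\<lambda>U. ennreal (l / 2) + ennreal (1 / (2 * l)) * ennreal (h U))"
  show thesis
  proof (rule that[of g])
    show "g \<in> borel_measurable (PiM K \<mu>)" unfolding g_def using hm by measurable
    show "ennreal (schatten_norm (B \<times> R) 1 (contract (PiE S A) (fluct_fam S A U) t x)) \<le> g U" for U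
    proof -
      have "(l - sqrt (h U))\<^sup>2 = l * l + h U - 2 * l * sqrt (h U)"
        using h0[of U] by (simp add: power2_diff power2_eq_square[of l])
      then have "2 * l * sqrt (h U) \<le> l * l + h U" using zero_le_power2[of "l - sqrt (h U)"] by linarith
      then have "sqrt (h U) \<le> l / 2 + 1 / (2 * l) * h U" using l by (simp add: field_simps)
      then have "ennreal (schatten_norm (B \<times> R) 1 (contract X (fluct_fam S A U) t x)) \<le> ennreal (l / 2 + 1 / (2 * l) * h U)"
        using bound[of U] by (intro ennreal_leI) simp
      also have "\<dots> = g U" unfolding g_def using l h0[of U] by (simp add: ennreal_plus ennreal_mult[symmetric])
      finally show ?thesis by (simp add: X_def)
    qed
    have "(\<integral>\<^sup>+U. ennreal (h U) \<partial>PiM K \<mu>) \<le> ennreal (moment_const S * (hs (X \<times> B) Nt * hs (X \<times> R) Nx))"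
      unfolding h_def X_def by (rule hs_contract_moment[OF assms(1,3,4)])
    also have "\<dots> \<le> ennreal \<Lambda>"
      unfolding \<Lambda>_def using moment_const_pos[OF assms(1)] Nt(1) Nx(1)
      by (intro ennreal_leI mult_left_mono mult_mono hs_nonneg) auto
    finally have Eh: "(\<integral>\<^sup>+U. ennreal (h U) \<partial>PiM K \<mu>) \<le> ennreal \<Lambda>" .
    have "(\<integral>\<^sup>+U. g U \<partial>PiM K \<mu>) = ennreal (l / 2) + ennreal (1 / (2 * l)) * (\<integral>\<^sup>+U. ennreal (h U) \<partial>PiM K \<mu>)"
      unfolding g_def using hm by (simp add: nn_integral_add nn_integral_cmult P.emeasure_space_1)
    also have "\<dots> \<le> ennreal (l / 2) + ennreal (1 / (2 * l)) * ennreal \<Lambda>"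
      by (intro add_left_mono mult_left_mono Eh) simp
    also have "\<dots> = ennreal l"
      using l by (simp add: ennreal_mult[symmetric] ennreal_plus[symmetric] field_simps flip: l(2))
    also have "l = sqrt (moment_const S) * (2 powr (u/2) * 2 powr (v/2))"
    proof -
      have "sqrt (2 powr w) = 2 powr (w / 2)" for w :: real
        by (simp add: powr_half_sqrt[symmetric] powr_powr)
      then show ?thesis by (simp add: l_def \<Lambda>_def real_sqrt_mult)
    qed
    also have "ennreal \<dots> \<le> ennreal (2 ^ card S * D_const A S * (2 powr (u/2) * 2 powr (v/2)))"
      by (intro ennreal_leI mult_right_mono moment_const_le assms) auto
    finally show "(\<integral>\<^sup>+U. g U \<partial>PiM K \<mu>) \<le> ennreal (2 ^ card S * D_const A S * (2 powr (u/2) * 2 powr (v/2)))" .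
  qed
qed

end

subsection \<open>Marginals\<close>

lemma sum_merge:
  assumes "S \<subseteq> K"
  shows "(\<Sum>F\<in>PiE K A. \<phi> F) = (\<Sum>f\<in>PiE S A. \<Sum>h\<in>PiE (K - S) A. \<phi> (merge S (K - S) (f, h)))"
proof -
  have m: "merge S (K - S) (restrict F S, restrict F (K - S)) = F" if "F \<in> PiE K A" for F
    using that assms by (auto simp: merge_def fun_eq_iff PiE_iff extensional_def)
  have "(\<Sum>F\<in>PiE K A. \<phi> F) = (\<Sum>p\<in>PiE S A \<times> PiE (K - S) A. \<phi> (merge S (K - S) p))"
  proof (rule sum.reindex_bij_witness[of _ "merge S (K - S)" "\<lambda>F. (restrict F S, restrict F (K - S))"])
    show "merge S (K - S) (restrict F S, restrict F (K - S)) = F" if "F \<in> PiE K A" for F using m[OF that] .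
    show "\<phi> (merge S (K - S) (restrict F S, restrict F (K - S))) = \<phi> F" if "F \<in> PiE K A" for F
      by (simp only: m[OF that])
    show "(restrict (merge S (K - S) p) S, restrict (merge S (K - S) p) (K - S)) = p"
      if "p \<in> PiE S A \<times> PiE (K - S) A" for p
      using that by (auto simp: prod_eq_iff merge_def fun_eq_iff PiE_iff extensional_def)
    show "merge S (K - S) p \<in> PiE K A" if "p \<in> PiE S A \<times> PiE (K - S) A" for p
      using that assms by (auto simp: merge_def PiE_iff extensional_def split: prod.splits)
    show "(restrict F S, restrict F (K - S)) \<in> PiE S A \<times> PiE (K - S) A" if "F \<in> PiE K A" for F
      using that assms by (auto simp: PiE_iff)
  qed
  then show ?thesis by (simp add: sum_times)
qed

lemma merge_PiE: "S \<subseteq> K \<Longrightarrow> f \<in> PiE S A \<Longrightarrow> h \<in> PiE (K - S) A \<Longrightarrow> merge S (K - S) (f, h) \<in> PiE K A"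
  by (auto simp: merge_def PiE_iff extensional_def)

lemma marginal_fam_entry:
  assumes "fst i \<in> PiE S A" "fst j \<in> PiE S A"
  shows "marginal_fam K S A M i j = (\<Sum>h\<in>PiE (K - S) A. M (merge S (K - S) (fst i, h), snd i) (merge S (K - S) (fst j, h), snd j))"
  using assms by (simp add: marginal_fam_def case_prod_beta)

lemma marginal_fam_psd:
  assumes "finite (PiE K A)" "finite R" "S \<subseteq> K" "psd (PiE K A \<times> R) M"
  shows "psd (PiE S A \<times> R) (marginal_fam K S A M)"
proof (rule psd_if_gram)
  have "M \<in> opers (PiE K A \<times> R)" using assms(4) by (simp add: psd_def)
  then show "marginal_fam K S A M \<in> opers (PiE S A \<times> R)"
    by (auto simp: marginal_fam_def opers_def)
  have "gram (PiE S A \<times> R) (\<lambda>i j. \<Sum>h\<in>PiE (K - S) A.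
      M (merge S (K - S) (fst i, h), snd i) (merge S (K - S) (fst j, h), snd j))"
  proof (rule gram_sum)
    fix h assume h: "h \<in> PiE (K - S) A"
    show "gram (PiE S A \<times> R) (\<lambda>i j. M (merge S (K - S) (fst i, h), snd i) (merge S (K - S) (fst j, h), snd j))"
      using assms(1,2) h
      by (intro gram_pullback[OF psd_gram[OF _ assms(4)], of _ "\<lambda>i. (merge S (K - S) (fst i, h), snd i)"])
        (simp_all add: mem_Times_iff merge_PiE[OF assms(3)])
  qed
  then obtain N u where u: "\<forall>i\<in>PiE S A \<times> R. \<forall>j\<in>PiE S A \<times> R. (\<Sum>h\<in>PiE (K - S) A.
      M (merge S (K - S) (fst i, h), snd i) (merge S (K - S) (fst j, h), snd j)) = (\<Sum>n<(N::nat). u n i * cnj (u n j))"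
    by (auto simp: gram_def)
  then show "gram (PiE S A \<times> R) (marginal_fam K S A M)"
    unfolding gram_def by (intro exI[of _ N] exI[of _ u] ballI, subst marginal_fam_entry) auto
qed

lemma trace_marginal_fam:
  assumes "S \<subseteq> K"
  shows "trace_op (PiE S A \<times> R) (marginal_fam K S A M) = trace_op (PiE K A \<times> R) M"
proof -
  have "trace_op (PiE S A \<times> R) (marginal_fam K S A M) = (\<Sum>f\<in>PiE S A. \<Sum>r\<in>R. \<Sum>h\<in>PiE (K - S) A.
      M (merge S (K - S) (f, h), r) (merge S (K - S) (f, h), r))"
    unfolding trace_op_def sum_times by (intro sum.cong refl, subst marginal_fam_entry) auto
  also have "\<dots> = (\<Sum>f\<in>PiE S A. \<Sum>h\<in>PiE (K - S) A. \<Sum>r\<in>R.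
      M (merge S (K - S) (f, h), r) (merge S (K - S) (f, h), r))"
    by (intro sum.cong refl sum.swap)
  also have "\<dots> = trace_op (PiE K A \<times> R) M"
    unfolding trace_op_def sum_times sum_merge[OF assms, of "\<lambda>F. \<Sum>r\<in>R. M (F, r) (F, r)"] ..
  finally show ?thesis .
qed

lemma marginal_snd_psd:
  assumes "finite I" "finite R" "psd (I \<times> R) M"
  shows "psd R (marginal_snd I M)"
proof (rule psd_if_gram)
  show "marginal_snd I M \<in> opers R" using assms(3) by (auto simp: marginal_snd_def opers_def psd_def)
  show "gram R (marginal_snd I M)"
    unfolding marginal_snd_def
  proof (rule gram_sum)
    fix i assume "i \<in> I"
    then show "gram R (\<lambda>j j'. M (i, j) (i, j'))"
      using assms by (intro gram_pullback[OF psd_gram[OF _ assms(3)], of R "\<lambda>j. (i, j)"]) auto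
  qed
qed

lemma trace_marginal_snd: "trace_op R (marginal_snd I M) = trace_op (I \<times> R) M"
  unfolding trace_op_def marginal_snd_def sum_times by (rule sum.swap)

text \<open>On \<open>K - S\<close> the depolarising kernel forces the inner index pairs on both
  sides to coincide. Summing over the common pair takes the partial trace of \<open>\<tau>\<close>
  and of \<open>\<rho>\<close> separately, and the normalisation of the kernel reduces the prefactor
  to that of \<open>S\<close>.\<close>

lemma contract_marginal:
  assumes "finite K" "S \<subseteq> K" "\<And>s. s \<in> K \<Longrightarrow> finite (A s) \<and> card (A s) \<noteq> 0"
  shows "contract (PiE K A) (\<lambda>p q. of_nat (card (PiE K A)) * ((\<Prod>s\<in>S. z s (comp_at s p) (comp_at s q))
      * (\<Prod>s\<in>K - S. depol_ker (A s) (comp_at s p) (comp_at s q)))) \<tau> \<rho>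
    = contract (PiE S A) (\<lambda>p q. of_nat (card (PiE S A)) * (\<Prod>s\<in>S. z s (comp_at s p) (comp_at s q)))
        (marginal_fam K S A \<tau>) (marginal_fam K S A \<rho>)" (is "?L = ?R")
proof (intro ext)
  fix i j
  define C where "C = K - S"
  have finC: "finite C" "finite S" using assms finite_subset by (auto simp: C_def)
  define mg where "mg = (\<lambda>u v :: (nat \<Rightarrow> 'a) \<times> (nat \<Rightarrow> 'a). (merge S C (fst u, fst v), merge S C (snd u, snd v)))"
  let ?XS = "PiE S A \<times> PiE S A" and ?XC = "PiE C A \<times> PiE C A" and ?XK = "PiE K A \<times> PiE K A"
  have finX: "finite (PiE C A)" using finC assms by (intro finite_PiE) (auto simp: C_def)
  have split: "(\<Sum>p\<in>?XK. \<phi> p) = (\<Sum>u\<in>?XS. \<Sum>v\<in>?XC. \<phi> (mg u v))" for \<phi> :: "_ \<Rightarrow> complex"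
  proof -
    have "(\<Sum>p\<in>?XK. \<phi> p) = (\<Sum>f\<in>PiE S A. \<Sum>h\<in>PiE C A. \<Sum>f'\<in>PiE S A. \<Sum>h'\<in>PiE C A.
        \<phi> (merge S C (f, h), merge S C (f', h')))"
      unfolding sum_times sum_merge[OF assms(2)] C_def ..
    also have "\<dots> = (\<Sum>f\<in>PiE S A. \<Sum>f'\<in>PiE S A. \<Sum>h\<in>PiE C A. \<Sum>h'\<in>PiE C A.
        \<phi> (merge S C (f, h), merge S C (f', h')))"
      by (rule sum.cong[OF refl], rule sum.swap)
    finally show ?thesis by (simp add: sum_times mg_def)
  qed
  have compS: "comp_at s (mg u v) = comp_at s u" if "s \<in> S" for s u v
    using that by (simp add: comp_at_def mg_def merge_def)
  have compC: "comp_at s (mg u v) = comp_at s v" if "s \<in> C" for s u v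
    using that by (simp add: comp_at_def mg_def merge_def C_def)
  define Z where "Z = (\<lambda>u u'. \<Prod>s\<in>S. z s (comp_at s u) (comp_at s u'))"
  define W where "W = (\<lambda>u v u' v'. \<tau> (fst (mg u v), fst i) (fst (mg u' v'), fst j) * \<rho> (snd (mg u v), snd i) (snd (mg u' v'), snd j))"
  have card: "card (PiE K A) = card (PiE S A) * card (PiE C A)"
    using assms finC prod.subset_diff[OF assms(2,1), of "\<lambda>s. card (A s)"] by (simp add: card_PiE C_def mult.commute)
  have cC: "card (PiE C A) \<noteq> 0" 
  proof -
    have "card (A s) \<noteq> 0" if "s \<in> C" for s using assms(3)[of s] that unfolding C_def by blast
    then show ?thesis using finC(1) by (simp only: card_PiE prod_zero_iff) blast
  qed
  have "?L i j = (\<Sum>u\<in>?XS. \<Sum>v\<in>?XC. \<Sum>u'\<in>?XS. \<Sum>v'\<in>?XC. of_nat (card (PiE K A)) *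
      (Z u u' * (\<Prod>s\<in>C. depol_ker (A s) (comp_at s v) (comp_at s v'))) * W u v u' v')"
    unfolding contract_def split C_def[symmetric] Z_def W_def using compS compC by (simp add: mult.assoc)
  also have "\<dots> = (\<Sum>u\<in>?XS. \<Sum>v\<in>?XC. \<Sum>u'\<in>?XS. \<Sum>v'\<in>?XC.
      if v = v' then of_nat (card (PiE S A)) * Z u u' * W u v u' v else 0)"
    using finC cC by (intro sum.cong refl) (simp add: prod_depol_ker card)
  also have "\<dots> = (\<Sum>u\<in>?XS. \<Sum>v\<in>?XC. \<Sum>u'\<in>?XS. of_nat (card (PiE S A)) * Z u u' * W u v u' v)"
    using finX by (intro sum.cong refl) simp
  also have "\<dots> = (\<Sum>u\<in>?XS. \<Sum>u'\<in>?XS. of_nat (card (PiE S A)) * Z u u' * (\<Sum>v\<in>?XC. W u v u' v))"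
    unfolding sum_distrib_left by (rule sum.cong[OF refl], rule sum.swap)
  also have "\<dots> = ?R i j"
    unfolding contract_def Z_def
  proof (intro sum.cong refl)
    fix u u' assume u: "u \<in> ?XS" "u' \<in> ?XS"
    have "(\<Sum>v\<in>?XC. W u v u' v) = (\<Sum>h\<in>PiE C A. \<tau> (merge S C (fst u, h), fst i) (merge S C (fst u', h), fst j))
        * (\<Sum>h\<in>PiE C A. \<rho> (merge S C (snd u, h), snd i) (merge S C (snd u', h), snd j))"
      by (simp add: W_def mg_def sum_times sum_product)
    also have "\<dots> = marginal_fam K S A \<tau> (fst u, fst i) (fst u', fst j) * marginal_fam K S A \<rho> (snd u, snd i) (snd u', snd j)"
      using u by (simp add: marginal_fam_entry C_def mem_Times_iff)
    finally show "of_nat (card (PiE S A)) * (\<Prod>s\<in>S. z s (comp_at s u) (comp_at s u')) * (\<Sum>v\<in>?XC. W u v u' v)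
      = of_nat (card (PiE S A)) * (\<Prod>s\<in>S. z s (comp_at s u) (comp_at s u')) * marginal_fam K S A \<tau> (fst u, fst i) (fst u', fst j)
        * marginal_fam K S A \<rho> (snd u, snd i) (snd u', snd j)" by simp
  qed
  finally show "?L i j = ?R i j" .
qed

lemma fluctuation_decomposition:
  assumes "finite K" "\<And>s. s \<in> K \<Longrightarrow> finite (A s) \<and> card (A s) \<noteq> 0"
  shows "contract (PiE K A) (\<lambda>p q. of_nat (card (PiE K A)) * (\<Prod>s\<in>K. conj_ker (U s) (comp_at s p) (comp_at s q))) \<tau> \<rho>
    = (\<lambda>i j. \<Sum>S\<in>Pow K. contract (PiE S A) (fluct_fam S A U) (marginal_fam K S A \<tau>) (marginal_fam K S A \<rho>) i j)"
proof -
  define \<kappa> where "\<kappa> = (\<lambda>S p q. of_nat (card (PiE K A)) * ((\<Prod>s\<in>S. fluct (A s) (U s) (comp_at s p) (comp_at s q))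
      * (\<Prod>s\<in>K - S. depol_ker (A s) (comp_at s p) (comp_at s q))))"
  have "of_nat (card (PiE K A)) * (\<Prod>s\<in>K. conj_ker (U s) (comp_at s p) (comp_at s q)) = (\<Sum>S\<in>Pow K. 1 * \<kappa> S p q)" for p q
  proof -
    have "conj_ker (U s) x y = fluct (A s) (U s) x y + depol_ker (A s) x y" for s x y
      by (simp add: fluct_eq)
    then show ?thesis by (simp add: \<kappa>_def sum_distrib_left prod_add[OF assms(1)])
  qed
  then have "contract (PiE K A) (\<lambda>p q. of_nat (card (PiE K A)) * (\<Prod>s\<in>K. conj_ker (U s) (comp_at s p) (comp_at s q))) \<tau> \<rho>
    = contract (PiE K A) (\<lambda>p q. \<Sum>S\<in>Pow K. 1 * \<kappa> S p q) \<tau> \<rho>"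
    by (simp only:)
  also have "\<dots> = (\<lambda>i j. \<Sum>S\<in>Pow K. contract (PiE K A) (\<kappa> S) \<tau> \<rho> i j)"
    by (subst contract_sum_kernel) simp
  also have "\<dots> = (\<lambda>i j. \<Sum>S\<in>Pow K. contract (PiE S A) (fluct_fam S A U) (marginal_fam K S A \<tau>) (marginal_fam K S A \<rho>) i j)"
  proof (intro ext sum.cong refl)
    fix i j S assume "S \<in> Pow K"
    then have S: "S \<subseteq> K" by simp
    show "contract (PiE K A) (\<kappa> S) \<tau> \<rho> i j
        = contract (PiE S A) (fluct_fam S A U) (marginal_fam K S A \<tau>) (marginal_fam K S A \<rho>) i j"
      unfolding \<kappa>_def fluct_fam_def[abs_def]
      by (rule fun_cong[OF fun_cong[OF contract_marginal[OF assms(1) S assms(2)]]])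
  qed
  finally show ?thesis .
qed

text \<open>Complete depolarisation leaves only the marginals on \<open>B\<close> and
  \<open>R\<close>. This is the product state subtracted in the theorem, so the empty set drops out
  of the decomposition.\<close>

lemma contract_empty:
  fixes A :: "nat \<Rightarrow> 'a set"
  shows "contract (PiE {} A) (fluct_fam {} A U) (marginal_fam K {} A \<tau>) (marginal_fam K {} A \<rho>)
    = tensor_op (marginal_snd (PiE K A) \<tau>) (marginal_snd (PiE K A) \<rho>)"
proof -
  have m: "merge {} K (f, h) = h" if "h \<in> PiE K A" for f h
    using that by (auto simp: merge_def fun_eq_iff PiE_iff extensional_def)
  have e: "marginal_fam K {} A M (\<lambda>x. undefined, b) (\<lambda>x. undefined, b') = marginal_snd (PiE K A) M b b'"
    for b b' and M :: "((nat \<Rightarrow> 'a) \<times> 'x) oper"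
    by (subst marginal_fam_entry) (auto simp: marginal_snd_def m)
  show ?thesis
    by (auto simp: contract_def fluct_fam_def tensor_op_def e fun_eq_iff)
qed

subsection \<open>Choi matrices\<close>

definition unit_op :: "'i \<Rightarrow> 'i \<Rightarrow> 'i oper" where
  "unit_op f g = (\<lambda>i j. if i = f \<and> j = g then 1 else 0)"

lemma unit_op_opers: "f \<in> I \<Longrightarrow> g \<in> I \<Longrightarrow> unit_op f g \<in> opers I"
  by (auto simp: unit_op_def opers_def)

lemma superoperatorD:
  assumes "superoperator I J T" "M \<in> opers I"
  shows "T M \<in> opers J"
    and "T (\<lambda>i j. c * M i j) = (\<lambda>i j. c * T M i j)"
    and "N \<in> opers I \<Longrightarrow> T (\<lambda>i j. M i j + N i j) = (\<lambda>i j. T M i j + T N i j)"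
  using assms by (simp_all add: superoperator_def)

lemma superoperator_sum:
  assumes T: "superoperator I J T" and "finite P" "\<And>p. p \<in> P \<Longrightarrow> M p \<in> opers I"
  shows "T (\<lambda>i j. \<Sum>p\<in>P. c p * M p i j) = (\<lambda>i j. \<Sum>p\<in>P. c p * T (M p) i j)"
  using assms(2,3)
proof (induction P rule: finite_induct)
  case empty
  have z: "(\<lambda>i j. 0) \<in> opers I" by (simp add: opers_def)
  show ?case using superoperatorD(2)[OF T z, of 0] by simp
next
  case (insert p P)
  let ?N = "\<lambda>i j. \<Sum>p\<in>P. c p * M p i j"
  have N: "?N \<in> opers I" and cM: "(\<lambda>i j. c p * M p i j) \<in> opers I"
    using insert.prems by (force simp: opers_def intro!: sum.neutral)+
  have "T (\<lambda>i j. c p * M p i j + ?N i j) = (\<lambda>i j. T (\<lambda>i j. c p * M p i j) i j + T ?N i j)"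
    by (rule superoperatorD(3)[OF T cM N])
  also have "T (\<lambda>i j. c p * M p i j) = (\<lambda>i j. c p * T (M p) i j)"
    using insert.prems by (intro superoperatorD(2)[OF T]) auto
  finally show ?case using insert by simp
qed

lemma superoperator_expand:
  assumes T: "superoperator I J T" and "finite I" "M \<in> opers I"
  shows "T M b b' = (\<Sum>f\<in>I. \<Sum>g\<in>I. M f g * T (unit_op f g) b b')"
proof -
  have "M i j = (\<Sum>p\<in>I\<times>I. M (fst p) (snd p) * unit_op (fst p) (snd p) i j)" for i j
  proof -
    have "(\<Sum>p\<in>I\<times>I. M (fst p) (snd p) * unit_op (fst p) (snd p) i j) = (\<Sum>p\<in>I\<times>I. if p = (i, j) then M i j else 0)"
      by (intro sum.cong refl) (auto simp: unit_op_def)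
    then show ?thesis using assms(2,3) by (auto simp: opers_def)
  qed
  then have "M = (\<lambda>i j. \<Sum>p\<in>I\<times>I. M (fst p) (snd p) * unit_op (fst p) (snd p) i j)" by (intro ext)
  then have "T M = T (\<lambda>i j. \<Sum>p\<in>I\<times>I. M (fst p) (snd p) * unit_op (fst p) (snd p) i j)" by (rule arg_cong)
  also have "\<dots> = (\<lambda>i j. \<Sum>p\<in>I\<times>I. M (fst p) (snd p) * T (unit_op (fst p) (snd p)) i j)"
    using assms(2) by (intro superoperator_sum[OF T]) (auto intro: unit_op_opers)
  finally show ?thesis by (simp add: sum_times)
qed

text \<open>A block of the product of EPR states with respect to the primed systems is a matrix unit
  divided by the dimension. The Choi matrix thus records the action of \<open>T\<close> on matrix
  units.\<close>

lemma choi_entry: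
  assumes K: "finite K" "\<And>s. s \<in> K \<Longrightarrow> finite (A s)"
    and T: "superoperator (PiE K A) B T"
  shows "choi K A T (f, b) (g, b') = (if f \<in> PiE K A \<and> g \<in> PiE K A
     then T (unit_op f g) b b' / of_nat (card (PiE K A)) else 0)"
proof (cases "f \<in> PiE K A \<and> g \<in> PiE K A")
  case True
  have "epr_fam K A (i, f) (j, g) = 1 / of_nat (card (PiE K A)) * unit_op f g i j" for i j
  proof (cases "i \<in> PiE K A \<and> j \<in> PiE K A")
    case ij: True
    \<comment> \<open>The EPR entry demands \<open>i = f\<close> and \<open>j = g\<close>, the same
      condition as for the depolarising kernel at these pairs, so that \<open>prod_depol_ker\<close>
      evaluates the product.\<close>
    have "epr_fam K A (i, f) (j, g) = (\<Prod>s\<in>K. depol_ker (A s) (comp_at s (i, j)) (comp_at s (f, g)))"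
      using True ij by (auto simp: epr_fam_def epr_def depol_ker_def comp_at_def PiE_mem intro!: prod.cong)
    also have "\<dots> = 1 / of_nat (card (PiE K A)) * unit_op f g i j"
      using True ij K by (subst prod_depol_ker) (auto simp: unit_op_def)
    finally show ?thesis .
  next
    case False
    then show ?thesis using True by (auto simp: epr_fam_def unit_op_def)
  qed
  moreover have "T (\<lambda>i j. 1 / of_nat (card (PiE K A)) * unit_op f g i j) = (\<lambda>i j. 1 / of_nat (card (PiE K A)) * T (unit_op f g) i j)"
    using True by (intro superoperatorD(2)[OF T] unit_op_opers) auto
  ultimately show ?thesis using True by (simp add: choi_def swap_op_def ext_superop_def)
next
  case False
  then have "epr_fam K A (i, f) (j, g) = 0" for i j by (auto simp: epr_fam_def)
  moreover have "T (\<lambda>i j. 0) = (\<lambda>i j. 0)"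
    using superoperator_sum[OF T, of "{}"] by simp
  ultimately show ?thesis using False by (auto simp: choi_def swap_op_def ext_superop_def)
qed

text \<open>Complete positivity is formulated with ancillas \<open>{..<n}\<close>, so the primed
  system is enumerated by \<open>h\<close>, \<open>T\<close> is applied to a maximally entangled
  state with that ancilla, and the result is pulled back.\<close>

lemma choi_psd:
  assumes K: "finite K" "\<And>s. s \<in> K \<Longrightarrow> finite (A s)" and "finite B"
    and T: "superoperator (PiE K A) B T" "completely_positive (PiE K A) B T"
  shows "psd (PiE K A \<times> B) (choi K A T)"
proof (rule psd_if_gram)
  define X where "X = PiE K A"
  have finX: "finite X" unfolding X_def using K by (intro finite_PiE)
  have TB: "T (unit_op f g) \<in> opers B" if "f \<in> X" "g \<in> X" for f g
    using superoperatorD(1)[OF T(1)] unit_op_opers[OF that] by (simp add: X_def)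
  show "choi K A T \<in> opers (PiE K A \<times> B)"
    unfolding opers_def using TB by (auto simp: choi_entry[OF K T(1)] X_def opers_def)
  define n where "n = card X"
  obtain h where "bij_betw h {0..<n} X" using ex_bij_betw_nat_finite[OF finX] by (auto simp: n_def)
  then have h: "bij_betw h {..<n} X" by (simp add: atLeast0LessThan)
  define k where "k = the_inv_into {..<n} h"
  have k: "k f \<in> {..<n}" "h (k f) = f" if "f \<in> X" for f
    using h that bij_betw_the_inv_into[OF h] f_the_inv_into_f_bij_betw[OF h, of f] by (auto simp: k_def bij_betw_def)
  \<comment> \<open>The normalised maximally entangled vector between \<open>X\<close> and its
    enumeration.\<close>
  define v where "v = (\<lambda>p :: (nat \<Rightarrow> 'a) \<times> nat. if fst p \<in> X \<and> snd p < n \<and> fst p = h (snd p)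
      then complex_of_real (1 / sqrt (real n)) else 0)"
  define M where "M = (\<lambda>p q. v p * cnj (v q))"
  have "psd (X \<times> {..<n}) M"
    by (rule psd_if_gram) (auto simp: M_def gram_rank_one opers_def v_def)
  then have "psd (B \<times> {..<n}) (ext_superop T M)"
    using T(2) by (simp add: completely_positive_def X_def)
  then have g: "gram (B \<times> {..<n}) (ext_superop T M)" using assms(3) by (intro psd_gram) auto
  have "ext_superop T M (b, k f) (b', k g) = choi K A T (f, b) (g, b')" if fg: "f \<in> X" "g \<in> X" for f g b b'
  proof -
    have "M (i, k f) (j, k g) = 1 / of_nat n * unit_op f g i j" for i j
      using k[OF fg(1)] k[OF fg(2)] fg by (auto simp: M_def v_def unit_op_def simp flip: of_real_mult)
    moreover have "T (\<lambda>i j. 1 / of_nat n * unit_op f g i j) = (\<lambda>i j. 1 / of_nat n * T (unit_op f g) i j)"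
      using unit_op_opers[OF fg] unfolding X_def by (rule superoperatorD(2)[OF T(1)])
    ultimately show ?thesis
      using fg by (simp add: choi_entry[OF K T(1)] ext_superop_def X_def n_def)
  qed
  moreover have "gram (X \<times> B) (\<lambda>x y. ext_superop T M (snd x, k (fst x)) (snd y, k (fst y)))"
    by (rule gram_pullback[OF g, of _ "\<lambda>x. (snd x, k (fst x))"]) (use k in auto)
  ultimately show "gram (PiE K A \<times> B) (choi K A T)"
    unfolding gram_def X_def[symmetric] by fastforce
qed

text \<open>The trace of the Choi state is the trace of the image of the maximally mixed state
  \<open>D\<close>.\<close>

lemma choi_trace:
  assumes K: "finite K" "\<And>s. s \<in> K \<Longrightarrow> finite (A s)"
    and T: "superoperator (PiE K A) B T" "trace_nonincreasing (PiE K A) B T"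
  shows "Re (trace_op (PiE K A \<times> B) (choi K A T)) \<le> 1"
proof -
  define X where "X = PiE K A"
  have finX: "finite X" unfolding X_def using K by (intro finite_PiE)
  define D where "D = (\<lambda>i j. complex_of_real (1 / real (card X)) * id_op X i j)"
  have D: "D \<in> opers X" using id_op_opers[of X] by (auto simp: D_def opers_def)
  have "gram X (\<lambda>i j. if i = j then 1 else 0)" using finX by (intro gram_delta[of X X "\<lambda>i. i"]) auto
  then have "gram X (id_op X)" by (simp add: gram_def id_op_def diag_op_def)
  then have "gram X D" unfolding D_def by (intro gram_mult gram_const) auto
  then have "psd X D" using D by (intro psd_if_gram)
  then have "Re (trace_op B (T D)) \<le> Re (trace_op X D)"
    using T(2) by (simp add: trace_nonincreasing_def X_def)
  also have "trace_op X D = of_nat (card X) * (1 / of_nat (card X))"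
    by (simp add: trace_op_def D_def id_op_def diag_op_def)
  \<comment> \<open>The trace is 1 unless \<open>X\<close> is empty, in which case
    \<open>1 / 0 = 0\<close> gives 0.\<close>
  also have "Re \<dots> \<le> 1" by (simp add: Re_divide_of_nat)
  finally have "Re (trace_op B (T D)) \<le> 1" .
  moreover have "trace_op B (T D) = trace_op (X \<times> B) (choi K A T)"
  proof -
    have "T D b b = (\<Sum>f\<in>X. choi K A T (f, b) (f, b))" for b
    proof -
      have "T D b b = (\<Sum>f\<in>X. \<Sum>g\<in>X. D f g * T (unit_op f g) b b)"
        using superoperator_expand[OF T(1), of D b b] finX D by (simp add: X_def)
      also have "\<dots> = (\<Sum>f\<in>X. \<Sum>g\<in>X. if f = g then T (unit_op f f) b b / of_nat (card X) else 0)"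
        by (intro sum.cong refl) (auto simp: D_def id_op_def diag_op_def)
      finally show ?thesis using finX by (simp add: choi_entry[OF K T(1)] X_def cong: sum.cong)
    qed
    then show ?thesis unfolding trace_op_def sum_times by (subst sum.swap) simp
  qed
  ultimately show ?thesis by (simp add: X_def)
qed

text \<open>Expanding the rotated state in matrix units expresses \<open>T\<close> through its Choi
  matrix, at the price of the factor \<open>card (PiE K A)\<close>. What is left of the unitaries is
  the conjugation kernel on all systems, the starting point of
  \<open>fluctuation_decomposition\<close>.\<close>

lemma perturbed_eq:
  fixes T :: "(nat \<Rightarrow> 'a, 'b) superoper" and R :: "'r set"
  assumes K: "finite K" "\<And>s. s \<in> K \<Longrightarrow> finite (A s) \<and> card (A s) \<noteq> 0" and "finite R"
    and T: "superoperator (PiE K A) B T" and \<rho>: "\<rho> \<in> opers (PiE K A \<times> R)"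
  shows "perturbed K A R T \<rho> U = contract (PiE K A)
     (\<lambda>p q. of_nat (card (PiE K A)) * (\<Prod>s\<in>K. conj_ker (U s) (comp_at s p) (comp_at s q))) (choi K A T) \<rho>"
proof (intro ext)
  fix i j :: "'b \<times> 'r"
  define X where "X = PiE K A"
  have finX: "finite X" unfolding X_def using K by (intro finite_PiE) auto
  have c0: "card X \<noteq> 0"
    unfolding X_def card_PiE[OF K(1)] prod_zero_iff[OF K(1)] using K(2) by blast
  define tf where "tf = tensor_fam K A U"
  define Y where "Y = (\<lambda>f f'. \<Sum>g\<in>X. \<Sum>g'\<in>X. tf f g * \<rho> (g, snd i) (g', snd j) * cnj (tf f' g'))"
  have W: "(\<Sum>l\<in>X\<times>R. tensor_op tf (id_op R) (f, r) l * F l) = (if r \<in> R then \<Sum>g\<in>X. tf f g * F (g, r) else 0)"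
    for f r and F :: "_ \<Rightarrow> complex"
  proof -
    have "(\<Sum>l\<in>X\<times>R. tensor_op tf (id_op R) (f, r) l * F l)
        = (\<Sum>g\<in>X. \<Sum>m\<in>R. if m = r then tf f g * F (g, r) else 0)"
      unfolding sum_times by (intro sum.cong refl) (auto simp: tensor_op_def id_op_def diag_op_def)
    then show ?thesis using assms(3) by simp
  qed
  have Ye: "mult_op (X \<times> R) (tensor_op tf (id_op R)) (mult_op (X \<times> R) \<rho> (adj (tensor_op tf (id_op R)))) (f, snd i) (f', snd j)
      = Y f f'" for f f'
  proof -
    have \<rho>W: "(\<Sum>l\<in>X\<times>R. \<rho> y l * adj (tensor_op tf (id_op R)) l (f', snd j))
      = (\<Sum>g'\<in>X. \<rho> y (g', snd j) * cnj (tf f' g'))" for y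
    proof -
      have "(\<Sum>l\<in>X\<times>R. \<rho> y l * adj (tensor_op tf (id_op R)) l (f', snd j))
        = cnj (\<Sum>l\<in>X\<times>R. tensor_op tf (id_op R) (f', snd j) l * cnj (\<rho> y l))"
        by (simp add: adj_def mult.commute)
      also have "\<dots> = (\<Sum>g'\<in>X. \<rho> y (g', snd j) * cnj (tf f' g'))"
      proof -
        have "\<rho> y (g', snd j) = 0" if "snd j \<notin> R" for g'
          using \<rho> that by (cases y) (auto simp: opers_def)
        then show ?thesis unfolding W by (simp add: mult.commute)
      qed
      finally show ?thesis .
    qed
    have "mult_op (X \<times> R) (tensor_op tf (id_op R)) (mult_op (X \<times> R) \<rho> (adj (tensor_op tf (id_op R)))) (f, snd i) (f', snd j)
      = (if snd i \<in> R then \<Sum>g\<in>X. tf f g * (\<Sum>g'\<in>X. \<rho> (g, snd i) (g', snd j) * cnj (tf f' g')) else 0)"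
      unfolding mult_op_def \<rho>W W ..
    also have "\<dots> = Y f f'"
    proof (cases "snd i \<in> R")
      case True
      then show ?thesis by (simp add: Y_def sum_distrib_left mult.assoc)
    next
      case False
      then have "\<rho> (g, snd i) y = 0" for g y using \<rho> by (cases y) (auto simp: opers_def)
      then show ?thesis using False by (simp add: Y_def)
    qed
    finally show ?thesis .
  qed
  have Yo: "Y \<in> opers X" by (auto simp: opers_def Y_def tf_def tensor_fam_def X_def)
  have tf: "tf f g * cnj (tf f' g') = (\<Prod>s\<in>K. conj_ker (U s) (comp_at s (f, g)) (comp_at s (f', g')))"
    if "f \<in> X" "g \<in> X" "f' \<in> X" "g' \<in> X" for f g f' g'
    using that by (simp add: tf_def tensor_fam_def conj_ker_def comp_at_def X_def prod.distrib)
  have "perturbed K A R T \<rho> U i j = T Y (fst i) (fst j)"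
    unfolding perturbed_def Let_def ext_superop_def using Ye
    by (simp add: case_prod_beta X_def[symmetric] tf_def[symmetric])
  also have "\<dots> = (\<Sum>f\<in>X. \<Sum>f'\<in>X. Y f f' * T (unit_op f f') (fst i) (fst j))"
    using superoperator_expand[OF T] finX Yo by (simp add: X_def)
  also have "\<dots> = (\<Sum>f\<in>X. \<Sum>f'\<in>X. \<Sum>g\<in>X. \<Sum>g'\<in>X. of_nat (card X) * (\<Prod>s\<in>K. conj_ker (U s) (comp_at s (f, g)) (comp_at s (f', g')))
      * choi K A T (f, fst i) (f', fst j) * \<rho> (g, snd i) (g', snd j))"
  proof (intro sum.cong refl)
    fix f f' assume f: "f \<in> X" "f' \<in> X"
    have "T (unit_op f f') (fst i) (fst j) = of_nat (card X) * choi K A T (f, fst i) (f', fst j)"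
      using f c0 choi_entry[OF K(1) _ T, of f "fst i" f' "fst j"] K(2) by (simp add: X_def)
    then show "Y f f' * T (unit_op f f') (fst i) (fst j) = (\<Sum>g\<in>X. \<Sum>g'\<in>X. of_nat (card X) *
        (\<Prod>s\<in>K. conj_ker (U s) (comp_at s (f, g)) (comp_at s (f', g')))
        * choi K A T (f, fst i) (f', fst j) * \<rho> (g, snd i) (g', snd j))"
      unfolding Y_def using f by (simp add: tf[symmetric] sum_distrib_right sum_distrib_left mult_ac)
  qed
  also have "\<dots> = (\<Sum>f\<in>X. \<Sum>g\<in>X. \<Sum>f'\<in>X. \<Sum>g'\<in>X. of_nat (card X) * (\<Prod>s\<in>K. conj_ker (U s) (comp_at s (f, g)) (comp_at s (f', g')))
      * choi K A T (f, fst i) (f', fst j) * \<rho> (g, snd i) (g', snd j))"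
    by (rule sum.cong[OF refl], rule sum.swap)
  also have "\<dots> = contract X (\<lambda>p q. of_nat (card X) * (\<Prod>s\<in>K. conj_ker (U s) (comp_at s p) (comp_at s q))) (choi K A T) \<rho> i j"
    by (simp add: contract_def sum_times)
  finally show "perturbed K A R T \<rho> U i j = contract (PiE K A)
     (\<lambda>p q. of_nat (card (PiE K A)) * (\<Prod>s\<in>K. conj_ker (U s) (comp_at s p) (comp_at s q))) (choi K A T) \<rho> i j"
    by (simp add: X_def)
qed

subsection \<open>Smoothing\<close>

text \<open>The exponent has the shape left by unfolding \<open>H2_smooth\<close>. In the mixed case
  of \<infinity> and -\<infinity>, extended real addition returns \<infinity>, so the bound to be
  proved becomes trivial.\<close>

lemma exp2_top:
  assumes "D = \<infinity> \<or> D' = \<infinity>"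
  shows "exp2 (- (- D / 2) - - D' / 2) = \<infinity>"
  using assms by (cases D; cases D') (auto simp: exp2_def)

text \<open>Strict upper bounds for the divergences are what produces smoothed operators from an
  infimum. They can be chosen at an additive cost of \<eta>, also when a divergence is -\<infinity>:
  then one bound is arbitrary and the other makes the product equal to \<eta>.\<close>

lemma exp2_approx:
  assumes "D < \<infinity>" "D' < \<infinity>" "0 < \<eta>"
  obtains u v :: real where "D < ereal u" "D' < ereal v"
    "ennreal (2 powr (u/2) * 2 powr (v/2)) \<le> exp2 (- (- D / 2) - - D' / 2) + ennreal \<eta>"
proof -
  have prod: "2 powr (u/2) * 2 powr (v/2) = 2 powr ((u + v) / 2)" for u v :: real
    by (simp add: powr_add[symmetric] add_divide_distrib)
  have small: "ennreal (2 powr (u/2) * 2 powr (v/2)) \<le> E + ennreal \<eta>" if "u + v = 2 * log 2 \<eta>" for u v E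
    using assms(3) that by (simp add: prod)
  consider (real) a b where "D = ereal a" "D' = ereal b" | (left) "D = -\<infinity>" | (right) "D' = -\<infinity>"
    using assms(1,2) by (cases D; cases D') auto
  then show thesis
  proof cases
    case real
    define e where "e = 2 powr ((a + b) / 2)"
    have e: "0 < e" by (simp add: e_def)
    \<comment> \<open>Raising both bounds by the same amount multiplies the product by
      \<open>2 powr \<delta>\<close>, and this choice turns \<open>e\<close> into
      \<open>e + \<eta>\<close>.\<close>
    define \<delta> where "\<delta> = log 2 (1 + \<eta> / e)"
    have "1 < 1 + \<eta> / e" using e assms(3) by simp
    then have \<delta>: "0 < \<delta>" unfolding \<delta>_def log_def by (intro divide_pos_pos ln_gt_zero) auto
    have "- (- D / 2) - - D' / 2 = ereal ((a + b) / 2)" using real by (simp add: add_divide_distrib)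
    then have E: "exp2 (- (- D / 2) - - D' / 2) = ennreal e" by (simp add: exp2_def e_def)
    have "2 powr ((a + \<delta>)/2) * 2 powr ((b + \<delta>)/2) = e * 2 powr \<delta>"
      unfolding prod e_def powr_add[symmetric] by (rule arg_cong[of _ _ "(powr) 2"]) argo
    also have "2 powr \<delta> = 1 + \<eta> / e" using e assms(3) by (simp add: \<delta>_def add_pos_pos)
    also have "e * (1 + \<eta> / e) = e + \<eta>" using e by (simp add: field_simps)
    finally have "ennreal (2 powr ((a + \<delta>)/2) * 2 powr ((b + \<delta>)/2)) \<le> exp2 (- (- D / 2) - - D' / 2) + ennreal \<eta>"
      unfolding E using e assms(3) by simp
    then show thesis using that[of "a + \<delta>" "b + \<delta>"] real \<delta> by simp
  next
    case left
    obtain v where "D' < ereal v" using assms(2) by (cases D') (auto intro: that gt_ex elim!: gt_ex[THEN exE])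
    then show thesis using that[of "2 * log 2 \<eta> - v" v] small[of "2 * log 2 \<eta> - v" v] left by simp
  next
    case right
    obtain u where "D < ereal u" using assms(1) by (cases D) (auto intro: that gt_ex elim!: gt_ex[THEN exE])
    then show thesis using that[of u "2 * log 2 \<eta> - u"] small[of u "2 * log 2 \<eta> - u"] right by simp
  qed
qed

lemma schatten_norm_minus_commute:
  "schatten_norm I p (\<lambda>i j. M i j - N i j) = schatten_norm I p (\<lambda>i j. N i j - M i j)"
proof -
  have "(cnj a - cnj b) * (c - d) = (cnj b - cnj a) * (d - c)" for a b c d :: complex
    by (simp add: algebra_simps)
  then have "mult_op I (adj (\<lambda>i j. M i j - N i j)) (\<lambda>i j. M i j - N i j)
      = mult_op I (adj (\<lambda>i j. N i j - M i j)) (\<lambda>i j. N i j - M i j)"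
    unfolding mult_op_def adj_def complex_cnj_diff by presburger
  then show ?thesis by (simp add: schatten_norm_def)
qed

text \<open>A strict bound on the infimum is met by an actual candidate, without recourse to
  attainment.\<close>

lemma D2_smooth_less:
  assumes "D2_smooth \<epsilon> I \<alpha> \<beta> < ereal u"
  obtains \<alpha>' where "subnormalised I \<alpha>'" "schatten_norm I 1 (\<lambda>i j. \<alpha> i j - \<alpha>' i j) \<le> \<epsilon> * Re (trace_op I \<alpha>)"
    "D2 I \<alpha>' \<beta> < ereal u"
proof -
  obtain \<alpha>' where "subnormalised I \<alpha>'" "schatten_norm I 1 (\<alpha>' - \<alpha>) \<le> \<epsilon> * Re (trace_op I \<alpha>)" "D2 I \<alpha>' \<beta> < ereal u"
    using assms unfolding D2_smooth_def INF_less_iff by blast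
  moreover have "\<alpha>' - \<alpha> = (\<lambda>i j. \<alpha>' i j - \<alpha> i j)" by (simp add: fun_eq_iff)
  ultimately show thesis using that schatten_norm_minus_commute[of I 1 \<alpha>' \<alpha>] by simp
qed

section \<open>Decoupling with smooth entropies\<close>

context haar_family
begin

text \<open>By bilinearity, the pair \<open>t\<close>, \<open>x\<close> is replaced by
  \<open>t\<close>, \<open>x - x'\<close>, then \<open>t - t'\<close>, \<open>x'\<close>, then
  \<open>t'\<close>, \<open>x'\<close>. The first two contractions have mean trace norm at most
  2^|S| \<epsilon> each, because the factor without a difference has trace norm at most 1; the third
  is covered by \<open>decoupling_bound\<close>.\<close>

lemma smooth_decoupling_bound:
  assumes S: "S \<subseteq> K" "S \<noteq> {}" and fin: "finite B" "finite R"
    and t: "subnormalised (PiE S A \<times> B) t" and x: "subnormalised (PiE S A \<times> R) x"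
    and \<epsilon>: "0 < \<epsilon>" and \<eta>: "0 < \<eta>"
  obtains g where "g \<in> borel_measurable (PiM K \<mu>)"
    "\<And>U. ennreal (schatten_norm (B \<times> R) 1 (contract (PiE S A) (fluct_fam S A U) t x)) \<le> g U"
    "(\<integral>\<^sup>+U. g U \<partial>PiM K \<mu>) \<le> ennreal (2 * 2 ^ card S * \<epsilon>) + ennreal (2 ^ card S * D_const A S) *
        exp2 (- (H2_smooth \<epsilon> (PiE S A) R x / 2) - H2_smooth \<epsilon> (PiE S A) B t / 2) + ennreal \<eta>"
proof -
  define X where "X = PiE S A"
  have finS: "finite S" using S(1) finK finite_subset by blast
  have finX: "finite X" unfolding X_def using S(1) finS finA by (intro finite_PiE) auto
  define bB where "bB = marginal_snd X t"
  define bR where "bR = marginal_snd X x"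
  define Dx where "Dx = D2_smooth \<epsilon> (X \<times> R) x (tensor_op (id_op X) bR)"
  define Dt where "Dt = D2_smooth \<epsilon> (X \<times> B) t (tensor_op (id_op X) bB)"
  define C where "C = 2 ^ card S * D_const A S"
  \<comment> \<open>Positivity is used twice: an infinite \<open>E\<close> keeps the right-hand side
    infinite after multiplication by \<open>C\<close>, and the slack passed to
    \<open>exp2_approx\<close> is \<open>\<eta> / C\<close>.\<close>
  have C: "0 < C" unfolding C_def using moment_const_le[OF S] moment_const_pos[OF S(1)]
    by (meson less_le_trans real_sqrt_gt_zero)
  define E where "E = exp2 (- (- Dx / 2) - - Dt / 2)"
  have E: "E = exp2 (- (H2_smooth \<epsilon> (PiE S A) R x / 2) - H2_smooth \<epsilon> (PiE S A) B t / 2)"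
    by (simp add: E_def H2_smooth_def Dx_def Dt_def bB_def bR_def X_def)
  have tp: "psd (X \<times> B) t" "Re (trace_op (X \<times> B) t) \<le> 1" and xp: "psd (X \<times> R) x" "Re (trace_op (X \<times> R) x) \<le> 1"
    using t x by (auto simp: subnormalised_def X_def)
  show thesis
  proof (cases "Dx = \<infinity> \<or> Dt = \<infinity>")
    case True
    then have "E = \<infinity>" unfolding E_def by (rule exp2_top)
    then have top: "ennreal C * E = \<infinity>" using C by (simp add: ennreal_mult_top)
    show thesis
    proof (rule that[of "\<lambda>_. \<infinity>"])
      show "(\<integral>\<^sup>+U. \<infinity> \<partial>PiM K \<mu>) \<le> ennreal (2 * 2 ^ card S * \<epsilon>) + ennreal (2 ^ card S * D_const A S) *
        exp2 (- (H2_smooth \<epsilon> (PiE S A) R x / 2) - H2_smooth \<epsilon> (PiE S A) B t / 2) + ennreal \<eta>"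
        unfolding E[symmetric] C_def[symmetric] top by simp
    qed auto
  next
    case False
    then have "Dx < \<infinity>" "Dt < \<infinity>" by auto
    then obtain u v where uv: "Dx < ereal u" "Dt < ereal v"
      "ennreal (2 powr (u/2) * 2 powr (v/2)) \<le> E + ennreal (\<eta> / C)"
      using exp2_approx[of Dx Dt "\<eta> / C"] \<eta> C unfolding E_def by (metis divide_pos_pos)
    obtain x' where x': "subnormalised (X \<times> R) x'" "schatten_norm (X \<times> R) 1 (\<lambda>i j. x i j - x' i j) \<le> \<epsilon> * Re (trace_op (X \<times> R) x)"
      "D2 (X \<times> R) x' (tensor_op (id_op X) bR) < ereal u"
      using D2_smooth_less[OF uv(1)[unfolded Dx_def]] by blast
    obtain t' where t': "subnormalised (X \<times> B) t'" "schatten_norm (X \<times> B) 1 (\<lambda>i j. t i j - t' i j) \<le> \<epsilon> * Re (trace_op (X \<times> B) t)"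
      "D2 (X \<times> B) t' (tensor_op (id_op X) bB) < ereal v"
      using D2_smooth_less[OF uv(2)[unfolded Dt_def]] by blast
    have tp': "psd (X \<times> B) t'" "Re (trace_op (X \<times> B) t') \<le> 1" and xp': "psd (X \<times> R) x'" "Re (trace_op (X \<times> R) x') \<le> 1"
      using t' x' by (auto simp: subnormalised_def)
    have herm: "M \<in> opers I" "adj M = M" if "psd I M" for I and M :: "'z oper" using that by (auto simp: psd_def)
    have hermd: "(\<lambda>i j. M i j - N i j) \<in> opers I" "adj (\<lambda>i j. M i j - N i j) = (\<lambda>i j. M i j - N i j)"
      if "psd I M" "psd I N" for I and M N :: "'z oper"
      using that by (auto simp: psd_def opers_def adj_def fun_eq_iff)
    let ?c = "\<lambda>U. contract X (fluct_fam S A U)"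
    let ?dx = "\<lambda>i j. x i j - x' i j" and ?dt = "\<lambda>i j. t i j - t' i j"
    obtain g1 where g1: "g1 \<in> borel_measurable (PiM K \<mu>)"
      "\<And>U. ennreal (schatten_norm (B \<times> R) 1 (?c U t ?dx)) \<le> g1 U"
      "(\<integral>\<^sup>+U. g1 U \<partial>PiM K \<mu>) = ennreal (2 ^ card S * schatten_norm (X \<times> B) 1 t * schatten_norm (X \<times> R) 1 ?dx)"
      using fluct_trace_norm_bound[OF S(1) fin herm[OF tp(1)[unfolded X_def]] hermd[OF xp(1)[unfolded X_def] xp'(1)[unfolded X_def]]]
      unfolding X_def by blast
    obtain g2 where g2: "g2 \<in> borel_measurable (PiM K \<mu>)"
      "\<And>U. ennreal (schatten_norm (B \<times> R) 1 (?c U ?dt x')) \<le> g2 U"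
      "(\<integral>\<^sup>+U. g2 U \<partial>PiM K \<mu>) = ennreal (2 ^ card S * schatten_norm (X \<times> B) 1 ?dt * schatten_norm (X \<times> R) 1 x')"
      using fluct_trace_norm_bound[OF S(1) fin hermd[OF tp(1)[unfolded X_def] tp'(1)[unfolded X_def]] herm[OF xp'(1)[unfolded X_def]]]
      unfolding X_def by blast
    have b: "psd B bB" "Re (trace_op B bB) \<le> 1" "psd R bR" "Re (trace_op R bR) \<le> 1"
      using marginal_snd_psd[OF finX fin(1) tp(1)] marginal_snd_psd[OF finX fin(2) xp(1)] tp(2) xp(2)
      by (auto simp: bB_def bR_def trace_marginal_snd)
    obtain g3 where g3: "g3 \<in> borel_measurable (PiM K \<mu>)"
      "\<And>U. ennreal (schatten_norm (B \<times> R) 1 (?c U t' x')) \<le> g3 U"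
      "(\<integral>\<^sup>+U. g3 U \<partial>PiM K \<mu>) \<le> ennreal (C * (2 powr (u/2) * 2 powr (v/2)))"
      using decoupling_bound[OF S fin tp'(1)[unfolded X_def] xp'(1)[unfolded X_def] b t'(3)[unfolded X_def] x'(3)[unfolded X_def]]
      unfolding C_def X_def by blast
    have tri: "schatten_norm (B \<times> R) 1 (?c U t x) \<le> schatten_norm (B \<times> R) 1 (?c U t ?dx)
        + schatten_norm (B \<times> R) 1 (?c U ?dt x') + schatten_norm (B \<times> R) 1 (?c U t' x')" for U
    proof -
      have o: "?c U a y \<in> opers (B \<times> R)" "adj (?c U a y) = ?c U a y"
        if "a \<in> opers (X \<times> B)" "adj a = a" "y \<in> opers (X \<times> R)" "adj y = y" for a y
        using that by (auto intro!: contract_opers contract_hermitian fluct_fam_hermitian)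
      note o1 = o[OF herm[OF tp(1)] hermd[OF xp(1) xp'(1)]] and o2 = o[OF hermd[OF tp(1) tp'(1)] herm[OF xp'(1)]]
        and o3 = o[OF herm[OF tp'(1)] herm[OF xp'(1)]]
      have o23: "(\<lambda>i j. ?c U ?dt x' i j + ?c U t' x' i j) \<in> opers (B \<times> R)"
        "adj (\<lambda>i j. ?c U ?dt x' i j + ?c U t' x' i j) = (\<lambda>i j. ?c U ?dt x' i j + ?c U t' x' i j)"
        using o2 o3 by (auto simp: opers_def adj_def fun_eq_iff)
      have finBR: "finite (B \<times> R)" using fin by simp
      have "?c U t x = (\<lambda>i j. ?c U t ?dx i j + (?c U ?dt x' i j + ?c U t' x' i j))"
        unfolding contract_diff_left contract_diff_right by simp
      then show ?thesis
        using schatten_1_triangle[OF finBR o1 o23] schatten_1_triangle[OF finBR o2 o3] by simp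
    qed
    define g where "g = (\<lambda>U. g1 U + g2 U + g3 U)"
    have sn: "0 \<le> schatten_norm I p M" for I p and M :: "'z oper" by (simp add: schatten_norm_def)
    show thesis
    proof (rule that[of g])
      show "g \<in> borel_measurable (PiM K \<mu>)" unfolding g_def using g1(1) g2(1) g3(1) by measurable
      show "ennreal (schatten_norm (B \<times> R) 1 (contract (PiE S A) (fluct_fam S A U) t x)) \<le> g U" for U
      proof -
        have "ennreal (schatten_norm (B \<times> R) 1 (?c U t x)) \<le> ennreal (schatten_norm (B \<times> R) 1 (?c U t ?dx))
          + ennreal (schatten_norm (B \<times> R) 1 (?c U ?dt x')) + ennreal (schatten_norm (B \<times> R) 1 (?c U t' x'))"
          using ennreal_leI[OF tri[of U]] by (simp add: sn)
        also have "\<dots> \<le> g U" unfolding g_def by (intro add_mono g1(2) g2(2) g3(2))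
        finally show ?thesis by (simp add: X_def)
      qed
      have 1: "(\<integral>\<^sup>+U. g1 U \<partial>PiM K \<mu>) \<le> ennreal (2 ^ card S * \<epsilon>)"
      proof -
        have "schatten_norm (X \<times> B) 1 t \<le> 1" using schatten_1_psd[OF _ tp(1)] tp(2) finX fin by force
        moreover have "schatten_norm (X \<times> R) 1 ?dx \<le> \<epsilon>"
          using x'(2) mult_left_mono[OF xp(2) less_imp_le[OF \<epsilon>]] by linarith
        ultimately have "schatten_norm (X \<times> B) 1 t * schatten_norm (X \<times> R) 1 ?dx \<le> 1 * \<epsilon>"
          by (intro mult_mono sn) auto
        then show ?thesis unfolding g1(3) by (intro ennreal_leI) (simp add: mult.assoc)
      qed
      have 2: "(\<integral>\<^sup>+U. g2 U \<partial>PiM K \<mu>) \<le> ennreal (2 ^ card S * \<epsilon>)"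
      proof -
        have "schatten_norm (X \<times> R) 1 x' \<le> 1" using schatten_1_psd[OF _ xp'(1)] xp'(2) finX fin by force
        moreover have "schatten_norm (X \<times> B) 1 ?dt \<le> \<epsilon>"
          using t'(2) mult_left_mono[OF tp(2) less_imp_le[OF \<epsilon>]] by linarith
        ultimately have "schatten_norm (X \<times> B) 1 ?dt * schatten_norm (X \<times> R) 1 x' \<le> \<epsilon> * 1"
          using \<epsilon> by (intro mult_mono sn) auto
        then show ?thesis unfolding g2(3) by (intro ennreal_leI) (simp add: mult.assoc)
      qed
      have 3: "(\<integral>\<^sup>+U. g3 U \<partial>PiM K \<mu>) \<le> ennreal C * E + ennreal \<eta>"
      proof -
        have "ennreal (C * (2 powr (u/2) * 2 powr (v/2))) = ennreal C * ennreal (2 powr (u/2) * 2 powr (v/2))"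
          using C by (simp add: ennreal_mult)
        also have "\<dots> \<le> ennreal C * (E + ennreal (\<eta> / C))" by (intro mult_left_mono uv(3)) simp
        also have "\<dots> = ennreal C * E + ennreal \<eta>"
          using C \<eta> by (simp add: distrib_left ennreal_mult[symmetric])
        finally show ?thesis using g3(3) by (rule order_trans[rotated])
      qed
      have "(\<integral>\<^sup>+U. g U \<partial>PiM K \<mu>) = (\<integral>\<^sup>+U. g1 U \<partial>PiM K \<mu>) + (\<integral>\<^sup>+U. g2 U \<partial>PiM K \<mu>) + (\<integral>\<^sup>+U. g3 U \<partial>PiM K \<mu>)"
        unfolding g_def using g1(1) g2(1) g3(1) by (simp add: nn_integral_add)
      also have "\<dots> \<le> ennreal (2 ^ card S * \<epsilon>) + ennreal (2 ^ card S * \<epsilon>) + (ennreal C * E + ennreal \<eta>)"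
        by (intro add_mono 1 2 3)
      also have "\<dots> = ennreal (2 * 2 ^ card S * \<epsilon>) + ennreal C * E + ennreal \<eta>"
        using \<epsilon> by (simp add: add.assoc flip: ennreal_plus)
      finally show "(\<integral>\<^sup>+U. g U \<partial>PiM K \<mu>) \<le> ennreal (2 * 2 ^ card S * \<epsilon>) + ennreal (2 ^ card S * D_const A S) *
        exp2 (- (H2_smooth \<epsilon> (PiE S A) R x / 2) - H2_smooth \<epsilon> (PiE S A) B t / 2) + ennreal \<eta>"
        unfolding E[symmetric] C_def[symmetric] .
    qed
  qed
qed

lemma smooth_decoupling:
  fixes B :: "'b set" and R :: "'r set"
  assumes fin: "finite B" "finite R" and \<epsilon>: "0 < \<epsilon>"
    and T: "superoperator (PiE K A) B T" "completely_positive (PiE K A) B T" "trace_nonincreasing (PiE K A) B T"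
    and \<rho>: "subnormalised (PiE K A \<times> R) \<rho>"
  defines "\<tau> \<equiv> choi K A T"
  shows "(\<integral>\<^sup>+ U. ennreal (schatten_norm (B \<times> R) 1
            (perturbed K A R T \<rho> U - tensor_op (marginal_snd (PiE K A) \<tau>) (marginal_snd (PiE K A) \<rho>))) \<partial>(PiM K \<mu>))
       \<le> ennreal (2 * (3 ^ card K - 1) * \<epsilon>) + (\<Sum>S\<in>Pow K - {{}}. ennreal (2 ^ card S * D_const A S) *
            exp2 (- (H2_smooth \<epsilon> (PiE S A) R (marginal_fam K S A \<rho>) / 2)
                  - H2_smooth \<epsilon> (PiE S A) B (marginal_fam K S A \<tau>) / 2))"
proof (rule ennreal_le_epsilon)
  fix e :: real assume e: "0 < e"
  define P where "P = Pow K - {{}}"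
  have finP: "finite P" using finK by (simp add: P_def)
  \<comment> \<open>One share of the slack for each set in \<open>P\<close>; the added 1 keeps the
    denominator positive.\<close>
  define \<eta> where "\<eta> = e / (card P + 1)"
  have \<eta>: "0 < \<eta>" using e by (simp add: \<eta>_def)
  define X where "X = PiE K A"
  have finX: "finite X" unfolding X_def using finK finA by (intro finite_PiE)
  have A: "finite (A s) \<and> card (A s) \<noteq> 0" if "s \<in> K" for s using finA[OF that] cardA[OF that] by auto
  have \<rho>p: "psd (X \<times> R) \<rho>" "Re (trace_op (X \<times> R) \<rho>) \<le> 1" using \<rho> by (auto simp: subnormalised_def X_def)
  have \<tau>p: "psd (X \<times> B) \<tau>" "Re (trace_op (X \<times> B) \<tau>) \<le> 1"
    using choi_psd[OF finK finA fin(1) T(1,2)] choi_trace[OF finK finA T(1,3)] by (simp_all add: X_def \<tau>_def)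
  have m: "subnormalised (PiE S A \<times> B) (marginal_fam K S A \<tau>)" "subnormalised (PiE S A \<times> R) (marginal_fam K S A \<rho>)"
    if "S \<in> P" for S
    using that \<rho>p \<tau>p finX fin unfolding X_def
    by (auto simp: subnormalised_def P_def trace_marginal_fam intro!: marginal_fam_psd)
  define c where "c = (\<lambda>S U. contract (PiE S A) (fluct_fam S A U) (marginal_fam K S A \<tau>) (marginal_fam K S A \<rho>))"
  define b where "b = (\<lambda>S. ennreal (2 ^ card S * D_const A S) *
            exp2 (- (H2_smooth \<epsilon> (PiE S A) R (marginal_fam K S A \<rho>) / 2)
                  - H2_smooth \<epsilon> (PiE S A) B (marginal_fam K S A \<tau>) / 2))"
  have "\<exists>g. g \<in> borel_measurable (PiM K \<mu>) \<and> (\<forall>U. ennreal (schatten_norm (B \<times> R) 1 (c S U)) \<le> g U) \<and>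
      (\<integral>\<^sup>+U. g U \<partial>PiM K \<mu>) \<le> ennreal (2 * 2 ^ card S * \<epsilon>) + b S + ennreal \<eta>" if "S \<in> P" for S
  proof -
    have S: "S \<subseteq> K" "S \<noteq> {}" using that by (auto simp: P_def)
    show ?thesis
      unfolding c_def b_def by (rule smooth_decoupling_bound[OF S fin m[OF that] \<epsilon> \<eta>]) blast
  qed
  then obtain g where g: "\<And>S. S \<in> P \<Longrightarrow> g S \<in> borel_measurable (PiM K \<mu>)"
    "\<And>S U. S \<in> P \<Longrightarrow> ennreal (schatten_norm (B \<times> R) 1 (c S U)) \<le> g S U"
    "\<And>S. S \<in> P \<Longrightarrow> (\<integral>\<^sup>+U. g S U \<partial>PiM K \<mu>) \<le> ennreal (2 * 2 ^ card S * \<epsilon>) + b S + ennreal \<eta>"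
    by metis
  have diff: "perturbed K A R T \<rho> U - tensor_op (marginal_snd (PiE K A) \<tau>) (marginal_snd (PiE K A) \<rho>)
      = (\<lambda>i j. \<Sum>S\<in>P. c S U i j)" for U
  proof -
    have "perturbed K A R T \<rho> U = (\<lambda>i j. \<Sum>S\<in>Pow K. c S U i j)"
      unfolding \<tau>_def c_def
      using perturbed_eq[OF finK A fin(2) T(1)] \<rho>p(1) fluctuation_decomposition[OF finK A]
      by (simp add: psd_def X_def)
    also have "\<dots> = (\<lambda>i j. c {} U i j + (\<Sum>S\<in>P. c S U i j))"
      unfolding P_def using finK by (subst sum.remove[of _ "{}"]) auto
    moreover have "c {} U = tensor_op (marginal_snd (PiE K A) \<tau>) (marginal_snd (PiE K A) \<rho>)"
      unfolding c_def by (rule contract_empty)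
    ultimately show ?thesis by (simp add: fun_eq_iff)
  qed
  have co: "c S U \<in> opers (B \<times> R)" "adj (c S U) = c S U" if "S \<in> P" for S U
    using m[OF that] unfolding c_def
    by (auto simp: subnormalised_def psd_def intro!: contract_opers contract_hermitian fluct_fam_hermitian)
  have sn: "0 \<le> schatten_norm I p M" for I p and M :: "'z oper" by (simp add: schatten_norm_def)
  have "(\<integral>\<^sup>+ U. ennreal (schatten_norm (B \<times> R) 1
            (perturbed K A R T \<rho> U - tensor_op (marginal_snd (PiE K A) \<tau>) (marginal_snd (PiE K A) \<rho>))) \<partial>(PiM K \<mu>))
      \<le> (\<integral>\<^sup>+ U. (\<Sum>S\<in>P. g S U) \<partial>PiM K \<mu>)"
  proof (rule nn_integral_mono)
    fix U
    have "schatten_norm (B \<times> R) 1 (\<lambda>i j. \<Sum>S\<in>P. c S U i j) \<le> (\<Sum>S\<in>P. schatten_norm (B \<times> R) 1 (c S U))"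
      using fin finP co by (intro schatten_1_sum) auto
    then have "ennreal (schatten_norm (B \<times> R) 1 (\<lambda>i j. \<Sum>S\<in>P. c S U i j)) \<le> (\<Sum>S\<in>P. ennreal (schatten_norm (B \<times> R) 1 (c S U)))"
      by (simp add: sn ennreal_leI)
    also have "\<dots> \<le> (\<Sum>S\<in>P. g S U)" by (intro sum_mono g(2))
    finally show "ennreal (schatten_norm (B \<times> R) 1 (perturbed K A R T \<rho> U
        - tensor_op (marginal_snd (PiE K A) \<tau>) (marginal_snd (PiE K A) \<rho>))) \<le> (\<Sum>S\<in>P. g S U)"
      unfolding diff .
  qed
  also have "\<dots> = (\<Sum>S\<in>P. \<integral>\<^sup>+ U. g S U \<partial>PiM K \<mu>)" using g(1) by (rule nn_integral_sum)
  also have "\<dots> \<le> (\<Sum>S\<in>P. ennreal (2 * 2 ^ card S * \<epsilon>) + b S + ennreal \<eta>)" by (intro sum_mono g(3))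
  also have "\<dots> = ennreal (\<Sum>S\<in>P. 2 * 2 ^ card S * \<epsilon>) + (\<Sum>S\<in>P. b S) + (\<Sum>S\<in>P. ennreal \<eta>)"
    using \<epsilon> by (simp add: sum.distrib del: sum_constant)
  also have "(\<Sum>S\<in>P. 2 * 2 ^ card S * \<epsilon>) = 2 * (3 ^ card K - 1) * \<epsilon>"
  proof -
    \<comment> \<open>The expansion of (2 + 1)^|K| over the subsets of \<open>K\<close>; removing
      the empty set subtracts 1.\<close>
    have "(\<Sum>S\<in>Pow K. (2::real) ^ card S) = 3 ^ card K"
      using prod_add[OF finK, of "\<lambda>_. 2 :: real" "\<lambda>_. 1"] by simp
    then have "(\<Sum>S\<in>P. (2::real) ^ card S) = 3 ^ card K - 1"
      unfolding P_def using finK by (subst (asm) sum.remove[of _ "{}"]) auto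
    then show ?thesis by (simp flip: sum_distrib_left sum_distrib_right)
  qed
  also have "ennreal (2 * (3 ^ card K - 1) * \<epsilon>) + (\<Sum>S\<in>P. b S) + (\<Sum>S\<in>P. ennreal \<eta>)
      \<le> ennreal (2 * (3 ^ card K - 1) * \<epsilon>) + (\<Sum>S\<in>P. b S) + ennreal e"
  proof (rule add_left_mono)
    have "real (card P) * \<eta> \<le> e" using e by (simp add: \<eta>_def field_simps)
    moreover have "(\<Sum>S\<in>P. ennreal \<eta>) = ennreal (real (card P) * \<eta>)"
      using \<eta> by (simp add: ennreal_mult ennreal_of_nat_eq_real_of_nat)
    ultimately show "(\<Sum>S\<in>P. ennreal \<eta>) \<le> ennreal e" by (simp add: ennreal_leI)
  qed
  finally show "(\<integral>\<^sup>+ U. ennreal (schatten_norm (B \<times> R) 1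
            (perturbed K A R T \<rho> U - tensor_op (marginal_snd (PiE K A) \<tau>) (marginal_snd (PiE K A) \<rho>))) \<partial>(PiM K \<mu>))
       \<le> ennreal (2 * (3 ^ card K - 1) * \<epsilon>) + (\<Sum>S\<in>Pow K - {{}}. ennreal (2 ^ card S * D_const A S) *
            exp2 (- (H2_smooth \<epsilon> (PiE S A) R (marginal_fam K S A \<rho>) / 2)
                  - H2_smooth \<epsilon> (PiE S A) B (marginal_fam K S A \<tau>) / 2)) + ennreal e"
    unfolding P_def b_def .
qed

end

theorem theorem6:
  fixes k :: nat
    and A :: "nat \<Rightarrow> 'a set" and B :: "'b set" and R :: "'r set"
    and T :: "(nat \<Rightarrow> 'a, 'b) superoper"
    and \<rho> :: "((nat \<Rightarrow> 'a) \<times> 'r) oper"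
    and \<tau> :: "((nat \<Rightarrow> 'a) \<times> 'b) oper"
    and \<mu> :: "nat \<Rightarrow> 'a oper measure"
    and \<epsilon> :: real
  assumes "0 < k"
    and "\<And>s. s \<in> {1..k} \<Longrightarrow> finite (A s) \<and> 2 \<le> card (A s)"
    and "finite B" and "finite R"
    and "superoperator (PiE {1..k} A) B T"
    and "completely_positive (PiE {1..k} A) B T"
    and "trace_nonincreasing (PiE {1..k} A) B T"
    and "\<tau> = choi {1..k} A T"
    and "subnormalised (PiE {1..k} A \<times> R) \<rho>"
    and "\<And>s. s \<in> {1..k} \<Longrightarrow> haar_measure (A s) (\<mu> s)"
    and "0 < \<epsilon>" and "\<epsilon> < 1"
  shows "(\<integral>\<^sup>+ U. ennreal (schatten_norm (B \<times> R) 1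
            (perturbed {1..k} A R T \<rho> U -
             tensor_op (marginal_snd (PiE {1..k} A) \<tau>) (marginal_snd (PiE {1..k} A) \<rho>)))
          \<partial>(PiM {1..k} \<mu>))
       \<le> ennreal (2 * (3 ^ k - 1) * \<epsilon>) +
         (\<Sum>S | S \<noteq> {} \<and> S \<subseteq> {1..k}.
            ennreal (2 ^ card S * D_const A S) *
            exp2 (- (H2_smooth \<epsilon> (PiE S A) R (marginal_fam {1..k} S A \<rho>) / 2)
                  - H2_smooth \<epsilon> (PiE S A) B (marginal_fam {1..k} S A \<tau>) / 2))"
proof -
  \<comment> \<open>\<open>haar_family\<close> requires a probability measure at every natural
    number, while the assumptions concern only the indices up to \<open>k\<close>. Point masses
    elsewhere do not change the product over these indices.\<close>
  define \<mu>' where "\<mu>' = (\<lambda>s. if s \<in> {1..k} then \<mu> s else return (count_space UNIV) undefined)"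
  interpret haar_family "{1..k}" A \<mu>'
  proof (rule haar_family.intro)
    show "finite {1..k}" by simp
    show "haar_unitary (A s) (\<mu>' s)" if "s \<in> {1..k}" for s
      using assms(2,10)[OF that] that by (auto simp: haar_unitary_def \<mu>'_def)
    show "prob_space (\<mu>' s)" for s
      using assms(10)[of s] by (auto simp: \<mu>'_def haar_measure_def intro: prob_space_return)
  qed
  have "PiM {1..k} \<mu> = PiM {1..k} \<mu>'" by (intro PiM_cong) (auto simp: \<mu>'_def)
  moreover have "{S. S \<noteq> {} \<and> S \<subseteq> {1..k}} = Pow {1..k} - {{}}" by auto
  ultimately show ?thesis
    using smooth_decoupling[OF assms(3,4,11,5,6,7,9)] assms(8) by simp
qed

end
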